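(* Let $l>0$ and let $\mathcal C_l=S^1\times[0,l]$ be the cylinder with boundary $\Sigma=\Sigma_1\cup\Sigma_2$. For each integer $m\ge1$ there exist positive constants $d_{m,l}$ (depending only on $m$ and $l$) and $d'_m$ (depending only on $m$) such that for every positive function $a\in C^\infty(\Sigma;\mathbb R_+)$, $$\|a^m\|^2_{H^{m+\frac12}(\Sigma)}\le d_{m,l}\Big(\operatorname{Tr}\big((a\Lambda)^2-(aD)^2\big)\Big)^m+d'_m\operatorname{Tr}\big((a\Lambda)^{2m}-(aD)^{2m}\big).$$
   Context: $\mathcal C_l$ carries the metric $g_0=dt^2+d\theta^2$ with $S^1$ of length $2\pi$ and angular coordinate $\theta$. $\Lambda$ is the Dirichlet-to-Neumann operator of $(\mathcal C_l,g_0)$ on $\Sigma$: $\Lambda f=\partial_n(\mathcal Hf)|_\Sigma$, with $\mathcal Hf$ the harmonic extension and $n$ the outward unit normal. $D=\frac1{\sqrt{-1}}\partial_\theta$ on each component of $\Sigma$. The operators $(a\Lambda)^{2m}-(aD)^{2m}$ are smoothing, hence trace class. On a unit circle, $\|b\|_{H^s}^2=\sum_{k\in\mathbb Z}(1+|k|^{2s})|\hat b_k|^2$ for $b=\sum_k\hat b_ke^{\sqrt{-1}k\theta}$; the squared norm on $H^s(\Sigma)$ is the sum of the squared norms over the two components $\Sigma_1,\Sigma_2$. *)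

theory Defs
  imports "HOL-Analysis.Analysis"
begin

text \<open>
  The circle of length \<open>2\<pi>\<close> is \<open>\<real>/2\<pi>\<int>\<close>: a function on it is a \<open>2\<pi>\<close>-periodic function of the
  angular coordinate \<open>\<theta>\<close>.  The boundary of the cylinder is a pair of circles, so a function on it
  is a family, indexed by the two components, of \<open>2\<pi>\<close>-periodic functions.  A function on the
  cylinder is a function of \<open>(\<theta>, t)\<close> that is \<open>2\<pi>\<close>-periodic in \<open>\<theta>\<close> for \<open>0 \<le> t \<le> l\<close>; its values for
  \<open>t\<close> outside \<open>[0, l]\<close> are irrelevant.
\<close>

datatype bdry = Lower | Upper

type_synonym 'a bdry_fun = "bdry \<Rightarrow> real \<Rightarrow> 'a"

fun height :: "real \<Rightarrow> bdry \<Rightarrow> real" where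
  "height l Lower = 0"
| "height l Upper = l"

definition smooth_circle :: "(real \<Rightarrow> 'a::real_normed_vector) \<Rightarrow> bool" where
  "smooth_circle f \<longleftrightarrow>
     (\<forall>x. f (x + 2 * pi) = f x) \<and>
     (\<forall>n x. ((\<lambda>g x. vector_derivative g (at x)) ^^ n) f differentiable at x)"

definition smooth_bdry :: "'a::real_normed_vector bdry_fun \<Rightarrow> bool" where
  "smooth_bdry f \<longleftrightarrow> (\<forall>i. smooth_circle (f i))"

subsection \<open>Harmonic extension and the Dirichlet-to-Neumann operator\<close>

definition partial_theta :: "(real \<times> real \<Rightarrow> complex) \<Rightarrow> real \<times> real \<Rightarrow> complex" where
  "partial_theta u = (\<lambda>(\<theta>, t). vector_derivative (\<lambda>s. u (s, t)) (at \<theta>))"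

definition partial_t :: "(real \<times> real \<Rightarrow> complex) \<Rightarrow> real \<times> real \<Rightarrow> complex" where
  "partial_t u = (\<lambda>(\<theta>, t). vector_derivative (\<lambda>s. u (\<theta>, s)) (at t))"

definition C1_on :: "(real \<times> real) set \<Rightarrow> (real \<times> real \<Rightarrow> complex) \<Rightarrow> bool" where
  "C1_on S u \<longleftrightarrow>
     (\<forall>(\<theta>, t) \<in> S. (\<lambda>s. u (s, t)) differentiable at \<theta> \<and> (\<lambda>s. u (\<theta>, s)) differentiable at t) \<and>
     continuous_on S (partial_theta u) \<and> continuous_on S (partial_t u)"

definition C2_on :: "(real \<times> real) set \<Rightarrow> (real \<times> real \<Rightarrow> complex) \<Rightarrow> bool" where
  "C2_on S u \<longleftrightarrow> C1_on S u \<and> C1_on S (partial_theta u) \<and> C1_on S (partial_t u)"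

definition laplacian :: "(real \<times> real \<Rightarrow> complex) \<Rightarrow> real \<times> real \<Rightarrow> complex" where
  "laplacian u p = partial_theta (partial_theta u) p + partial_t (partial_t u) p"

definition is_harmonic_extension :: "real \<Rightarrow> complex bdry_fun \<Rightarrow> (real \<times> real \<Rightarrow> complex) \<Rightarrow> bool" where
  "is_harmonic_extension l f u \<longleftrightarrow>
     (\<forall>\<theta>. \<forall>t\<in>{0..l}. u (\<theta> + 2 * pi, t) = u (\<theta>, t)) \<and>
     continuous_on (UNIV \<times> {0..l}) u \<and>
     C2_on (UNIV \<times> {0<..<l}) u \<and>
     (\<forall>p \<in> UNIV \<times> {0<..<l}. laplacian u p = 0) \<and>
     (\<forall>i \<theta>. u (\<theta>, height l i) = f i \<theta>)"

text \<open>
  For continuous \<open>f\<close> the harmonic extension is unique on the closed cylinder by the maximum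
  principle; only its values off the cylinder are left to the choice operator, and these do not
  enter the one-sided normal derivatives below.
\<close>

definition harmonic_extension :: "real \<Rightarrow> complex bdry_fun \<Rightarrow> real \<times> real \<Rightarrow> complex" where
  "harmonic_extension l f = (SOME u. is_harmonic_extension l f u)"

text \<open>The outward unit normal is \<open>-\<partial>\<^sub>t\<close> on the component \<open>t = 0\<close> and \<open>\<partial>\<^sub>t\<close> on \<open>t = l\<close>.\<close>

fun normal_sign :: "bdry \<Rightarrow> complex" where
  "normal_sign Lower = -1"
| "normal_sign Upper = 1"

definition DN :: "real \<Rightarrow> complex bdry_fun \<Rightarrow> complex bdry_fun" where
  "DN l f = (\<lambda>i \<theta>. normal_sign i *
     vector_derivative (\<lambda>t. harmonic_extension l f (\<theta>, t)) (at (height l i) within {0..l}))"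

definition D_op :: "complex bdry_fun \<Rightarrow> complex bdry_fun" where
  "D_op f = (\<lambda>i \<theta>. (1 / \<i>) * vector_derivative (f i) (at \<theta>))"

definition mult_op ::
  "real bdry_fun \<Rightarrow> (complex bdry_fun \<Rightarrow> complex bdry_fun) \<Rightarrow> complex bdry_fun \<Rightarrow> complex bdry_fun" where
  "mult_op a T f = (\<lambda>i \<theta>. complex_of_real (a i \<theta>) * T f i \<theta>)"

definition power_diff :: "real \<Rightarrow> real bdry_fun \<Rightarrow> nat \<Rightarrow> complex bdry_fun \<Rightarrow> complex bdry_fun" where
  "power_diff l a n f =
     (\<lambda>i \<theta>. (mult_op a (DN l) ^^ n) f i \<theta> - (mult_op a D_op ^^ n) f i \<theta>)"

subsection \<open>Trace\<close>

definition L2_inner :: "complex bdry_fun \<Rightarrow> complex bdry_fun \<Rightarrow> complex" where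
  "L2_inner f g = (\<Sum>i\<in>{Lower, Upper}. integral {0..2 * pi} (\<lambda>\<theta>. f i \<theta> * cnj (g i \<theta>)))"

definition fourier_basis :: "bdry \<times> int \<Rightarrow> complex bdry_fun" where
  "fourier_basis = (\<lambda>(i, k) j \<theta>. if j = i then cis (of_int k * \<theta>) / sqrt (2 * pi) else 0)"

text \<open>
  The trace of a trace class operator on \<open>L\<^sup>2\<close> of the boundary is \<open>\<Sum> \<langle>T e, e\<rangle>\<close> over any orthonormal
  basis; the basis used here consists of smooth functions, so that \<open>T\<close> need only be given on
  these.
\<close>

definition op_trace :: "(complex bdry_fun \<Rightarrow> complex bdry_fun) \<Rightarrow> complex" where
  "op_trace T = (\<Sum>\<^sub>\<infinity>p. L2_inner (T (fourier_basis p)) (fourier_basis p))"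

subsection \<open>Sobolev norms\<close>

definition fourier_coeff :: "(real \<Rightarrow> complex) \<Rightarrow> int \<Rightarrow> complex" where
  "fourier_coeff b k = integral {0..2 * pi} (\<lambda>\<theta>. b \<theta> * cis (- of_int k * \<theta>)) / (2 * pi)"

text \<open>Used for \<open>s > 0\<close> only, where \<open>0 powr (2 * s) = 0\<close> is the intended weight at \<open>k = 0\<close>.\<close>

definition circle_sobolev_norm_sq :: "real \<Rightarrow> (real \<Rightarrow> complex) \<Rightarrow> real" where
  "circle_sobolev_norm_sq s b =
     (\<Sum>\<^sub>\<infinity>k. (1 + \<bar>real_of_int k\<bar> powr (2 * s)) * (norm (fourier_coeff b k))\<^sup>2)"

definition sobolev_norm_sq :: "real \<Rightarrow> complex bdry_fun \<Rightarrow> real" where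
  "sobolev_norm_sq s f = (\<Sum>i\<in>{Lower, Upper}. circle_sobolev_norm_sq s (f i))"

end

theory Submission
  imports Defs
begin

text \<open>
  On the \<open>k\<close>-th Fourier mode \<open>\<Lambda>\<close> is a \<open>2 \<times> 2\<close> matrix acting on the two boundary components, with
  diagonal entries \<open>|k| coth (|k| l)\<close> and off-diagonal entries \<open>- |k| / sinh (|k| l)\<close>.  It has the
  explicit square root \<open>G\<close> with entries \<open>\<alpha>\<close> on and \<open>-\<beta>\<close> off the diagonal, where
  \<open>\<alpha>\<^sup>2 - \<beta>\<^sup>2 = |k|\<close> and \<open>\<beta> = exp (- |k| l) \<alpha>\<close>.  Let \<open>J\<close> be \<open>1\<close> on one component and \<open>-1\<close> on the
  other, and \<open>K = J sgn D\<close>.  Then \<open>G G = \<Lambda>\<close> and \<open>G K G = J D\<close>.  Since \<open>J\<close> commutes with \<open>a\<close> and \<open>D\<close>,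
  cyclicity of the trace turns \<open>(a\<Lambda>)\<^sup>2\<^sup>m\<close> and \<open>(aD)\<^sup>2\<^sup>m\<close> into \<open>H\<^sup>2\<^sup>m\<close> and \<open>(HK)\<^sup>2\<^sup>m\<close> for the self-adjoint
  \<open>H = G a G\<close>, with \<open>K\<close> a self-adjoint involution.

  For such a pair, repeated use of the Cauchy-Schwarz inequality for the Hilbert-Schmidt inner
  product gives \<open>Tr H\<^sup>2\<^sup>m \<ge> \<parallel>(HK)\<^sup>m\<^sup>-\<^sup>1 H\<parallel>\<^sup>2\<close> (\<open>hs_sq_le_trace_power\<close>), while \<open>Tr (HK)\<^sup>2\<^sup>m\<close> is the same sum of
  squares with the signs of \<open>K\<close>.  So the trace difference is at least
  \<open>\<Sum> (1 - \<kappa>\<^sub>p \<kappa>\<^sub>q) |E\<^sub>p\<^sub>q|\<^sup>2\<close> with \<open>E = (HK)\<^sup>m\<^sup>-\<^sup>1 H = G (aDJ)\<^sup>m\<^sup>-\<^sup>1 a G\<close>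
  (\<open>trace_power_difference\<close>).  The individual traces are infinite, so this is done for the truncations
  to finitely many modes.  The difference survives the limit because \<open>a\<Lambda>\<close> and \<open>aD sgn D\<close> differ by
  a matrix that decays rapidly in both indices, and commutators with \<open>sgn D\<close> decay in the same way
  (\<open>smoothing_power_diff\<close>, \<open>trace_limit\<close>, \<open>op_trace_lower_bound\<close>).

  The entries of \<open>E\<close> that join a positive to a negative frequency carry the Sobolev norm.  The
  entry of \<open>(aD)\<^sup>m\<^sup>-\<^sup>1 a\<close> from \<open>n\<close> to \<open>n + N\<close> is a polynomial in \<open>n\<close> of degree \<open>m - 1\<close> whose leading
  coefficient is the \<open>N\<close>-th Fourier coefficient of \<open>a\<^sup>m\<close> (\<open>core_entry\<close>).  Finite differences with a
  step proportional to \<open>N\<close> bound a weighted sum of its squares over \<open>-N < n < 0\<close> below by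
  \<open>N\<^sup>2\<^sup>m\<^sup>+\<^sup>1\<close> times the square of that coefficient (\<open>weighted_polynomial_lower_bound\<close>).  The conjugation
  by \<open>G\<close> costs nothing there, whatever \<open>l\<close> is (\<open>root_product_lower_bound\<close>), so the constant
  of the high modes depends on \<open>m\<close> only (\<open>high_modes\<close>).

  The finitely many remaining coefficients of \<open>a\<^sup>m\<close> are at most \<open>(\<Sum> |a\<^sub>k|)\<^sup>m\<close>, and the case \<open>m = 1\<close> of
  the same trace bound controls \<open>\<Sum> (1 + k\<^sup>2) |a\<^sub>k|\<^sup>2\<close>.  The mean values of \<open>a\<close> enter through the entry of
  \<open>E\<close> that joins the two components at frequency \<open>0\<close>.  It contains their sum, and positivity of \<open>a\<close>
  excludes cancellation (\<open>zero_mode\<close>).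
\<close>

section \<open>Traces of words in a matrix and its sign twist\<close>

type_synonym 'a mat = "'a \<Rightarrow> 'a \<Rightarrow> complex"

text \<open>
  Products and traces are taken over an index set \<open>I\<close>, so that one definition covers the full operator
  (\<open>I = UNIV\<close>) and its truncations.
\<close>
definition matmul :: "'a set \<Rightarrow> 'a mat \<Rightarrow> 'a mat \<Rightarrow> 'a mat" where
  "matmul I X Y = (\<lambda>p q. \<Sum>\<^sub>\<infinity>r\<in>I. X p r * Y r q)"

definition idmat :: "'a mat" where
  "idmat = (\<lambda>p q. if p = q then 1 else 0)"

definition matprod :: "'a set \<Rightarrow> 'a mat list \<Rightarrow> 'a mat" where
  "matprod I Ms = foldr (matmul I) Ms idmat"

definition mtrace :: "'a set \<Rightarrow> 'a mat \<Rightarrow> complex" where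
  "mtrace I X = (\<Sum>\<^sub>\<infinity>p\<in>I. X p p)"

lemma matprod_Nil [simp]: "matprod I [] = idmat"
  and matprod_Cons: "matprod I (M # Ms) = matmul I M (matprod I Ms)"
  by (simp_all add: matprod_def)

lemma matmul_finite: "finite I \<Longrightarrow> matmul I X Y p q = (\<Sum>r\<in>I. X p r * Y r q)"
  by (simp add: matmul_def)

lemma mtrace_finite: "finite I \<Longrightarrow> mtrace I X = (\<Sum>p\<in>I. X p p)"
  by (simp add: mtrace_def)

lemma matmul_idmat:
  assumes "finite I" "q \<in> I" shows "matmul I X idmat p q = X p q"
proof -
  have "(\<Sum>r\<in>I. X p r * (if r = q then 1 else 0)) = (\<Sum>r\<in>I. if r = q then X p r else 0)"
    by (intro sum.cong) auto
  with assms show ?thesis by (simp add: matmul_finite idmat_def)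
qed

lemma matmul_assoc:
  assumes "finite I" shows "matmul I (matmul I X Y) Z = matmul I X (matmul I Y Z)"
proof (intro ext)
  fix p q
  have "matmul I (matmul I X Y) Z p q = (\<Sum>r\<in>I. \<Sum>s\<in>I. X p s * Y s r * Z r q)"
    using assms by (simp add: matmul_finite sum_distrib_right)
  also have "\<dots> = (\<Sum>s\<in>I. \<Sum>r\<in>I. X p s * Y s r * Z r q)" by (rule sum.swap)
  also have "\<dots> = matmul I X (matmul I Y Z) p q"
    using assms by (simp add: matmul_finite sum_distrib_left mult.assoc)
  finally show "matmul I (matmul I X Y) Z p q = matmul I X (matmul I Y Z) p q" .
qed

lemma matprod_append:
  assumes "finite I" "p \<in> I"
  shows "matprod I (Ms @ Ns) p q = (\<Sum>r\<in>I. matprod I Ms p r * matprod I Ns r q)"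
  using assms(2)
proof (induction Ms arbitrary: p)
  case Nil
  have "(\<Sum>r\<in>I. (if p = r then 1 else 0) * matprod I Ns r q)
      = (\<Sum>r\<in>I. if p = r then matprod I Ns r q else 0)"
    by (intro sum.cong) auto
  with Nil assms(1) show ?case by (simp add: idmat_def)
next
  case (Cons M Ms)
  have "matprod I ((M # Ms) @ Ns) p q
      = (\<Sum>s\<in>I. \<Sum>r\<in>I. M p s * matprod I Ms s r * matprod I Ns r q)"
    using assms(1) Cons.IH by (simp add: matprod_Cons matmul_finite sum_distrib_left mult.assoc)
  also have "\<dots> = (\<Sum>r\<in>I. \<Sum>s\<in>I. M p s * matprod I Ms s r * matprod I Ns r q)"
    by (rule sum.swap)
  finally show ?case
    using assms(1) by (simp add: matprod_Cons matmul_finite sum_distrib_right)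
qed

lemma mtrace_matprod_append:
  assumes "finite I"
  shows "mtrace I (matprod I (Ms @ Ns))
    = (\<Sum>p\<in>I. \<Sum>q\<in>I. matprod I Ms p q * matprod I Ns q p)"
  using assms by (simp add: mtrace_finite matprod_append)

lemma mtrace_matprod_rotate:
  assumes "finite I"
  shows "mtrace I (matprod I (Ms @ Ns)) = mtrace I (matprod I (Ns @ Ms))"
  using assms unfolding mtrace_matprod_append[OF assms]
  by (subst sum.swap) (simp add: mult.commute)

lemma matprod_snoc:
  assumes "finite I" "p \<in> I" "q \<in> I"
  shows "matprod I (Ms @ [N]) p q = (\<Sum>r\<in>I. matprod I Ms p r * N r q)"
  using assms by (simp add: matprod_append matprod_Cons matmul_idmat)

lemma matprod_merge:
  "finite I \<Longrightarrow> matprod I (X # Y # Ms) = matprod I (matmul I X Y # Ms)"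
  by (simp add: matprod_Cons matmul_assoc)

lemma matprod_pairs:
  "finite I \<Longrightarrow> matprod I (concat (replicate n [X, Y])) = matprod I (replicate n (matmul I X Y))"
proof (induction n)
  case (Suc n)
  have "matprod I (concat (replicate (Suc n) [X, Y]))
      = matprod I (matmul I X Y # concat (replicate n [X, Y]))"
    using Suc.prems by (simp add: matprod_merge)
  with Suc show ?case by (simp add: matprod_Cons)
qed simp

lemma mtrace_power_commute:
  assumes "finite I" "n > 0"
  shows "mtrace I (matprod I (replicate n (matmul I X Y)))
       = mtrace I (matprod I (replicate n (matmul I Y X)))"
proof -
  have split: "concat (replicate (Suc k) [X, Y]) = X # (concat (replicate k [Y, X]) @ [Y])"
    and join: "concat (replicate (Suc k) [Y, X]) = (concat (replicate k [Y, X]) @ [Y]) @ [X]" for k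
    by (induction k) simp_all
  obtain k where n: "n = Suc k" using assms(2) by (cases n) auto
  have "mtrace I (matprod I (concat (replicate n [X, Y])))
      = mtrace I (matprod I (concat (replicate n [Y, X])))"
    unfolding n split join
    using mtrace_matprod_rotate[OF assms(1), of "[X]" "concat (replicate k [Y, X]) @ [Y]"] by simp
  then show ?thesis by (simp only: matprod_pairs[OF assms(1)])
qed

text \<open>
  The two letters \<open>H\<close> and \<open>HK\<close>, where \<open>K\<close> is the diagonal matrix with entries \<open>\<kappa>\<close>.
\<close>
definition twist :: "('a \<Rightarrow> real) \<Rightarrow> 'a mat \<Rightarrow> bool \<Rightarrow> 'a mat" where
  "twist \<kappa> A e = (\<lambda>p q. A p q * (if e then of_real (\<kappa> q) else 1))"

locale hermitian_word =
  fixes I :: "'a set" and A :: "'a mat" and \<kappa> :: "'a \<Rightarrow> real"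
  assumes fin: "finite I"
    and hermitian: "\<And>p q. p \<in> I \<Longrightarrow> q \<in> I \<Longrightarrow> A q p = cnj (A p q)"
    and sign: "\<And>p. \<kappa> p = 1 \<or> \<kappa> p = -1"
begin

definition word :: "bool list \<Rightarrow> 'a mat" where
  "word es = matprod I (map (twist \<kappa> A) es)"

definition hs_sq :: "bool list \<Rightarrow> real" where
  "hs_sq xs = (\<Sum>p\<in>I. \<Sum>q\<in>I. (cmod (word (xs @ [False]) p q))\<^sup>2)"

lemma hs_sq_nonneg: "hs_sq xs \<ge> 0"
  unfolding hs_sq_def by (intro sum_nonneg) auto

lemma word_snoc:
  assumes "p \<in> I" "q \<in> I"
  shows "word (xs @ [u]) p q = word (xs @ [False]) p q * (if u then of_real (\<kappa> q) else 1)"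
  using assms fin unfolding word_def
  by (simp add: matprod_snoc twist_def sum_distrib_right mult.assoc)

lemma cmod_word_snoc:
  assumes "p \<in> I" "q \<in> I"
  shows "cmod (word (xs @ [u]) p q) = cmod (word (xs @ [False]) p q)"
  using sign[of q] by (subst word_snoc[OF assms, of xs u]) (auto simp: norm_mult)

lemma word_Cons: "p \<in> I \<Longrightarrow> word (x # xs) p q = (\<Sum>r\<in>I. twist \<kappa> A x p r * word xs r q)"
  using fin by (simp add: word_def matprod_Cons matmul_finite)

lemma word_append: "p \<in> I \<Longrightarrow> word (xs @ ys) p q = (\<Sum>r\<in>I. word xs p r * word ys r q)"
  using fin by (simp add: word_def matprod_append)

lemma word_single: "p \<in> I \<Longrightarrow> q \<in> I \<Longrightarrow> word [x] p q = twist \<kappa> A x p q"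
  using fin by (simp add: word_def matprod_Cons matmul_idmat)

text \<open>
  The adjoint of \<open>H K\<^sub>1 H \<cdots> K\<^sub>d H\<close> reverses the order of the \<open>K\<close>'s, because \<open>H\<close> and \<open>K\<close> are self-adjoint.
  The final letter has to be \<open>H\<close>, as otherwise the adjoint would start with \<open>K\<close>.
\<close>
lemma word_adjoint:
  assumes "p \<in> I" "q \<in> I"
  shows "word (rev xs @ [False]) p q = cnj (word (xs @ [False]) q p)"
  using assms
proof (induction xs arbitrary: q)
  case Nil
  then show ?case using hermitian[of q p] by (simp add: word_single twist_def)
next
  case (Cons x xs)
  have "word (rev (x # xs) @ [False]) p q
      = (\<Sum>r\<in>I. word (rev xs @ [x]) p r * word [False] r q)"
    using Cons.prems word_append[of p "rev xs @ [x]" "[False]" q] by simp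
  also have "\<dots> = (\<Sum>r\<in>I. cnj (twist \<kappa> A x q r * word (xs @ [False]) r p))"
  proof (intro sum.cong refl)
    fix r assume r: "r \<in> I"
    have "word (rev xs @ [x]) p r = word (rev xs @ [False]) p r * (if x then of_real (\<kappa> r) else 1)"
      using r Cons.prems by (intro word_snoc)
    then show "word (rev xs @ [x]) p r * word [False] r q
        = cnj (twist \<kappa> A x q r * word (xs @ [False]) r p)"
      using r Cons.prems Cons.IH[OF Cons.prems(1) r] hermitian[of q r]
      by (simp add: word_single twist_def)
  qed
  also have "\<dots> = cnj (word ((x # xs) @ [False]) q p)"
    using Cons.prems by (simp add: word_Cons)
  finally show ?case .
qed

lemma trace_append: "mtrace I (word (xs @ ys)) = (\<Sum>p\<in>I. \<Sum>q\<in>I. word xs p q * word ys q p)"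
  using fin by (simp add: mtrace_finite word_append)

lemma trace_rotate: "mtrace I (word (xs @ ys)) = mtrace I (word (ys @ xs))"
  unfolding word_def map_append by (rule mtrace_matprod_rotate[OF fin])

lemma trace_reflected:
  "mtrace I (word ((xs @ [False]) @ (rev xs @ [False]))) = of_real (hs_sq xs)"
proof -
  have "word (xs @ [False]) p q * word (rev xs @ [False]) q p
      = of_real ((cmod (word (xs @ [False]) p q))\<^sup>2)" if "p \<in> I" "q \<in> I" for p q
    using that by (simp add: word_adjoint complex_norm_square[symmetric] del: of_real_power)
  then show ?thesis
    unfolding trace_append hs_sq_def of_real_sum by (intro sum.cong refl) auto
qed

text \<open>
  The trace is a Hilbert-Schmidt inner product of two half words.  The signs \<open>u\<close> and \<open>v\<close> at the
  cuts only multiply columns by \<open>\<plusminus>1\<close>, so they do not change the norms.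
\<close>
lemma trace_cauchy_schwarz:
  "(cmod (mtrace I (word ((xs @ [u]) @ (ys @ [v])))))\<^sup>2 \<le> hs_sq xs * hs_sq ys"
proof -
  define f g where "f = (\<lambda>(p, q). cmod (word (xs @ [u]) p q))"
    and "g = (\<lambda>(p, q). cmod (word (ys @ [v]) q p))"
  have "cmod (mtrace I (word ((xs @ [u]) @ (ys @ [v]))))
      \<le> (\<Sum>z\<in>I \<times> I. f z * g z)"
    unfolding trace_append sum.cartesian_product
    by (rule order_trans[OF norm_sum]) (auto simp: f_def g_def norm_mult intro!: sum_mono)
  then have "(cmod (mtrace I (word ((xs @ [u]) @ (ys @ [v])))))\<^sup>2 \<le> (\<Sum>z\<in>I \<times> I. f z * g z)\<^sup>2"
    by (intro power_mono) auto
  also have "\<dots> \<le> (\<Sum>z\<in>I \<times> I. (f z)\<^sup>2) * (\<Sum>z\<in>I \<times> I. (g z)\<^sup>2)"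
    by (rule Cauchy_Schwarz_ineq_sum)
  also have "(\<Sum>z\<in>I \<times> I. (f z)\<^sup>2) = hs_sq xs"
    unfolding hs_sq_def f_def sum.cartesian_product
    by (intro sum.cong refl) (use cmod_word_snoc[of _ _ xs u] in auto)
  also have "(\<Sum>z\<in>I \<times> I. (g z)\<^sup>2) = (\<Sum>p\<in>I. \<Sum>q\<in>I. (cmod (word (ys @ [False]) q p))\<^sup>2)"
    unfolding g_def sum.cartesian_product
    by (intro sum.cong refl) (use cmod_word_snoc[of _ _ ys v] in auto)
  also have "\<dots> = hs_sq ys" unfolding hs_sq_def by (rule sum.swap)
  finally show ?thesis .
qed

text \<open>
  A reflection positivity argument.  Among all words of length \<open>2d + 2\<close> take one whose trace is largest in
  absolute value.  By Cauchy-Schwarz the word reflected about its first half is again a maximiser.  The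
  reflection copies a run of untwisted letters and puts one more between the copies, so it lengthens
  the run.  After at most \<open>d\<close> rounds the first half is untwisted, and the untwisted word is a maximiser.
\<close>
lemma hs_sq_le_trace_power:
  assumes "length xs = d"
  shows "hs_sq xs \<le> hs_sq (replicate d False)"
proof -
  define n where "n = 2 * Suc d"
  define f where "f = (\<lambda>es. cmod (mtrace I (word es)))"
  define S where "S = {es :: bool list. length es = n}"
  define M where "M = Max (f ` S)"
  have finS: "finite S"
    unfolding S_def using finite_lists_length_eq[of "UNIV :: bool set" n] by simp
  have S0: "replicate n False \<in> S" by (simp add: S_def)
  have Mub: "f es \<le> M" if "es \<in> S" for es
    unfolding M_def using finS that by (intro Max_ge) auto
  have refl_S: "(ys @ [False]) @ (rev ys @ [False]) \<in> S"
    and f_refl: "f ((ys @ [False]) @ (rev ys @ [False])) = hs_sq ys" if "length ys = d" for ys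
    using that trace_reflected[of ys] hs_sq_nonneg[of ys] by (simp_all add: S_def n_def f_def del: append_assoc)
  have hsM: "hs_sq ys \<le> M" if "length ys = d" for ys
    using Mub[OF refl_S[OF that]] f_refl[OF that] by simp
  have M0: "M \<ge> 0" using hsM[OF assms] hs_sq_nonneg[of xs] by linarith
  have max_reflect: "hs_sq (take d es) = M" if "es \<in> S" "f es = M" for es
  proof (cases "M = 0")
    case True
    have "hs_sq (take d es) \<le> M" using that by (intro hsM) (auto simp: S_def n_def)
    with True show ?thesis using hs_sq_nonneg[of "take d es"] by linarith
  next
    case False
    define ys where "ys = take d (drop (Suc d) es)"
    have len: "length es = 2 * Suc d" using that by (simp add: S_def n_def)
    have "es = (take d es @ [es ! d]) @ (ys @ [es ! (2 * d + 1)])"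
    proof -
      have "take (Suc d) es = take d es @ [es ! d]"
        using len by (intro take_Suc_conv_app_nth) simp
      moreover have "drop (Suc d) es = ys @ [es ! (2 * d + 1)]"
        unfolding ys_def using len take_Suc_conv_app_nth[of d "drop (Suc d) es"]
        by (simp add: mult_2)
      ultimately show ?thesis by (metis append_take_drop_id)
    qed
    then have "M\<^sup>2 \<le> hs_sq (take d es) * hs_sq ys"
      using trace_cauchy_schwarz[of "take d es" "es ! d" ys "es ! (2 * d + 1)"] that
      by (simp add: f_def del: append_assoc)
    also have "\<dots> \<le> hs_sq (take d es) * M"
      using len by (intro mult_left_mono hsM hs_sq_nonneg) (auto simp: ys_def)
    finally have "M \<le> hs_sq (take d es)" using False M0
      by (simp add: power2_eq_square)
    moreover have "hs_sq (take d es) \<le> M" using len by (intro hsM) auto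
    ultimately show ?thesis by simp
  qed
  have run: "\<exists>es\<in>S. f es = M \<and> take r es = replicate r False" if "r \<le> d" for r
    using that
  proof (induction r)
    case 0
    have "M \<in> f ` S" unfolding M_def using finS S0 by (intro Max_in) auto
    then show ?case by auto
  next
    case (Suc r)
    then obtain es where es: "es \<in> S" "f es = M" "take r es = replicate r False" by auto
    define ys where "ys = take d es"
    have len: "length ys = d" using es by (simp add: ys_def S_def n_def)
    have ry: "take r ys = replicate r False"
      using es(3) Suc.prems by (simp add: ys_def min_def)
    then have ysd: "ys = replicate r False @ drop r ys" by (metis append_take_drop_id)
    have "rev ys = rev (drop r ys) @ replicate r False"
      by (subst ysd) (simp add: rev_replicate)
    then have split: "(ys @ [False]) @ (rev ys @ [False])
        = (ys @ [False] @ rev (drop r ys)) @ replicate (Suc r) False"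
      by (simp add: replicate_append_same)
    \<comment> \<open>a rotation: the run at the end moves to the front, where the run of \<open>ys\<close> follows it\<close>
    define es' where "es' = replicate (Suc r) False @ (ys @ [False] @ rev (drop r ys))"
    have "f es' = f ((ys @ [False]) @ (rev ys @ [False]))"
      unfolding split f_def es'_def by (subst trace_rotate) simp
    also have "\<dots> = M" using f_refl[OF len] max_reflect[OF es(1,2)] by (simp add: ys_def)
    finally have "f es' = M" .
    moreover have "es' \<in> S"
      using refl_S[OF len] unfolding split by (simp add: es'_def S_def add_ac)
    moreover have "take (Suc r) es' = replicate (Suc r) False" by (simp add: es'_def)
    ultimately show ?case by blast
  qed
  obtain es where "es \<in> S" "f es = M" "take d es = replicate d False" using run[of d] by auto
  then show ?thesis using max_reflect[of es] hsM[OF assms] by simp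
qed

text \<open>
  With \<open>B = (HK)\<^sup>d H\<close> self-adjointness gives \<open>Tr (HK)\<^sup>2\<^sup>d\<^sup>+\<^sup>2 = \<Sum> \<kappa>\<^sub>p \<kappa>\<^sub>q |B\<^sub>p\<^sub>q|\<^sup>2\<close>, whereas \<open>Tr H\<^sup>2\<^sup>d\<^sup>+\<^sup>2\<close> is at least
  \<open>\<Sum> |B\<^sub>p\<^sub>q|\<^sup>2\<close>.
\<close>
theorem trace_power_difference:
  shows "Re (mtrace I (word (replicate (2 * Suc d) False))) - Re (mtrace I (word (replicate (2 * Suc d) True)))
    \<ge> (\<Sum>p\<in>I. \<Sum>q\<in>I. (1 - \<kappa> p * \<kappa> q) * (cmod (word (replicate d True @ [False]) p q))\<^sup>2)"
proof -
  define B where "B = word (replicate d True @ [False])"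
  have rep: "replicate (2 * Suc d) e = (replicate d e @ [e]) @ (replicate d e @ [e])" for e :: bool
    by (simp only: mult_2 replicate_add replicate_append_same flip: replicate_Suc)
  have "mtrace I (word (replicate (2 * Suc d) False)) = of_real (hs_sq (replicate d False))"
    using trace_reflected[of "replicate d False"] unfolding rep by simp
  then have 1: "Re (mtrace I (word (replicate (2 * Suc d) False))) \<ge> (\<Sum>p\<in>I. \<Sum>q\<in>I. (cmod (B p q))\<^sup>2)"
    using hs_sq_le_trace_power[of "replicate d True" d] by (simp add: hs_sq_def B_def)
  have "mtrace I (word (replicate (2 * Suc d) True))
      = (\<Sum>p\<in>I. \<Sum>q\<in>I. of_real (\<kappa> p * \<kappa> q * (cmod (B p q))\<^sup>2))"
    unfolding rep trace_append
  proof (intro sum.cong refl)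
    fix p q assume pq: "p \<in> I" "q \<in> I"
    have "B q p = cnj (B p q)"
      using word_adjoint[OF pq(2,1), of "replicate d True"] by (simp add: B_def rev_replicate)
    moreover have "word (replicate d True @ [True]) p q = B p q * of_real (\<kappa> q)"
      "word (replicate d True @ [True]) q p = B q p * of_real (\<kappa> p)"
      using word_snoc[OF pq, of "replicate d True" True] word_snoc[OF pq(2,1), of "replicate d True" True]
      by (simp_all add: B_def)
    ultimately show "word (replicate d True @ [True]) p q * word (replicate d True @ [True]) q p
        = of_real (\<kappa> p * \<kappa> q * (cmod (B p q))\<^sup>2)"
      by (simp add: complex_norm_square mult_ac del: of_real_power)
  qed
  then have "Re (mtrace I (word (replicate (2 * Suc d) True)))
      = (\<Sum>p\<in>I. \<Sum>q\<in>I. \<kappa> p * \<kappa> q * (cmod (B p q))\<^sup>2)"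
    by (simp only: of_real_sum[symmetric] Re_complex_of_real)
  with 1 show ?thesis
    by (simp add: B_def left_diff_distrib sum_subtractf)
qed

end

section \<open>Finite differences of polynomials\<close>

primrec fdiff :: "nat \<Rightarrow> nat \<Rightarrow> (nat \<Rightarrow> complex) \<Rightarrow> nat \<Rightarrow> complex" where
  "fdiff h 0 f = f"
| "fdiff h (Suc n) f = (\<lambda>x. fdiff h n f (x + h) - fdiff h n f x)"

lemma fdiff_Suc': "fdiff h (Suc n) f = fdiff h n (\<lambda>x. f (x + h) - f x)"
  by (induction n arbitrary: f) (simp_all add: fun_eq_iff)

lemma fdiff_polynomial:
  "fdiff h n (\<lambda>x. \<Sum>i\<le>n. c i * of_nat x ^ i) x = fact n * of_nat h ^ n * c n"
proof (induction n arbitrary: c)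
  case (Suc n)
  define e where "e j = (\<Sum>i\<in>{Suc j..Suc n}. c i * (of_nat (i choose j) * of_nat h ^ (i - j)))" for j
  have "(\<Sum>i\<le>Suc n. c i * of_nat (y + h) ^ i) - (\<Sum>i\<le>Suc n. c i * of_nat y ^ i)
      = (\<Sum>j\<le>n. e j * of_nat y ^ j)" for y
  proof -
    have "c i * of_nat (y + h) ^ i - c i * of_nat y ^ i
        = (\<Sum>j<i. c i * (of_nat (i choose j) * of_nat h ^ (i - j)) * of_nat y ^ j)" for i
    proof -
      have "(of_nat y + of_nat h :: complex) ^ i
          = (\<Sum>j\<le>i. of_nat (i choose j) * of_nat y ^ j * of_nat h ^ (i - j))"
        by (rule binomial_ring)
      also have "{..i} = insert i {..<i}" by auto
      finally show ?thesis by (simp add: algebra_simps sum_distrib_left)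
    qed
    then have "(\<Sum>i\<le>Suc n. c i * of_nat (y + h) ^ i) - (\<Sum>i\<le>Suc n. c i * of_nat y ^ i)
        = (\<Sum>i\<le>Suc n. \<Sum>j<i. c i * (of_nat (i choose j) * of_nat h ^ (i - j)) * of_nat y ^ j)"
      by (simp add: sum_subtractf[symmetric] del: sum.atMost_Suc)
    also have "\<dots> = (\<Sum>(i, j)\<in>Sigma {..Suc n} (\<lambda>i. {..<i}).
        c i * (of_nat (i choose j) * of_nat h ^ (i - j)) * of_nat y ^ j)"
      by (intro sum.Sigma) auto
    also have "\<dots> = (\<Sum>(j, i)\<in>Sigma {..n} (\<lambda>j. {Suc j..Suc n}).
        c i * (of_nat (i choose j) * of_nat h ^ (i - j)) * of_nat y ^ j)"
      by (rule sum.reindex_bij_witness[of _ prod.swap prod.swap]) auto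
    also have "\<dots> = (\<Sum>j\<le>n. e j * of_nat y ^ j)"
      unfolding e_def sum_distrib_right by (intro sum.Sigma[symmetric]) auto
    finally show ?thesis .
  qed
  then have "fdiff h (Suc n) (\<lambda>x. \<Sum>i\<le>Suc n. c i * of_nat x ^ i) x
      = fdiff h n (\<lambda>x. \<Sum>j\<le>n. e j * of_nat x ^ j) x"
    unfolding fdiff_Suc' by (simp del: sum.atMost_Suc)
  also have "\<dots> = fact (Suc n) * of_nat h ^ Suc n * c (Suc n)"
    unfolding Suc.IH by (simp add: e_def)
  finally show ?case .
qed simp

lemma sum_fdiff_sq_le:
  "(\<Sum>x\<in>{s..<s + L}. (cmod (fdiff h n f x))\<^sup>2) \<le> 4 ^ n * (\<Sum>x\<in>{s..<s + L + n * h}. (cmod (f x))\<^sup>2)"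
proof (induction n arbitrary: L)
  case (Suc n)
  define g where "g x = (cmod (fdiff h n f x))\<^sup>2" for x
  have "(cmod (fdiff h (Suc n) f x))\<^sup>2 \<le> 2 * g (x + h) + 2 * g x" for x
  proof -
    have "(cmod (fdiff h (Suc n) f x))\<^sup>2 \<le> (cmod (fdiff h n f (x + h)) + cmod (fdiff h n f x))\<^sup>2"
      by (simp add: norm_triangle_ineq4 power_mono)
    also have "\<dots> \<le> 2 * g (x + h) + 2 * g x"
      using zero_le_power2[of "cmod (fdiff h n f (x + h)) - cmod (fdiff h n f x)"]
      unfolding g_def by (simp add: power2_eq_square algebra_simps)
    finally show ?thesis .
  qed
  then have "(\<Sum>x\<in>{s..<s + L}. (cmod (fdiff h (Suc n) f x))\<^sup>2)
      \<le> 2 * (\<Sum>x\<in>{s..<s + L}. g (x + h)) + 2 * (\<Sum>x\<in>{s..<s + L}. g x)"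
    unfolding sum_distrib_left sum.distrib[symmetric] by (intro sum_mono)
  also have "(\<Sum>x\<in>{s..<s + L}. g (x + h)) = (\<Sum>x\<in>{s + h..<s + L + h}. g x)"
    by (rule sum.shift_bounds_nat_ivl[symmetric])
  also have "\<dots> \<le> (\<Sum>x\<in>{s..<s + (L + h)}. g x)"
    by (intro sum_mono2) (auto simp: g_def)
  also have "(\<Sum>x\<in>{s..<s + L}. g x) \<le> (\<Sum>x\<in>{s..<s + (L + h)}. g x)"
    by (intro sum_mono2) (auto simp: g_def)
  finally have "(\<Sum>x\<in>{s..<s + L}. (cmod (fdiff h (Suc n) f x))\<^sup>2) \<le> 4 * (\<Sum>x\<in>{s..<s + (L + h)}. g x)"
    by simp
  also have "\<dots> \<le> 4 * (4 ^ n * (\<Sum>x\<in>{s..<s + (L + h) + n * h}. (cmod (f x))\<^sup>2))"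
    unfolding g_def by (intro mult_left_mono Suc.IH) auto
  finally show ?case by (simp add: add_ac)
qed simp

text \<open>
  The \<open>d\<close>-th difference with step \<open>q\<close> of the polynomial is the constant \<open>d! q\<^sup>d c\<^sub>d\<close>.  With \<open>q\<close> about
  \<open>N / (d + 4)\<close> there are \<open>q\<close> starting points for which all nodes stay at distance at least \<open>q\<close> from \<open>0\<close>
  and from \<open>N\<close>.  There the weight is at least \<open>q\<^sup>2\<close>, and the total is of order \<open>q\<^sup>2 q q\<^sup>2\<^sup>d = q\<^sup>2\<^sup>d\<^sup>+\<^sup>3\<close>.
\<close>
lemma weighted_polynomial_lower_bound:
  fixes c :: "nat \<Rightarrow> complex" and N d :: nat
  assumes N: "N \<ge> d + 4"
  shows "(\<Sum>j\<in>{1..<N}. real j * real (N - j) * (cmod (\<Sum>i\<le>d. c i * of_nat j ^ i))\<^sup>2)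
    \<ge> real N ^ (2 * d + 3) * (cmod (c d))\<^sup>2 / (4 ^ d * (2 * (real d + 4)) ^ (2 * d + 3))"
proof -
  define q where "q = N div (d + 4)"
  define f where "f j = (\<Sum>i\<le>d. c i * of_nat j ^ i)" for j :: nat
  have q1: "q \<ge> 1" using N by (simp add: q_def div_greater_zero_iff Suc_le_eq)
  have qN: "q * (d + 4) \<le> N" unfolding q_def by simp
  have "N < (d + 4) * (q + 1)"
    unfolding q_def using dividend_less_times_div[of "d + 4" N] by (simp add: algebra_simps)
  also have "\<dots> \<le> (d + 4) * (2 * q)" using q1 by (intro mult_left_mono) auto
  finally have "real N \<le> real ((d + 4) * (2 * q))" by linarith
  then have Nq: "real N / (2 * (real d + 4)) \<le> real q" by (simp add: field_simps)
  have "(real N / (2 * (real d + 4))) ^ (2 * d + 3) * (cmod (c d))\<^sup>2 / 4 ^ d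
      \<le> real q ^ (2 * d + 3) * (cmod (c d))\<^sup>2 / 4 ^ d"
    by (intro divide_right_mono mult_right_mono power_mono Nq) auto
  also have "\<dots> \<le> (fact d)\<^sup>2 * (real q ^ (2 * d + 3) * (cmod (c d))\<^sup>2 / 4 ^ d)"
    using mult_right_mono[of 1 "(fact d :: real)\<^sup>2" "real q ^ (2 * d + 3) * (cmod (c d))\<^sup>2 / 4 ^ d"]
    by (simp add: fact_ge_1)
  also have "\<dots> = (real q)\<^sup>2 / 4 ^ d * (\<Sum>x\<in>{q..<q + q}. (cmod (fdiff q d f x))\<^sup>2)"
  proof -
    have "(cmod (fdiff q d f x))\<^sup>2 = (fact d)\<^sup>2 * real q ^ (2 * d) * (cmod (c d))\<^sup>2" for x
      unfolding f_def fdiff_polynomial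
      by (simp add: norm_mult norm_power power_mult_distrib power_mult[symmetric] mult.commute[of 2 d])
    moreover have "real q ^ (2 * d + 3) = (real q)\<^sup>2 * real q * real q ^ (2 * d)"
      by (simp add: power_add power2_eq_square power3_eq_cube)
    ultimately show ?thesis by simp
  qed
  also have "\<dots> \<le> (real q)\<^sup>2 / 4 ^ d * (4 ^ d * (\<Sum>x\<in>{q..<q + q + d * q}. (cmod (f x))\<^sup>2))"
    by (intro mult_left_mono sum_fdiff_sq_le) auto
  also have "\<dots> = (\<Sum>x\<in>{q..<q + q + d * q}. (real q)\<^sup>2 * (cmod (f x))\<^sup>2)"
    by (simp add: sum_distrib_left)
  also have "\<dots> \<le> (\<Sum>j\<in>{q..<q + q + d * q}. real j * real (N - j) * (cmod (f j))\<^sup>2)"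
  proof (intro sum_mono mult_right_mono)
    fix j assume j: "j \<in> {q..<q + q + d * q}"
    have "q * (d + 4) = q + q + d * q + 2 * q" by (simp add: algebra_simps)
    then have "q \<le> N - j" using j qN by auto
    then show "(real q)\<^sup>2 \<le> real j * real (N - j)"
      unfolding power2_eq_square using j by (intro mult_mono) auto
  qed auto
  also have "\<dots> \<le> (\<Sum>j\<in>{1..<N}. real j * real (N - j) * (cmod (f j))\<^sup>2)"
  proof (intro sum_mono2)
    have "q * (d + 4) = q + q + d * q + 2 * q" by (simp add: algebra_simps)
    then show "{q..<q + q + d * q} \<subseteq> {1..<N}" using q1 qN by auto
  qed auto
  finally show ?thesis by (simp add: f_def power_divide mult_ac)
qed

section \<open>Infinite matrices with off-diagonal decay\<close>

type_synonym idx = "bdry \<times> int"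

lemma UNIV_bdry: "UNIV = {Lower, Upper}"
  using bdry.exhaust by auto

instance bdry :: finite
  by standard (simp add: UNIV_bdry)

definition wt :: "int \<Rightarrow> real" where
  "wt k = 1 + \<bar>real_of_int k\<bar>"

lemma wt_ge_1 [simp]: "1 \<le> wt k" and wt_pos [simp]: "0 < wt k" and wt_nonneg [simp]: "0 \<le> wt k"
  and wt_nz [simp]: "wt k \<noteq> 0"
  by (auto simp: wt_def)

lemma wt_minus [simp]: "wt (- k) = wt k"
  by (simp add: wt_def)

lemma wt_commute: "wt (j - k) = wt (k - j)"
  using wt_minus[of "j - k"] by simp

lemma wt_add_le: "wt (j + k) \<le> wt j * wt k"
proof -
  have "wt (j + k) \<le> 1 + (\<bar>real_of_int j\<bar> + \<bar>real_of_int k\<bar>)" unfolding wt_def by simp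
  also have "\<dots> \<le> wt j * wt k" by (simp add: wt_def algebra_simps)
  finally show ?thesis .
qed

lemma wt_diff_le: "wt j \<le> wt k * wt (j - k)" "wt j \<le> wt k * wt (k - j)"
  "wt (j - k) \<le> wt (j - i) * wt (i - k)"
  using wt_add_le[of k "j - k"] wt_add_le[of "j - i" "i - k"] by (auto simp: wt_commute)

lemma wt_power_ge_1 [simp]: "1 \<le> wt k ^ n" by (simp add: one_le_power)

lemma summable_on_int:
  fixes f :: "int \<Rightarrow> real"
  assumes "(\<lambda>n. f (int n)) summable_on UNIV" "(\<lambda>n. f (- int n)) summable_on UNIV"
  shows "f summable_on UNIV"
proof -
  have 1: "f summable_on range int"
    using assms(1) by (subst summable_on_reindex) (auto simp: o_def)
  have 2: "f summable_on range (\<lambda>n. - int n)"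
    using assms(2) by (subst summable_on_reindex) (auto simp: o_def inj_on_def)
  have "(UNIV :: int set) = range int \<union> range (\<lambda>n. - int n)"
    by (auto simp: image_iff) (metis int_cases2)
  with summable_on_union[OF 1 2] show ?thesis by simp
qed

lemma summable_wt: "(\<lambda>k. 1 / wt k ^ 2) summable_on UNIV"
proof -
  have "summable (\<lambda>n. inverse (real (Suc n)) ^ 2)"
    using inverse_power_summable[of 2, where 'a = real] by (subst summable_Suc_iff) (simp add: power_inverse)
  then have "(\<lambda>n. 1 / wt (int n) ^ 2) summable_on UNIV"
    by (intro norm_summable_imp_summable_on) (simp add: wt_def inverse_eq_divide power_divide add_ac)
  then show ?thesis by (intro summable_on_int) simp_all
qed

lemma summable_on_idx:
  fixes f :: "idx \<Rightarrow> 'a::banach"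
  assumes "\<And>i. (\<lambda>k. f (i, k)) summable_on UNIV"
  shows "f summable_on UNIV"
proof -
  have "f summable_on range (Pair i)" for i
    using assms[of i] by (subst summable_on_reindex) (auto simp: o_def inj_on_def)
  then have "f summable_on (range (Pair Lower) \<union> range (Pair Upper))"
    by (intro summable_on_Un_disjoint) auto
  moreover have "(UNIV :: idx set) = range (Pair Lower) \<union> range (Pair Upper)"
    using UNIV_bdry by (auto simp: image_iff)
  ultimately show ?thesis by simp
qed

lemma infsum_idx:
  fixes f :: "idx \<Rightarrow> 'a::banach"
  assumes "\<And>i. (\<lambda>k. f (i, k)) summable_on UNIV"
  shows "infsum f UNIV = (\<Sum>i\<in>UNIV. \<Sum>\<^sub>\<infinity>k. f (i, k))"
proof -
  have "infsum f (UNIV \<times> UNIV) = (\<Sum>\<^sub>\<infinity>i\<in>UNIV. \<Sum>\<^sub>\<infinity>k\<in>UNIV. f (i, k))"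
    using summable_on_idx[OF assms] infsum_Sigma'_banach[of "\<lambda>i k. f (i, k)" UNIV "\<lambda>_. UNIV"] by simp
  then show ?thesis by simp
qed

definition wsum :: real where "wsum = (\<Sum>\<^sub>\<infinity>p::idx. 1 / wt (snd p) ^ 2)"

lemma summable_wt_shift: "(\<lambda>p::idx. C / wt (k - snd p) ^ 2) summable_on UNIV"
  and infsum_wt_shift: "(\<Sum>\<^sub>\<infinity>p::idx. C / wt (k - snd p) ^ 2) = C * wsum"
proof -
  have b: "bij_betw (\<lambda>p::idx. (fst p, k - snd p)) UNIV UNIV"
    by (rule bij_betw_byWitness[of _ "\<lambda>p. (fst p, k - snd p)"]) auto
  have s: "(\<lambda>p::idx. 1 / wt (snd p) ^ 2) summable_on UNIV"
    by (rule summable_on_idx) (simp add: summable_wt)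
  have "(\<lambda>p::idx. 1 / wt (k - snd p) ^ 2) summable_on UNIV"
    using s summable_on_reindex_bij_betw[OF b, of "\<lambda>p. 1 / wt (snd p) ^ 2"] by simp
  from summable_on_cmult_right[OF this, of C]
  show "(\<lambda>p::idx. C / wt (k - snd p) ^ 2) summable_on UNIV" by simp
  have "(\<Sum>\<^sub>\<infinity>p::idx. 1 / wt (k - snd p) ^ 2) = wsum"
    unfolding wsum_def using infsum_reindex_bij_betw[OF b, of "\<lambda>p. 1 / wt (snd p) ^ 2"] by simp
  then show "(\<Sum>\<^sub>\<infinity>p::idx. C / wt (k - snd p) ^ 2) = C * wsum"
    using infsum_cmult_right'[of C "\<lambda>p::idx. 1 / wt (k - snd p) ^ 2" UNIV] by simp
qed

lemma infsum_dominated_tendsto: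
  fixes f :: "nat \<Rightarrow> 'a \<Rightarrow> 'b::banach"
  assumes lim: "\<And>x. (\<lambda>N. f N x) \<longlonglongrightarrow> g x"
    and bound: "\<And>N x. norm (f N x) \<le> h x" and h: "h summable_on UNIV"
  shows "(\<lambda>N. infsum (f N) UNIV) \<longlonglongrightarrow> infsum g UNIV"
proof -
  have "norm (g x) \<le> h x" for x
    by (rule tendsto_upperbound[OF tendsto_norm[OF lim[of x]]]) (auto simp: bound)
  then have "(\<lambda>x. norm (g x)) summable_on UNIV"
    by (intro Infinite_Sum.abs_summable_on_comparison_test'[OF h])
  then have g: "g summable_on UNIV" by (rule abs_summable_summable)
  have "uniform_limit UNIV (\<lambda>X N. \<Sum>x\<in>X. f N x) (\<lambda>N. infsum (f N) UNIV) (finite_subsets_at_top UNIV)"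
    by (rule Weierstrass_m_test_general[OF bound h])
  moreover have "(\<lambda>N. \<Sum>x\<in>X. f N x) \<longlonglongrightarrow> (\<Sum>x\<in>X. g x)" for X
    by (intro tendsto_sum lim)
  ultimately show ?thesis
    using infsum_tendsto[OF g]
    by (intro swap_uniform_limit'[where f = "\<lambda>X N. \<Sum>x\<in>X. f N x" and g = "sum g"
          and F = "finite_subsets_at_top UNIV" and S = UNIV]) auto
qed

definition mode_box :: "nat \<Rightarrow> idx set" where
  "mode_box N = {p. \<bar>snd p\<bar> \<le> int N}"

lemma finite_box: "finite (mode_box N)"
proof -
  have "mode_box N = UNIV \<times> {- int N..int N}" by (auto simp: mode_box_def)
  then show ?thesis by simp
qed

type_synonym family = "idx set \<Rightarrow> idx mat"

text \<open>
  A family assigns to each index set \<open>I\<close> the matrix of an operator expression whose intermediate sums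
  run over \<open>I\<close>.  A stable family converges entrywise as the truncation is removed.  The bounds below are uniform
  in \<open>I\<close>, which makes dominated convergence available for products and traces.
\<close>
definition stable :: "family \<Rightarrow> bool" where
  "stable X \<longleftrightarrow> (\<forall>p q. (\<lambda>N. X (mode_box N) p q) \<longlonglongrightarrow> X UNIV p q)"

text \<open>
  The matrix analogue of a pseudodifferential operator of order \<open>s\<close> with smooth symbol.
\<close>
definition finite_order :: "family \<Rightarrow> bool" where
  "finite_order X \<longleftrightarrow> stable X \<and>
     (\<exists>s. \<forall>r. \<exists>C. \<forall>I p q. cmod (X I p q) \<le> C * wt (snd p) ^ s / wt (snd p - snd q) ^ r)"

text \<open>
  The matrix analogue of an operator with smooth kernel, a two-sided ideal among the families of
  finite order.
\<close>
definition smoothing :: "family \<Rightarrow> bool" where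
  "smoothing X \<longleftrightarrow> stable X \<and>
     (\<forall>r. \<exists>C. \<forall>I p q. cmod (X I p q) \<le> C / (wt (snd p) * wt (snd q)) ^ r)"

definition family_mul :: "family \<Rightarrow> family \<Rightarrow> family" where
  "family_mul X Y = (\<lambda>I. matmul I (X I) (Y I))"

lemma eventually_in_box: "\<forall>\<^sub>F N in sequentially. p \<in> mode_box N"
  unfolding mode_box_def eventually_sequentially by (intro exI[of _ "nat \<bar>snd p\<bar>"]) auto

lemma infsum_restrict: "infsum f I = (\<Sum>\<^sub>\<infinity>p. if p \<in> I then f p else 0)"
  by (rule infsum_cong_neutral) auto

lemma infsum_box_tendsto:
  fixes f :: "idx set \<Rightarrow> idx \<Rightarrow> complex"
  assumes lim: "\<And>p. (\<lambda>N. f (mode_box N) p) \<longlonglongrightarrow> f UNIV p"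
    and bound: "\<And>I p. cmod (f I p) \<le> h p" and h: "h summable_on UNIV"
  shows "(\<lambda>N. infsum (f (mode_box N)) (mode_box N)) \<longlonglongrightarrow> infsum (f UNIV) UNIV"
    and "cmod (infsum (f I) I) \<le> infsum h UNIV" and "f I summable_on UNIV"
proof -
  have h0: "h p \<ge> 0" for p using order_trans[OF norm_ge_zero bound] .
  have ev: "\<forall>\<^sub>F N in sequentially. (if p \<in> mode_box N then f (mode_box N) p else 0) = f (mode_box N) p" for p
    using eventually_in_box[of p] by eventually_elim simp
  show "(\<lambda>N. infsum (f (mode_box N)) (mode_box N)) \<longlonglongrightarrow> infsum (f UNIV) UNIV"
    unfolding infsum_restrict[of "f (mode_box _)" "mode_box _"]
  proof (rule infsum_dominated_tendsto[OF _ _ h])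
    show "(\<lambda>N. if p \<in> mode_box N then f (mode_box N) p else 0) \<longlonglongrightarrow> f UNIV p" for p
      using lim[of p] tendsto_cong[OF ev[of p]] by simp
  qed (use bound h0 in auto)
  have "(\<lambda>p. norm (f I p)) summable_on UNIV"
    by (intro Infinite_Sum.abs_summable_on_comparison_test'[OF h] bound)
  then show "f I summable_on UNIV" by (rule abs_summable_summable)
  have s: "(\<lambda>p. norm (if p \<in> I then f I p else 0)) summable_on UNIV"
    by (intro Infinite_Sum.abs_summable_on_comparison_test'[OF h]) (use bound h0 in auto)
  have "cmod (infsum (f I) I) \<le> (\<Sum>\<^sub>\<infinity>p. cmod (if p \<in> I then f I p else 0))"
    unfolding infsum_restrict[of "f I" I] by (rule norm_infsum_bound[OF s])
  also have "\<dots> \<le> infsum h UNIV"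
    by (intro infsum_mono s h) (use bound h0 in auto)
  finally show "cmod (infsum (f I) I) \<le> infsum h UNIV" .
qed

lemma family_mul_dominated:
  assumes "stable X" "stable Y"
    and "\<And>I r. cmod (X I p r * Y I r q) \<le> B / wt (k - snd r) ^ 2"
  shows "(\<lambda>N. family_mul X Y (mode_box N) p q) \<longlonglongrightarrow> family_mul X Y UNIV p q"
    and "cmod (family_mul X Y I p q) \<le> B * wsum"
    and "(\<lambda>r. X I p r * Y I r q) summable_on UNIV"
proof -
  have lim: "(\<lambda>N. X (mode_box N) p r * Y (mode_box N) r q) \<longlonglongrightarrow> X UNIV p r * Y UNIV r q" for r
    using assms(1,2) unfolding stable_def by (intro tendsto_mult) blast+
  note d = infsum_box_tendsto[where f = "\<lambda>I r. X I p r * Y I r q" and h = "\<lambda>r. B / wt (k - snd r) ^ 2",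
      OF lim assms(3) summable_wt_shift]
  show "(\<lambda>N. family_mul X Y (mode_box N) p q) \<longlonglongrightarrow> family_mul X Y UNIV p q"
    using d(1) by (simp add: family_mul_def matmul_def)
  show "cmod (family_mul X Y I p q) \<le> B * wsum"
    using d(2)[of I] by (simp add: family_mul_def matmul_def infsum_wt_shift)
  show "(\<lambda>r. X I p r * Y I r q) summable_on UNIV" by (rule d(3))
qed

lemma finite_orderE:
  assumes "finite_order X"
  obtains s C where "\<And>r. C r \<ge> 0"
    "\<And>r I p q. cmod (X I p q) \<le> C r * wt (snd p) ^ s / wt (snd p - snd q) ^ r"
proof -
  obtain s where "\<forall>r. \<exists>C. \<forall>I p q. cmod (X I p q) \<le> C * wt (snd p) ^ s / wt (snd p - snd q) ^ r"
    using assms by (auto simp: finite_order_def)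
  then obtain C where C: "\<And>r I p q. cmod (X I p q) \<le> C r * wt (snd p) ^ s / wt (snd p - snd q) ^ r"
    by metis
  have "C r \<ge> 0" for r
  proof -
    have "0 \<le> C r * wt 0 ^ s / wt (0 - 0) ^ r"
      using order_trans[OF norm_ge_zero C[of _ "(Lower, 0)" "(Lower, 0)" r]] by simp
    then show ?thesis by (simp add: wt_def)
  qed
  with C that show ?thesis by blast
qed

lemma smoothingE:
  assumes "smoothing X"
  obtains C where "\<And>r. C r \<ge> 0" "\<And>r I p q. cmod (X I p q) \<le> C r / (wt (snd p) * wt (snd q)) ^ r"
proof -
  obtain C where C: "\<And>r I p q. cmod (X I p q) \<le> C r / (wt (snd p) * wt (snd q)) ^ r"
    using assms unfolding smoothing_def by metis
  have "C r \<ge> 0" for r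
  proof -
    have "0 \<le> C r / (wt 0 * wt 0) ^ r"
      using order_trans[OF norm_ge_zero C[of _ "(Lower, 0)" "(Lower, 0)" r]] by simp
    then show ?thesis by (simp add: wt_def)
  qed
  with C that show ?thesis by blast
qed

lemma stable_finite_order: "finite_order X \<Longrightarrow> stable X"
  and stable_smoothing: "smoothing X \<Longrightarrow> stable X"
  by (simp_all add: finite_order_def smoothing_def)

text \<open>
  The inequality \<open>wt (j + k) \<le> wt j wt k\<close> moves weights between the indices.  Two spare powers of
  off-diagonal decay make the sum over the intermediate index converge.
\<close>
lemma finite_order_mul_bound:
  assumes "finite_order X" "finite_order Y"
  obtains s C where "\<And>R. C R \<ge> 0"
    "\<And>R I p q r. cmod (X I p r * Y I r q) \<le> C R * wt (snd p) ^ s / wt (snd p - snd q) ^ R / wt (snd p - snd r) ^ 2"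
proof -
  obtain s C where C: "\<And>r. C r \<ge> 0"
    "\<And>r I p q. cmod (X I p q) \<le> C r * wt (snd p) ^ s / wt (snd p - snd q) ^ r"
    using finite_orderE[OF assms(1)] by metis
  obtain t E where E: "\<And>r. E r \<ge> 0"
    "\<And>r I p q. cmod (Y I p q) \<le> E r * wt (snd p) ^ t / wt (snd p - snd q) ^ r"
    using finite_orderE[OF assms(2)] by metis
  show thesis
  proof (rule that[of "\<lambda>R. C (R + t + 2) * E R" "s + t"])
    show "0 \<le> C (R + t + 2) * E R" for R using C(1) E(1) by simp
    fix R I and p q r :: idx
    define a b c P u where "a = wt (snd p - snd r)" "b = wt (snd r - snd q)" "c = wt (snd p - snd q)"
      "P = wt (snd p)" "u = wt (snd r)"
    have pos: "a \<ge> 1" "b \<ge> 1" "c \<ge> 1" "P \<ge> 1" "u \<ge> 1" by (simp_all add: a_b_c_P_u_def)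
    have "u \<le> P * a" and "c \<le> a * b"
      unfolding a_b_c_P_u_def using wt_diff_le(2)[of "snd r" "snd p"] wt_diff_le(3) by auto
    then have u: "u ^ t \<le> P ^ t * a ^ t" and c: "c ^ R \<le> a ^ R * b ^ R"
      using pos by (simp_all add: power_mono flip: power_mult_distrib)
    have "cmod (X I p r * Y I r q) \<le> (C (R + t + 2) * P ^ s / a ^ (R + t + 2)) * (E R * u ^ t / b ^ R)"
      unfolding norm_mult a_b_c_P_u_def by (rule mult_mono[OF C(2) E(2)]) (simp_all add: C(1) E(1))
    also have "\<dots> \<le> (C (R + t + 2) * P ^ s / a ^ (R + t + 2)) * (E R * (P ^ t * a ^ t) / b ^ R)"
      using u C(1) E(1) pos by (intro mult_left_mono divide_right_mono) auto
    also have "\<dots> = C (R + t + 2) * E R * P ^ (s + t) / (a ^ R * b ^ R) / a ^ 2"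
      using pos by (simp add: power_add power2_eq_square field_simps)
    also have "\<dots> \<le> C (R + t + 2) * E R * P ^ (s + t) / c ^ R / a ^ 2"
      using c C(1) E(1) pos by (intro divide_right_mono divide_left_mono) auto
    finally show "cmod (X I p r * Y I r q)
        \<le> C (R + t + 2) * E R * wt (snd p) ^ (s + t) / wt (snd p - snd q) ^ R / wt (snd p - snd r) ^ 2"
      by (simp add: a_b_c_P_u_def)
  qed
qed

lemma finite_order_mul:
  assumes "finite_order X" "finite_order Y"
  shows "finite_order (family_mul X Y)"
proof -
  obtain s C where C: "\<And>R. C R \<ge> 0"
    "\<And>R I p q r. cmod (X I p r * Y I r q) \<le> C R * wt (snd p) ^ s / wt (snd p - snd q) ^ R / wt (snd p - snd r) ^ 2"
    using finite_order_mul_bound[OF assms] by metis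
  note d = family_mul_dominated[OF assms[THEN stable_finite_order] C(2)]
  have "cmod (family_mul X Y I p q) \<le> C R * wsum * wt (snd p) ^ s / wt (snd p - snd q) ^ R" for R I p q
    using family_mul_dominated(2)[OF assms[THEN stable_finite_order] C(2)[where R = R], of I p q] by (simp add: mult_ac)
  then show ?thesis
    unfolding finite_order_def stable_def using d(1) by blast
qed

lemma finite_order_mul_summable:
  assumes "finite_order X" "finite_order Y"
  shows "(\<lambda>r. X I p r * Y I r q) summable_on UNIV"
  using finite_order_mul_bound[OF assms]
    family_mul_dominated(3)[OF assms[THEN stable_finite_order]] by metis

lemma smoothing_mul_left:
  assumes "finite_order X" "smoothing Y"
  shows "smoothing (family_mul X Y)"
proof -
  obtain s C where C: "\<And>r. C r \<ge> 0"
    "\<And>r I p q. cmod (X I p q) \<le> C r * wt (snd p) ^ s / wt (snd p - snd q) ^ r"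
    using finite_orderE[OF assms(1)] by metis
  obtain E where E: "\<And>r. E r \<ge> 0"
    "\<And>r I p q. cmod (Y I p q) \<le> E r / (wt (snd p) * wt (snd q)) ^ r"
    using smoothingE[OF assms(2)] by metis
  have bd: "cmod (X I p r * Y I r q)
      \<le> (C (R + s) * E (R + s + 2) / (wt (snd p) * wt (snd q)) ^ R) / wt (0 - snd r) ^ 2" for R I and p q r :: idx
  proof -
    define a P u v where "a = wt (snd p - snd r)" "P = wt (snd p)" "u = wt (snd r)" "v = wt (snd q)"
    have pos: "a \<ge> 1" "P \<ge> 1" "u \<ge> 1" "v \<ge> 1" by (simp_all add: a_P_u_v_def)
    have "P \<le> u * a" unfolding a_P_u_v_def using wt_diff_le(1) by auto
    then have P: "P ^ (R + s) \<le> u ^ (R + s) * a ^ (R + s)"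
      using pos by (simp add: power_mono flip: power_mult_distrib)
    have "cmod (X I p r * Y I r q) \<le> (C (R + s) * P ^ s / a ^ (R + s)) * (E (R + s + 2) / (u * v) ^ (R + s + 2))"
      unfolding norm_mult a_P_u_v_def by (rule mult_mono[OF C(2) E(2)]) (simp_all add: C(1) E(1))
    also have "\<dots> = (C (R + s) * E (R + s + 2) / P ^ R) * (P ^ (R + s) / (u ^ (R + s) * a ^ (R + s))) / u ^ 2 / v ^ (R + s + 2)"
      using pos by (simp add: power_add power2_eq_square field_simps)
    also have "\<dots> \<le> (C (R + s) * E (R + s + 2) / P ^ R) * 1 / u ^ 2 / v ^ (R + s + 2)"
      using P C(1) E(1) pos by (intro divide_right_mono mult_left_mono) auto
    also have "\<dots> \<le> (C (R + s) * E (R + s + 2) / P ^ R) * 1 / u ^ 2 / v ^ R"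
      using C(1) E(1) pos by (intro divide_left_mono power_increasing) auto
    finally show ?thesis by (simp add: a_P_u_v_def power_mult_distrib mult_ac)
  qed
  note d = family_mul_dominated[OF stable_finite_order[OF assms(1)] stable_smoothing[OF assms(2)] bd]
  have "cmod (family_mul X Y I p q) \<le> C (R + s) * E (R + s + 2) * wsum / (wt (snd p) * wt (snd q)) ^ R" for R I p q
    using family_mul_dominated(2)[OF stable_finite_order[OF assms(1)] stable_smoothing[OF assms(2)] bd[where R = R], of I p q] by simp
  then show ?thesis unfolding smoothing_def stable_def using d(1) by blast
qed

lemma smoothing_mul_right:
  assumes "smoothing X" "finite_order Y"
  shows "smoothing (family_mul X Y)"
proof -
  obtain C where C: "\<And>r. C r \<ge> 0"
    "\<And>r I p q. cmod (X I p q) \<le> C r / (wt (snd p) * wt (snd q)) ^ r"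
    using smoothingE[OF assms(1)] by metis
  obtain s E where E: "\<And>r. E r \<ge> 0"
    "\<And>r I p q. cmod (Y I p q) \<le> E r * wt (snd p) ^ s / wt (snd p - snd q) ^ r"
    using finite_orderE[OF assms(2)] by metis
  have bd: "cmod (X I p r * Y I r q)
      \<le> (C (R + s + 2) * E R / (wt (snd p) * wt (snd q)) ^ R) / wt (0 - snd r) ^ 2" for R I and p q r :: idx
  proof -
    define a P u v where "a = wt (snd r - snd q)" "P = wt (snd p)" "u = wt (snd r)" "v = wt (snd q)"
    have pos: "a \<ge> 1" "P \<ge> 1" "u \<ge> 1" "v \<ge> 1" by (simp_all add: a_P_u_v_def)
    have "v \<le> u * a" unfolding a_P_u_v_def using wt_diff_le(2) by auto
    then have v: "v ^ R \<le> u ^ R * a ^ R"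
      using pos by (simp add: power_mono flip: power_mult_distrib)
    have "cmod (X I p r * Y I r q) \<le> (C (R + s + 2) / (P * u) ^ (R + s + 2)) * (E R * u ^ s / a ^ R)"
      unfolding norm_mult a_P_u_v_def by (rule mult_mono[OF C(2) E(2)]) (simp_all add: C(1) E(1))
    also have "\<dots> = (C (R + s + 2) * E R / v ^ R) * (v ^ R / (u ^ R * a ^ R)) / u ^ 2 / P ^ (R + s + 2)"
      using pos by (simp add: power_add power2_eq_square field_simps)
    also have "\<dots> \<le> (C (R + s + 2) * E R / v ^ R) * 1 / u ^ 2 / P ^ (R + s + 2)"
      using v C(1) E(1) pos by (intro divide_right_mono mult_left_mono) auto
    also have "\<dots> \<le> (C (R + s + 2) * E R / v ^ R) * 1 / u ^ 2 / P ^ R"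
      using C(1) E(1) pos by (intro divide_left_mono power_increasing) auto
    finally show ?thesis by (simp add: a_P_u_v_def power_mult_distrib mult_ac)
  qed
  note d = family_mul_dominated[OF stable_smoothing[OF assms(1)] stable_finite_order[OF assms(2)] bd]
  have "cmod (family_mul X Y I p q) \<le> C (R + s + 2) * E R * wsum / (wt (snd p) * wt (snd q)) ^ R" for R I p q
    using family_mul_dominated(2)[OF stable_smoothing[OF assms(1)] stable_finite_order[OF assms(2)] bd[where R = R], of I p q] by simp
  then show ?thesis unfolding smoothing_def stable_def using d(1) by blast
qed

lemma smoothing_add:
  assumes "smoothing X" "smoothing Y"
  shows "smoothing (\<lambda>I p q. X I p q + Y I p q)"
proof -
  obtain C where C: "\<And>r I p q. cmod (X I p q) \<le> C r / (wt (snd p) * wt (snd q)) ^ r"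
    using smoothingE[OF assms(1)] by metis
  obtain E where E: "\<And>r I p q. cmod (Y I p q) \<le> E r / (wt (snd p) * wt (snd q)) ^ r"
    using smoothingE[OF assms(2)] by metis
  have "cmod (X I p q + Y I p q) \<le> (C r + E r) / (wt (snd p) * wt (snd q)) ^ r" for r I p q
    unfolding add_divide_distrib by (rule order_trans[OF norm_triangle_ineq add_mono[OF C E]])
  moreover have "stable (\<lambda>I p q. X I p q + Y I p q)"
    using assms[THEN stable_smoothing] unfolding stable_def by (intro allI tendsto_add) auto
  ultimately show ?thesis unfolding smoothing_def by blast
qed

lemma smoothing_scale:
  assumes "smoothing X" "\<And>p q. cmod (c p q) \<le> 1"
  shows "smoothing (\<lambda>I p q. X I p q * c p q)"
proof -
  obtain C where C: "\<And>r. C r \<ge> 0" "\<And>r I p q. cmod (X I p q) \<le> C r / (wt (snd p) * wt (snd q)) ^ r"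
    using smoothingE[OF assms(1)] by metis
  have "cmod (X I p q * c p q) \<le> C r / (wt (snd p) * wt (snd q)) ^ r" for r I p q
    unfolding norm_mult
    using mult_mono[OF C(2)[of I p q r] assms(2)[of p q]] C(1) by simp
  moreover have "stable (\<lambda>I p q. X I p q * c p q)"
    using stable_smoothing[OF assms(1)] unfolding stable_def by (intro allI tendsto_mult_right) auto
  ultimately show ?thesis unfolding smoothing_def by blast
qed

lemma finite_order_scale:
  assumes "finite_order X" "\<And>p q. cmod (c p q) \<le> 1"
  shows "finite_order (\<lambda>I p q. X I p q * c p q)"
proof -
  obtain s C where C: "\<And>r. C r \<ge> 0"
    "\<And>r I p q. cmod (X I p q) \<le> C r * wt (snd p) ^ s / wt (snd p - snd q) ^ r"
    using finite_orderE[OF assms(1)] by metis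
  have "cmod (X I p q * c p q) \<le> C r * wt (snd p) ^ s / wt (snd p - snd q) ^ r" for r I p q
    unfolding norm_mult
    using mult_mono[OF C(2)[of I p q r] assms(2)[of p q]] C(1) by simp
  moreover have "stable (\<lambda>I p q. X I p q * c p q)"
    using stable_finite_order[OF assms(1)] unfolding stable_def by (intro allI tendsto_mult_right) auto
  ultimately show ?thesis unfolding finite_order_def by blast
qed

lemma finite_order_constI:
  assumes "\<And>r. \<exists>C. \<forall>p q. cmod (M p q) \<le> C * wt (snd p) ^ s / wt (snd p - snd q) ^ r"
  shows "finite_order (\<lambda>_. M)"
  unfolding finite_order_def stable_def using assms by auto

lemma smoothing_constI:
  assumes "\<And>r. \<exists>C. \<forall>p q. cmod (M p q) \<le> C / (wt (snd p) * wt (snd q)) ^ r"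
  shows "smoothing (\<lambda>_. M)"
  unfolding smoothing_def stable_def using assms by auto

lemma smoothing_imp_finite_order:
  assumes "smoothing X"
  shows "finite_order X"
proof -
  obtain C where C: "\<And>r. C r \<ge> 0" "\<And>r I p q. cmod (X I p q) \<le> C r / (wt (snd p) * wt (snd q)) ^ r"
    using smoothingE[OF assms] by metis
  have "cmod (X I p q) \<le> C r * wt (snd p) ^ 0 / wt (snd p - snd q) ^ r" for r I p q
  proof -
    have "wt (snd p - snd q) ^ r \<le> (wt (snd p) * wt (snd q)) ^ r"
      using wt_add_le[of "snd p" "- snd q"] by (intro power_mono) auto
    then have "C r / (wt (snd p) * wt (snd q)) ^ r \<le> C r / wt (snd p - snd q) ^ r"
      using C(1) by (intro divide_left_mono) auto
    with C(2)[of I p q r] show ?thesis by simp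
  qed
  then show ?thesis using stable_smoothing[OF assms] unfolding finite_order_def by blast
qed

lemma finite_order_idmat: "finite_order (\<lambda>_. idmat)"
  by (rule finite_order_constI[where s = 0]) (rule exI[of _ 1], auto simp: idmat_def wt_def)

lemma finite_order_power:
  assumes "finite_order (\<lambda>_. M)"
  shows "finite_order (\<lambda>I. matprod I (replicate n M))"
proof (induction n)
  case (Suc n)
  then show ?case using finite_order_mul[OF assms Suc] by (simp add: matprod_Cons family_mul_def)
qed (simp add: finite_order_idmat)

text \<open>
  The sign at frequency \<open>0\<close> is \<open>1\<close>, to make \<open>sgn D\<close> an involution.
\<close>
definition sgn_idx :: "idx \<Rightarrow> real" where
  "sgn_idx p = (if snd p \<ge> 0 then 1 else - 1)"

text \<open>
  The commutator with \<open>sgn D\<close> only keeps entries joining frequencies of different sign.  There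
  \<open>|p - q|\<close> is at least both \<open>|p|\<close> and \<open>|q|\<close>, so off-diagonal decay is decay in both indices.
\<close>
lemma commutator_sgn_smoothing:
  assumes "finite_order X"
  shows "smoothing (\<lambda>I p q. of_real (sgn_idx p - sgn_idx q) * X I p q)"
proof -
  obtain s C where C: "\<And>r. C r \<ge> 0"
    "\<And>r I p q. cmod (X I p q) \<le> C r * wt (snd p) ^ s / wt (snd p - snd q) ^ r"
    using finite_orderE[OF assms(1)] by metis
  have "cmod (of_real (sgn_idx p - sgn_idx q) * X I p q) \<le> 2 * C (2 * r + s) / (wt (snd p) * wt (snd q)) ^ r"
    for r I and p q :: idx
  proof (cases "sgn_idx p = sgn_idx q")
    case False
    define a P v where "a = wt (snd p - snd q)" "P = wt (snd p)" "v = wt (snd q)"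
    have pos: "a \<ge> 1" "P \<ge> 1" "v \<ge> 1" by (simp_all add: a_P_v_def)
    have "P \<le> a" "v \<le> a" unfolding a_P_v_def wt_def using False
      by (auto simp: sgn_idx_def split: if_splits)
    then have le: "P ^ s * (P * v) ^ r \<le> a ^ (2 * r + s)"
      unfolding power_add power_mult power_mult_distrib power2_eq_square
      by (subst mult.commute[of "P ^ s"]) (use pos in \<open>intro mult_mono power_mono; auto\<close>)
    have "cmod (of_real (sgn_idx p - sgn_idx q) * X I p q) \<le> 2 * cmod (X I p q)"
      unfolding norm_mult by (intro mult_right_mono) (auto simp: sgn_idx_def)
    also have "\<dots> \<le> 2 * (C (2 * r + s) * P ^ s / a ^ (2 * r + s))"
      unfolding a_P_v_def by (intro mult_left_mono C) auto
    also have "\<dots> = 2 * C (2 * r + s) / (P * v) ^ r * (P ^ s * (P * v) ^ r / a ^ (2 * r + s))"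
      using pos by (simp add: field_simps)
    also have "\<dots> \<le> 2 * C (2 * r + s) / (P * v) ^ r * 1"
      using le pos C(1) by (intro mult_left_mono) auto
    finally show ?thesis by (simp add: a_P_v_def)
  qed (use C in auto)
  moreover have "stable (\<lambda>I p q. of_real (sgn_idx p - sgn_idx q) * X I p q)"
    using stable_finite_order[OF assms] unfolding stable_def by (intro allI tendsto_mult_left) auto
  ultimately show ?thesis unfolding smoothing_def by blast
qed

lemma smoothing_trace:
  assumes "smoothing X"
  shows "(\<lambda>N. mtrace (mode_box N) (X (mode_box N))) \<longlonglongrightarrow> mtrace UNIV (X UNIV)"
proof -
  obtain C where C: "\<And>r. C r \<ge> 0" "\<And>r I p q. cmod (X I p q) \<le> C r / (wt (snd p) * wt (snd q)) ^ r"
    using smoothingE[OF assms(1)] by metis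
  have bound: "cmod (X I p p) \<le> C 1 / wt (0 - snd p) ^ 2" for I p
    using C(2)[of I p p 1] by (simp add: power2_eq_square)
  have lim: "(\<lambda>N. X (mode_box N) p p) \<longlonglongrightarrow> X UNIV p p" for p
    using stable_smoothing[OF assms] unfolding stable_def by blast
  note d = infsum_box_tendsto[where f = "\<lambda>I p. X I p p", OF lim bound summable_wt_shift]
  show "(\<lambda>N. mtrace (mode_box N) (X (mode_box N))) \<longlonglongrightarrow> mtrace UNIV (X UNIV)"
    using d(1) by (simp add: mtrace_def)
qed

text \<open>
  Modulo smoothing families \<open>M\<close> is \<open>D S\<close> with \<open>S = sgn D\<close>, and \<open>S\<close> commutes with everything, so \<open>M\<^sup>n\<close> is
  \<open>D\<^sup>n S\<^sup>n\<close>.  Keeping \<open>S\<^sup>n\<close> on the right lets the induction add one factor on the left without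
  reassociating infinite products.
\<close>
theorem smoothing_power_diff:
  assumes M: "finite_order (\<lambda>_. M)" and D: "finite_order (\<lambda>_. D)"
    and R: "smoothing (\<lambda>_ p q. M p q - D p q * of_real (sgn_idx q))"
  shows "smoothing (\<lambda>I p q. matprod I (replicate n M) p q
    - matprod I (replicate n D) p q * of_real (sgn_idx q ^ n))"
proof (induction n)
  case 0
  show ?case by (simp add: smoothing_constI[of "\<lambda>_ _. 0"] exI[of _ 0])
next
  case (Suc n)
  define Mn Dn where "Mn = (\<lambda>I. matprod I (replicate n M))" and "Dn = (\<lambda>I. matprod I (replicate n D))"
  define R0 E C where "R0 = (\<lambda>(_::idx set) p q. M p q - D p q * of_real (sgn_idx q))"
    and "E = (\<lambda>I p q. Mn I p q - Dn I p q * of_real (sgn_idx q ^ n))"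
    and "C = (\<lambda>I p q. of_real (sgn_idx p - sgn_idx q) * Dn I p q)"
  have sgn1: "cmod (of_real (sgn_idx q)) \<le> 1" "cmod (of_real (sgn_idx q ^ n)) \<le> 1"
      "cmod (of_real (sgn_idx q) ^ n) \<le> 1" for q and n :: nat
    by (auto simp: sgn_idx_def norm_power)
  have MnF: "finite_order Mn" and DnF: "finite_order Dn"
    unfolding Mn_def Dn_def by (intro finite_order_power M D)+
  have ES: "smoothing E" using Suc by (simp add: E_def Mn_def Dn_def)
  have R0S: "smoothing R0" using R by (simp add: R0_def)
  have CS: "smoothing C" unfolding C_def by (rule commutator_sgn_smoothing[OF DnF])
  define DS where "DS = (\<lambda>(_::idx set) p q. D p q * of_real (sgn_idx q))"
  have DSF: "finite_order DS" unfolding DS_def by (rule finite_order_scale[OF D]) (rule sgn1)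
  have total: "smoothing (\<lambda>I p q. family_mul R0 Mn I p q + (family_mul DS E I p q
      + family_mul (\<lambda>_. D) C I p q * of_real (sgn_idx q ^ n)))"
    by (intro smoothing_add smoothing_scale smoothing_mul_left smoothing_mul_right R0S MnF DSF ES D CS sgn1)
  \<comment> \<open>\<open>M X = (M - D S) X + D S (X - Y S\<^sup>n) + D (S Y - Y S) S\<^sup>n + D Y S\<^sup>n\<^sup>+\<^sup>1\<close> for \<open>X = M\<^sup>n\<close> and \<open>Y = D\<^sup>n\<close>\<close>
  have eq: "matprod I (replicate (Suc n) M) p q - matprod I (replicate (Suc n) D) p q * of_real (sgn_idx q ^ Suc n)
      = family_mul R0 Mn I p q + (family_mul DS E I p q
        + family_mul (\<lambda>_. D) C I p q * of_real (sgn_idx q ^ n))" for I p q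
  proof -
    have hs: "((\<lambda>r. X I p r * Y I r q) has_sum family_mul X Y I p q) I"
      if "finite_order X" "finite_order Y" for X Y
      unfolding family_mul_def matmul_def
      by (intro has_sum_infsum summable_on_subset_banach[OF finite_order_mul_summable[OF that]]) simp
    note fo = smoothing_imp_finite_order
    have "((\<lambda>r. (R0 I p r * Mn I r q + (DS I p r * E I r q + D p r * C I r q * of_real (sgn_idx q ^ n)))
        + D p r * Dn I r q * of_real (sgn_idx q ^ Suc n)) has_sum
        ((family_mul R0 Mn I p q + (family_mul DS E I p q
          + family_mul (\<lambda>_. D) C I p q * of_real (sgn_idx q ^ n)))
         + family_mul (\<lambda>_. D) Dn I p q * of_real (sgn_idx q ^ Suc n))) I"
      by (intro has_sum_add has_sum_cmult_left hs[OF fo[OF R0S] MnF] hs[OF DSF fo[OF ES]]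
          hs[OF D fo[OF CS]] hs[OF D DnF])
    moreover have "(R0 I p r * Mn I r q + (DS I p r * E I r q + D p r * C I r q * of_real (sgn_idx q ^ n)))
        + D p r * Dn I r q * of_real (sgn_idx q ^ Suc n) = M p r * Mn I r q" for r
      by (simp add: R0_def DS_def E_def C_def algebra_simps)
    ultimately have "family_mul (\<lambda>_. M) Mn I p q = (family_mul R0 Mn I p q + (family_mul DS E I p q
          + family_mul (\<lambda>_. D) C I p q * of_real (sgn_idx q ^ n)))
         + family_mul (\<lambda>_. D) Dn I p q * of_real (sgn_idx q ^ Suc n)"
      unfolding family_mul_def matmul_def by (simp add: infsumI)
    then show ?thesis by (simp add: matprod_Cons family_mul_def Mn_def Dn_def)
  qed
  show ?case unfolding eq by (rule total)
qed

section \<open>Fourier series with rapidly decaying coefficients\<close>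

definition rapid :: "(int \<Rightarrow> complex) \<Rightarrow> bool" where
  "rapid c \<longleftrightarrow> (\<forall>r. \<exists>C. \<forall>k. cmod (c k) \<le> C / wt k ^ r)"

definition fourier_series :: "(int \<Rightarrow> complex) \<Rightarrow> real \<Rightarrow> complex" where
  "fourier_series c \<theta> = (\<Sum>\<^sub>\<infinity>k. c k * cis (of_int k * \<theta>))"

definition convolution :: "(int \<Rightarrow> complex) \<Rightarrow> (int \<Rightarrow> complex) \<Rightarrow> int \<Rightarrow> complex" where
  "convolution a c k = (\<Sum>\<^sub>\<infinity>j. a (k - j) * c j)"

lemma rapidE:
  assumes "rapid c"
  obtains C where "\<And>r. C r \<ge> 0" "\<And>r k. cmod (c k) \<le> C r / wt k ^ r"
proof -
  obtain C where C: "\<And>r k. cmod (c k) \<le> C r / wt k ^ r"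
    using assms unfolding rapid_def by metis
  have "C r \<ge> 0" for r
    using order_trans[OF norm_ge_zero C[of 0 r]] by (simp add: wt_def)
  with C that show ?thesis by blast
qed

lemma rapid_multiplier:
  assumes "rapid c" and e: "\<And>k. cmod (e k) \<le> B * wt k ^ s"
  shows "rapid (\<lambda>k. e k * c k)"
  unfolding rapid_def
proof
  fix r
  obtain C where C: "\<And>r. C r \<ge> 0" "\<And>r k. cmod (c k) \<le> C r / wt k ^ r"
    using rapidE[OF assms(1)] by metis
  have "cmod (e k * c k) \<le> B * C (r + s) / wt k ^ r" for k
  proof -
    have "cmod (e k * c k) \<le> (B * wt k ^ s) * (C (r + s) / wt k ^ (r + s))"
      unfolding norm_mult by (rule mult_mono'[OF e C(2)]) auto
    then show ?thesis by (simp add: power_add field_simps)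
  qed
  then show "\<exists>C. \<forall>k. cmod (e k * c k) \<le> C / wt k ^ r" by blast
qed

lemma rapid_summable:
  assumes "rapid c"
  shows "(\<lambda>k. B * cmod (c k) * wt k ^ s) summable_on UNIV"
proof -
  obtain C where C: "\<And>r. C r \<ge> 0" "\<And>r k. cmod (c k) \<le> C r / wt k ^ r"
    using rapidE[OF assms(1)] by metis
  have "norm (cmod (c k) * wt k ^ s) \<le> C (s + 2) * (1 / wt k ^ 2)" for k
    using mult_right_mono[OF C(2)[of k "s + 2"], of "wt k ^ s"] by (simp add: power_add power2_eq_square field_simps)
  then have "(\<lambda>k. norm (cmod (c k) * wt k ^ s)) summable_on UNIV"
    by (intro Infinite_Sum.abs_summable_on_comparison_test'[OF summable_on_cmult_right[OF summable_wt]])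
  then have "(\<lambda>k. cmod (c k) * wt k ^ s) summable_on UNIV" by simp
  from summable_on_cmult_right[OF this, of B] show ?thesis by (simp add: mult.assoc)
qed

lemma rapid_abs_summable: "rapid c \<Longrightarrow> (\<lambda>k. cmod (c k)) summable_on UNIV"
  using rapid_summable[of c 1 0] by simp

lemma fourier_series_summable:
  assumes "rapid c" shows "(\<lambda>k. c k * cis (of_int k * \<theta>)) summable_on UNIV"
  by (rule abs_summable_summable) (use rapid_abs_summable[OF assms] in \<open>simp add: norm_mult\<close>)

lemma has_sum_diff:
  fixes f g :: "'k \<Rightarrow> complex"
  assumes "(f has_sum a) A" "(g has_sum b) A"
  shows "((\<lambda>x. f x - g x) has_sum a - b) A"
  using has_sum_add[OF assms(1) has_sum_uminusI[OF assms(2)]] by simp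

text \<open>
  The constant is crude.  It comes from estimating the increment of \<open>f'\<close> by its linearisation at \<open>x\<close>, with
  \<open>f''\<close> varying by at most \<open>2 M\<close>.
\<close>
lemma quadratic_remainder:
  fixes f :: "real \<Rightarrow> complex"
  assumes S: "convex S" "x \<in> S" "y \<in> S"
    and f: "\<And>z. z \<in> S \<Longrightarrow> (f has_vector_derivative f' z) (at z within S)"
    and f': "\<And>z. z \<in> S \<Longrightarrow> (f' has_vector_derivative f'' z) (at z within S)"
    and bound: "\<And>z. z \<in> S \<Longrightarrow> norm (f'' z) \<le> M"
  shows "norm (f y - f x - (y - x) *\<^sub>R f' x) \<le> 3 * M * \<bar>y - x\<bar> ^ 2"
proof -
  have seg: "closed_segment x z \<subseteq> closed_segment x y" if "z \<in> closed_segment x y" for z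
    using that by (simp add: subset_closed_segment)
  have sub: "closed_segment x y \<subseteq> S" using S by (simp add: closed_segment_subset)
  have M0: "M \<ge> 0" using order_trans[OF norm_ge_zero bound[OF S(2)]] .
  have lip: "norm (f' z - f' x) \<le> 3 * M * \<bar>y - x\<bar>" if z: "z \<in> closed_segment x y" for z
  proof -
    have "norm (f' z - f' x - (z - x) *\<^sub>R f'' x) \<le> norm (z - x) * (2 * M)"
    proof (rule vector_differentiable_bound_linearization[of "closed_segment x y" f' f''])
      show "(f' has_vector_derivative f'' w) (at w within closed_segment x y)" if "w \<in> closed_segment x y" for w
        using f'[of w] that sub by (meson has_vector_derivative_within_subset subsetD)
      show "norm (f'' w - f'' x) \<le> 2 * M" if "w \<in> closed_segment x y" for w
        using norm_triangle_ineq4[of "f'' w" "f'' x"] bound[of w] bound[of x] that sub S(2) by auto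
    qed (use seg[OF z] in auto)
    moreover have "norm ((z - x) *\<^sub>R f'' x) \<le> \<bar>z - x\<bar> * M"
      using bound[OF S(2)] by (simp add: mult_left_mono)
    moreover have "norm (f' z - f' x) \<le> norm (f' z - f' x - (z - x) *\<^sub>R f'' x) + norm ((z - x) *\<^sub>R f'' x)"
      using norm_triangle_ineq[of "f' z - f' x - (z - x) *\<^sub>R f'' x" "(z - x) *\<^sub>R f'' x"] by simp
    ultimately have "norm (f' z - f' x) \<le> 3 * M * \<bar>z - x\<bar>" by (simp add: mult_ac)
    also have "\<bar>z - x\<bar> \<le> \<bar>y - x\<bar>" using z by (auto simp: closed_segment_eq_real_ivl split: if_splits)
    finally show ?thesis using M0 by (simp add: mult_left_mono)
  qed
  have "norm (f y - f x - (y - x) *\<^sub>R f' x) \<le> norm (y - x) * (3 * M * \<bar>y - x\<bar>)"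
  proof (rule vector_differentiable_bound_linearization[of "closed_segment x y" f f'])
    show "(f has_vector_derivative f' w) (at w within closed_segment x y)" if "w \<in> closed_segment x y" for w
      using f[of w] that sub by (meson has_vector_derivative_within_subset subsetD)
  qed (use lip in auto)
  then show ?thesis by (simp add: power2_eq_square mult_ac)
qed

text \<open>
  Two derivatives bounded by a summable sequence make the remainders at \<open>x\<close> quadratic with a summable constant, so the
  difference quotients can be summed directly.
\<close>
lemma infsum_has_vector_derivative:
  fixes f f' f'' :: "'k \<Rightarrow> real \<Rightarrow> complex"
  assumes S: "convex S" "x \<in> S" and M: "M summable_on UNIV"
    and f: "\<And>k z. z \<in> S \<Longrightarrow> (f k has_vector_derivative f' k z) (at z within S)"
    and f': "\<And>k z. z \<in> S \<Longrightarrow> (f' k has_vector_derivative f'' k z) (at z within S)"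
    and bf: "\<And>k z. z \<in> S \<Longrightarrow> norm (f k z) \<le> M k"
    and bf': "\<And>k z. z \<in> S \<Longrightarrow> norm (f' k z) \<le> M k"
    and bf'': "\<And>k z. z \<in> S \<Longrightarrow> norm (f'' k z) \<le> M k"
  shows "((\<lambda>z. \<Sum>\<^sub>\<infinity>k. f k z) has_vector_derivative (\<Sum>\<^sub>\<infinity>k. f' k x)) (at x within S)"
  unfolding has_vector_derivative_def
proof (rule has_derivativeI_sandwich[where e = 1])
  have sf: "(\<lambda>k. f k z) summable_on UNIV" "(\<lambda>k. f' k z) summable_on UNIV" if "z \<in> S" for z
    using that by (auto intro!: abs_summable_summable Infinite_Sum.abs_summable_on_comparison_test'[OF M] bf bf')
  define K where "K = (\<Sum>\<^sub>\<infinity>k. 3 * M k)"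
  show "norm ((\<Sum>\<^sub>\<infinity>k. f k y) - (\<Sum>\<^sub>\<infinity>k. f k x) - (y - x) *\<^sub>R (\<Sum>\<^sub>\<infinity>k. f' k x)) / norm (y - x) \<le> K * \<bar>y - x\<bar>"
    if y: "y \<in> S" "y \<noteq> x" for y
  proof -
    have hs: "((\<lambda>k. f k y - f k x - (y - x) *\<^sub>R f' k x) has_sum
        ((\<Sum>\<^sub>\<infinity>k. f k y) - (\<Sum>\<^sub>\<infinity>k. f k x) - (y - x) *\<^sub>R (\<Sum>\<^sub>\<infinity>k. f' k x))) UNIV"
      using sf[OF S(2)] sf[OF y(1)]
      by (intro has_sum_diff has_sum_scaleR has_sum_infsum) auto
    have "((\<lambda>k. 3 * M k * \<bar>y - x\<bar> ^ 2) has_sum (K * \<bar>y - x\<bar> ^ 2)) UNIV"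
      unfolding K_def by (intro has_sum_cmult_left has_sum_infsum summable_on_cmult_right M)
    then have "norm ((\<Sum>\<^sub>\<infinity>k. f k y) - (\<Sum>\<^sub>\<infinity>k. f k x) - (y - x) *\<^sub>R (\<Sum>\<^sub>\<infinity>k. f' k x)) \<le> K * \<bar>y - x\<bar> ^ 2"
      by (rule norm_infsum_le[OF hs]) (rule quadratic_remainder[OF S y(1) f f' bf''])
    then show ?thesis using y by (simp add: power2_eq_square divide_simps mult_ac)
  qed
  have "((\<lambda>y. K * \<bar>y - x\<bar>) \<longlongrightarrow> K * \<bar>x - x\<bar>) (at x within S)"
    by (intro tendsto_intros)
  then show "((\<lambda>y. K * \<bar>y - x\<bar>) \<longlongrightarrow> 0) (at x within S)" by simp
qed (auto intro: bounded_linear_scaleR_left)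

lemma has_vector_derivative_cis:
  "((\<lambda>\<theta>. cis (a * \<theta>)) has_vector_derivative \<i> * of_real a * cis (a * \<theta>)) (at \<theta> within S)"
proof -
  have "((\<lambda>\<theta>. exp (\<i> * of_real a * of_real \<theta>)) has_vector_derivative
      \<i> * of_real a * exp (\<i> * of_real a * of_real \<theta>)) (at \<theta> within S)"
    by (rule has_vector_derivative_real_field) (auto intro!: derivative_eq_intros)
  then show ?thesis by (simp add: cis_conv_exp mult.assoc)
qed

lemma fourier_series_has_vector_derivative:
  assumes "rapid c"
  shows "(fourier_series c has_vector_derivative fourier_series (\<lambda>k. \<i> * of_int k * c k) \<theta>) (at \<theta>)"
proof -
  have "((\<lambda>\<theta>. \<Sum>\<^sub>\<infinity>k. c k * cis (of_int k * \<theta>)) has_vector_derivative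
      (\<Sum>\<^sub>\<infinity>k. \<i> * of_int k * c k * cis (of_int k * \<theta>))) (at \<theta> within UNIV)"
  proof (rule infsum_has_vector_derivative[where M = "\<lambda>k. 1 * cmod (c k) * wt k ^ 2"
        and f'' = "\<lambda>k \<theta>. \<i> * of_int k * c k * (\<i> * of_int k * cis (of_int k * \<theta>))"])
    show "(\<lambda>k. 1 * cmod (c k) * wt k ^ 2) summable_on UNIV" by (rule rapid_summable[OF assms])
    have w: "1 \<le> wt k ^ 2" "\<bar>real_of_int k\<bar> \<le> wt k ^ 2" "\<bar>real_of_int k\<bar> * \<bar>real_of_int k\<bar> \<le> wt k ^ 2" for k
      by (auto simp: wt_def power2_eq_square algebra_simps)
    show "norm (c k * cis (of_int k * z)) \<le> 1 * cmod (c k) * wt k ^ 2" for k z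
      using mult_left_mono[OF w(1), of "cmod (c k)" k] by (simp add: norm_mult)
    show "norm (\<i> * of_int k * c k * cis (of_int k * z)) \<le> 1 * cmod (c k) * wt k ^ 2" for k z
      using mult_left_mono[OF w(2), of "cmod (c k)" k] by (simp add: norm_mult mult_ac)
    show "norm (\<i> * of_int k * c k * (\<i> * of_int k * cis (of_int k * z))) \<le> 1 * cmod (c k) * wt k ^ 2" for k z
      using mult_left_mono[OF w(3), of "cmod (c k)" k] by (simp add: norm_mult mult_ac)
    show "((\<lambda>\<theta>. c k * cis (of_int k * \<theta>)) has_vector_derivative \<i> * of_int k * c k * cis (of_int k * z)) (at z within UNIV)" for k z
      using has_vector_derivative_mult_right[OF has_vector_derivative_cis, of "c k" "of_int k" z UNIV]
      by (simp add: mult_ac)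
    show "((\<lambda>\<theta>. \<i> * of_int k * c k * cis (of_int k * \<theta>)) has_vector_derivative
        \<i> * of_int k * c k * (\<i> * of_int k * cis (of_int k * z))) (at z within UNIV)" for k z
      using has_vector_derivative_mult_right[OF has_vector_derivative_cis, of "\<i> * of_int k * c k" "of_int k" z UNIV]
      by simp
  qed auto
  then show ?thesis by (simp add: fourier_series_def[abs_def])
qed

lemma rapid_derivative: "rapid c \<Longrightarrow> rapid (\<lambda>k. \<i> * of_int k * c k)"
  by (rule rapid_multiplier[where B = 1 and s = 1]) (auto simp: wt_def norm_mult)

lemma cis_int_period: "cis (of_int k * (\<theta> + 2 * pi)) = cis (of_int k * \<theta>)"
proof -
  have "cis (of_int k * (\<theta> + 2 * pi)) = cis (of_int k * \<theta>) * cis (2 * pi * of_int k)"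
    by (simp add: cis_mult algebra_simps)
  then show ?thesis by (simp add: cis_multiple_2pi)
qed

lemma fourier_series_periodic: "fourier_series c (\<theta> + 2 * pi) = fourier_series c \<theta>"
  by (simp only: fourier_series_def cis_int_period)

lemma fourier_series_2pi: "fourier_series c (2 * pi) = fourier_series c 0"
  using fourier_series_periodic[of c 0] by simp

text \<open>
  All modes but \<open>k = 0\<close> have a periodic primitive.  This replaces an interchange of sum and integral.
\<close>
lemma integral_fourier_series:
  assumes "rapid c"
  shows "(fourier_series c has_integral of_real (2 * pi) * c 0) {0..2 * pi}"
proof -
  define e where "e k = c k / (\<i> * of_int k)" for k
  have e: "rapid e"
    unfolding e_def divide_inverse mult.commute[of "c _"]
    by (rule rapid_multiplier[OF assms, where B = 1 and s = 0])
       (auto simp: norm_divide norm_mult divide_simps)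
  have "(fourier_series (\<lambda>k. \<i> * of_int k * e k) has_integral fourier_series e (2 * pi) - fourier_series e 0) {0..2 * pi}"
    by (rule fundamental_theorem_of_calculus)
       (auto intro: has_vector_derivative_at_within fourier_series_has_vector_derivative e)
  then have 1: "(fourier_series (\<lambda>k. \<i> * of_int k * e k) has_integral 0) {0..2 * pi}"
    by (simp add: fourier_series_2pi)
  have "fourier_series c \<theta> = fourier_series (\<lambda>k. \<i> * of_int k * e k) \<theta> + c 0" for \<theta>
  proof -
    have "((\<lambda>k. \<i> * of_int k * e k * cis (of_int k * \<theta>)) has_sum fourier_series (\<lambda>k. \<i> * of_int k * e k) \<theta>) UNIV"
      unfolding fourier_series_def by (intro has_sum_infsum fourier_series_summable rapid_derivative e)
    moreover have "((\<lambda>k. if k = 0 then c 0 else 0) has_sum c 0) (UNIV :: int set)"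
      by (rule has_sum_finite_neutralI[of "{0}"]) auto
    ultimately have "((\<lambda>k. \<i> * of_int k * e k * cis (of_int k * \<theta>) + (if k = 0 then c 0 else 0)) has_sum
        fourier_series (\<lambda>k. \<i> * of_int k * e k) \<theta> + c 0) UNIV"
      by (rule has_sum_add)
    moreover have "\<i> * of_int k * e k * cis (of_int k * \<theta>) + (if k = 0 then c 0 else 0) = c k * cis (of_int k * \<theta>)" for k
      by (auto simp: e_def)
    ultimately show ?thesis by (simp add: fourier_series_def infsumI)
  qed
  then have "fourier_series c = (\<lambda>\<theta>. fourier_series (\<lambda>k. \<i> * of_int k * e k) \<theta> + c 0)" by blast
  moreover have "((\<lambda>\<theta>::real. c 0) has_integral (2 * pi) *\<^sub>R c 0) {0..2 * pi}"
    using has_integral_const_real[of "c 0" 0 "2 * pi"] by simp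
  ultimately show ?thesis
    using has_integral_add[OF 1, of "\<lambda>_. c 0" "(2 * pi) *\<^sub>R c 0"] by (simp add: scaleR_conv_of_real)
qed

lemma fourier_series_shift:
  "fourier_series c \<theta> * cis (of_int j * \<theta>) = fourier_series (\<lambda>k. c (k - j)) \<theta>"
proof -
  have "fourier_series c \<theta> * cis (of_int j * \<theta>) = (\<Sum>\<^sub>\<infinity>k. c k * cis (of_int (k + j) * \<theta>))"
    unfolding fourier_series_def infsum_cmult_left'[symmetric]
    by (simp add: mult.assoc cis_mult distrib_right)
  also have "\<dots> = (\<Sum>\<^sub>\<infinity>k. c (k - j) * cis (of_int k * \<theta>))"
    by (rule infsum_reindex_bij_witness[of _ "\<lambda>k. k - j" "\<lambda>k. k + j"]) auto
  finally show ?thesis by (simp add: fourier_series_def)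
qed

lemma rapid_shift:
  assumes "rapid c" shows "rapid (\<lambda>k. c (k - j))"
  unfolding rapid_def
proof
  fix r
  obtain C where C: "\<And>r. C r \<ge> 0" "\<And>r k. cmod (c k) \<le> C r / wt k ^ r"
    using rapidE[OF assms] by metis
  have "cmod (c (k - j)) \<le> C r * wt j ^ r / wt k ^ r" for k
  proof -
    have "wt k ^ r \<le> wt j ^ r * wt (k - j) ^ r"
      unfolding power_mult_distrib[symmetric] by (intro power_mono wt_diff_le) auto
    then have "1 / wt (k - j) ^ r \<le> wt j ^ r / wt k ^ r"
      by (simp add: divide_simps mult_ac)
    then have "C r * (1 / wt (k - j) ^ r) \<le> C r * (wt j ^ r / wt k ^ r)"
      using C(1) by (rule mult_left_mono)
    with C(2)[of "k - j" r] show ?thesis by simp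
  qed
  then show "\<exists>C. \<forall>k. cmod (c (k - j)) \<le> C / wt k ^ r" by blast
qed

lemma fourier_coeff_fourier_series:
  assumes "rapid c" shows "fourier_coeff (fourier_series c) k = c k"
proof -
  have "(\<lambda>\<theta>. fourier_series c \<theta> * cis (- of_int k * \<theta>)) = fourier_series (\<lambda>j. c (j - (- k)))"
    by (rule ext) (simp only: fourier_series_shift[symmetric] of_int_minus)
  then show ?thesis
    using integral_unique[OF integral_fourier_series[OF rapid_shift[OF assms, of "- k"]]]
    by (simp add: fourier_coeff_def)
qed

lemma rapid_convolution:
  assumes "rapid a" "rapid c" shows "rapid (convolution a c)"
  unfolding rapid_def
proof
  fix r
  obtain A where A: "\<And>r. A r \<ge> 0" "\<And>r k. cmod (a k) \<le> A r / wt k ^ r"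
    using rapidE[OF assms(1)] by metis
  define K where "K = (\<Sum>\<^sub>\<infinity>j. A r * cmod (c j) * wt j ^ r)"
  have "cmod (convolution a c k) \<le> K / wt k ^ r" for k
  proof -
    have bd: "cmod (a (k - j) * c j) \<le> A r * cmod (c j) * wt j ^ r / wt k ^ r" for j
    proof -
      have "wt k ^ r \<le> wt j ^ r * wt (k - j) ^ r"
        unfolding power_mult_distrib[symmetric] by (intro power_mono wt_diff_le) auto
      then have "1 / wt (k - j) ^ r \<le> wt j ^ r / wt k ^ r"
        by (simp add: divide_simps mult_ac)
      then have "A r * (1 / wt (k - j) ^ r) \<le> A r * (wt j ^ r / wt k ^ r)"
        using A(1) by (rule mult_left_mono)
      then have "cmod (a (k - j)) \<le> A r * (wt j ^ r / wt k ^ r)" using A(2)[of "k - j" r] by simp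
      from mult_right_mono[OF this, of "cmod (c j)"] show ?thesis by (simp add: norm_mult mult_ac)
    qed
    have s: "(\<lambda>j. A r * cmod (c j) * wt j ^ r / wt k ^ r) summable_on UNIV"
      using summable_on_cmult_left[OF rapid_summable[OF assms(2), of "A r" r], of "1 / wt k ^ r"] by simp
    have s2: "(\<lambda>j. cmod (a (k - j) * c j)) summable_on UNIV"
      by (rule Infinite_Sum.abs_summable_on_comparison_test'[OF s bd])
    have "cmod (convolution a c k) \<le> (\<Sum>\<^sub>\<infinity>j. cmod (a (k - j) * c j))"
      unfolding convolution_def by (rule norm_infsum_bound[OF s2])
    also have "\<dots> \<le> (\<Sum>\<^sub>\<infinity>j. A r * cmod (c j) * wt j ^ r / wt k ^ r)"
      by (rule infsum_mono[OF s2 s bd])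
    also have "\<dots> = K / wt k ^ r"
      unfolding K_def using infsum_cmult_left'[of "\<lambda>j. A r * cmod (c j) * wt j ^ r" "1 / wt k ^ r" UNIV] by simp
    finally show ?thesis .
  qed
  then show "\<exists>C. \<forall>k. cmod (convolution a c k) \<le> C / wt k ^ r" by blast
qed

lemma fourier_series_mult:
  assumes "rapid a" "rapid c"
  shows "fourier_series a \<theta> * fourier_series c \<theta> = fourier_series (convolution a c) \<theta>"
proof -
  define f where "f = (\<lambda>(k, j). a (k - j) * c j * cis (of_int k * \<theta>))"
  have nsum: "(\<lambda>(k, j). cmod (a k) * cmod (c j)) summable_on UNIV \<times> UNIV"
  proof (rule summable_on_SigmaI[where g = "\<lambda>k. cmod (a k) * (\<Sum>\<^sub>\<infinity>j. cmod (c j))"])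
    show "((\<lambda>j. case (k, j) of (k, j) \<Rightarrow> cmod (a k) * cmod (c j)) has_sum cmod (a k) * (\<Sum>\<^sub>\<infinity>j. cmod (c j))) UNIV" for k
      using has_sum_cmult_right[OF has_sum_infsum[OF rapid_abs_summable[OF assms(2)]]] by simp
    show "(\<lambda>k. cmod (a k) * (\<Sum>\<^sub>\<infinity>j. cmod (c j))) summable_on UNIV"
      by (rule summable_on_cmult_left[OF rapid_abs_summable[OF assms(1)]])
  qed auto
  have b: "bij_betw (\<lambda>(k, j). (k - j, j)) UNIV (UNIV :: (int \<times> int) set)"
    by (rule bij_betw_byWitness[of _ "\<lambda>(k, j). (k + j, j)"]) auto
  have "(\<lambda>z. (\<lambda>(k, j). cmod (a k) * cmod (c j)) ((\<lambda>(k, j). (k - j, j)) z)) summable_on UNIV"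
    using nsum by (subst summable_on_reindex_bij_betw[OF b]) simp
  then have "(\<lambda>z. norm (f z)) summable_on UNIV"
    by (simp add: f_def norm_mult case_prod_unfold)
  then have fs: "f summable_on UNIV \<times> UNIV" using abs_summable_summable by fastforce
  have "fourier_series a \<theta> * fourier_series c \<theta>
      = (\<Sum>\<^sub>\<infinity>j. fourier_series a \<theta> * (c j * cis (of_int j * \<theta>)))"
    unfolding fourier_series_def[of c] by (simp add: infsum_cmult_right')
  also have "\<dots> = (\<Sum>\<^sub>\<infinity>j. \<Sum>\<^sub>\<infinity>k. f (k, j))"
  proof (rule infsum_cong)
    fix j
    have "fourier_series a \<theta> * (c j * cis (of_int j * \<theta>)) = c j * fourier_series (\<lambda>k. a (k - j)) \<theta>"
      by (simp add: fourier_series_shift[symmetric] mult_ac)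
    also have "\<dots> = (\<Sum>\<^sub>\<infinity>k. f (k, j))"
      unfolding fourier_series_def infsum_cmult_right'[symmetric] f_def by (simp add: mult_ac)
    finally show "fourier_series a \<theta> * (c j * cis (of_int j * \<theta>)) = (\<Sum>\<^sub>\<infinity>k. f (k, j))" .
  qed
  also have "\<dots> = (\<Sum>\<^sub>\<infinity>k. \<Sum>\<^sub>\<infinity>j. f (k, j))"
    using infsum_swap_banach[of "\<lambda>k j. f (k, j)" UNIV UNIV] fs by simp
  also have "\<dots> = fourier_series (convolution a c) \<theta>"
    unfolding fourier_series_def convolution_def infsum_cmult_left'[symmetric] f_def by simp
  finally show ?thesis .
qed

lemma fourier_coeff_sum:
  "fourier_coeff (\<lambda>\<theta>. \<Sum>j\<in>F. c j * cis (of_int j * \<theta>)) k = (if k \<in> F then c k else 0)" if "finite F"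
proof -
  define e where "e j = (if j \<in> F then c j else 0)" for j
  define B where "B r = (\<Sum>j\<in>F. cmod (c j) * wt j ^ r)" for r
  have "cmod (e k) \<le> B r / wt k ^ r" for r k
  proof (cases "k \<in> F")
    case True
    have "cmod (c k) * wt k ^ r \<le> B r"
      unfolding B_def using True that by (intro member_le_sum) auto
    with True show ?thesis by (simp add: e_def field_simps)
  next
    case False
    then show ?thesis by (simp add: e_def B_def sum_nonneg)
  qed
  then have e: "rapid e" unfolding rapid_def by blast
  have "fourier_series e \<theta> = (\<Sum>j\<in>F. c j * cis (of_int j * \<theta>))" for \<theta>
    unfolding fourier_series_def
    by (rule infsumI, rule has_sum_finite_neutralI[OF that]) (auto simp: e_def)
  then have "(\<lambda>\<theta>. \<Sum>j\<in>F. c j * cis (of_int j * \<theta>)) = fourier_series e" by auto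
  then show ?thesis using fourier_coeff_fourier_series[OF e, of k] by (simp add: e_def)
qed

lemma bessel_inequality:
  assumes g: "continuous_on {0..2 * pi} g" and F: "finite F"
  shows "2 * pi * (\<Sum>k\<in>F. (cmod (fourier_coeff g k))\<^sup>2) \<le> integral {0..2 * pi} (\<lambda>\<theta>. (cmod (g \<theta>))\<^sup>2)"
proof -
  define c where "c = fourier_coeff g"
  define s where "s \<theta> = (\<Sum>k\<in>F. c k * cis (of_int k * \<theta>))" for \<theta>
  have cs: "continuous_on {0..2 * pi} s"
    unfolding s_def by (intro continuous_intros continuous_on_cis) 
  have proj: "integral {0..2 * pi} (\<lambda>\<theta>. h \<theta> * cnj (s \<theta>)) = 2 * pi * (\<Sum>k\<in>F. cnj (c k) * fourier_coeff h k)"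
    if h: "continuous_on {0..2 * pi} h" for h
  proof -
    have "integral {0..2 * pi} (\<lambda>\<theta>. h \<theta> * cnj (s \<theta>))
        = integral {0..2 * pi} (\<lambda>\<theta>. \<Sum>k\<in>F. cnj (c k) * (h \<theta> * cis (- of_int k * \<theta>)))"
      by (intro integral_cong) (simp add: s_def sum_distrib_left cis_cnj mult_ac)
    also have "\<dots> = (\<Sum>k\<in>F. integral {0..2 * pi} (\<lambda>\<theta>. cnj (c k) * (h \<theta> * cis (- of_int k * \<theta>))))"
      by (intro integral_sum F integrable_continuous_real continuous_intros h continuous_on_cis)
    finally show ?thesis
      by (simp only: integral_mult_right fourier_coeff_def) (simp add: sum_distrib_left mult_ac)
  qed
  have fs: "fourier_coeff s k = c k" if "k \<in> F" for k
    using fourier_coeff_sum[OF F, of c k] that by (simp add: s_def[abs_def])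
  define T where "T = 2 * pi * (\<Sum>k\<in>F. (cmod (c k))\<^sup>2)"
  have T: "complex_of_real T = 2 * pi * (\<Sum>k\<in>F. cnj (c k) * c k)"
    unfolding T_def of_real_mult of_real_sum complex_norm_square by (simp add: mult.commute)
  have 1: "integral {0..2 * pi} (\<lambda>\<theta>. g \<theta> * cnj (s \<theta>)) = T"
    unfolding T by (subst proj[OF g]) (simp add: c_def)
  have 2: "integral {0..2 * pi} (\<lambda>\<theta>. s \<theta> * cnj (s \<theta>)) = T"
    unfolding T by (subst proj[OF cs]) (simp add: fs)
  have ig: "(\<lambda>\<theta>. g \<theta> * cnj (s \<theta>)) integrable_on {0..2 * pi}" "(\<lambda>\<theta>. s \<theta> * cnj (s \<theta>)) integrable_on {0..2 * pi}"
    "(\<lambda>\<theta>. (cmod (g \<theta>))\<^sup>2) integrable_on {0..2 * pi}" "(\<lambda>\<theta>. (cmod (g \<theta> - s \<theta>))\<^sup>2) integrable_on {0..2 * pi}"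
    by (intro integrable_continuous_real continuous_intros g cs)+
  have r1: "((\<lambda>\<theta>. Re (g \<theta> * cnj (s \<theta>))) has_integral T) {0..2 * pi}"
    using has_integral_Re[OF integrable_integral[OF ig(1)]] 1 by simp
  have r2: "((\<lambda>\<theta>. Re (s \<theta> * cnj (s \<theta>))) has_integral T) {0..2 * pi}"
    using has_integral_Re[OF integrable_integral[OF ig(2)]] 2 by simp
  have "((\<lambda>\<theta>. (cmod (g \<theta>))\<^sup>2 - 2 * Re (g \<theta> * cnj (s \<theta>)) + Re (s \<theta> * cnj (s \<theta>))) has_integral
      integral {0..2 * pi} (\<lambda>\<theta>. (cmod (g \<theta>))\<^sup>2) - 2 * T + T) {0..2 * pi}"
    by (intro has_integral_add has_integral_diff has_integral_mult_right r1 r2 integrable_integral ig)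
  moreover have "(cmod (g \<theta>))\<^sup>2 - 2 * Re (g \<theta> * cnj (s \<theta>)) + Re (s \<theta> * cnj (s \<theta>)) \<ge> 0" for \<theta>
  proof -
    have "(cmod (g \<theta>))\<^sup>2 - 2 * Re (g \<theta> * cnj (s \<theta>)) + Re (s \<theta> * cnj (s \<theta>)) = (cmod (g \<theta> - s \<theta>))\<^sup>2"
      unfolding cmod_power2 by (simp add: power2_eq_square algebra_simps)
    then show ?thesis by simp
  qed
  ultimately have "0 \<le> integral {0..2 * pi} (\<lambda>\<theta>. (cmod (g \<theta>))\<^sup>2) - 2 * T + T"
    by (rule has_integral_nonneg)
  then show ?thesis by (simp add: T_def c_def)
qed

lemma riemann_lebesgue:
  assumes g: "continuous_on {0..2 * pi} g" and "inj h"
  shows "(\<lambda>n. fourier_coeff g (h n)) \<longlonglongrightarrow> 0"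
proof -
  define B where "B = integral {0..2 * pi} (\<lambda>\<theta>. (cmod (g \<theta>))\<^sup>2) / (2 * pi)"
  have "(\<Sum>i<n. (cmod (fourier_coeff g (h i)))\<^sup>2) \<le> B" for n
  proof -
    have "(\<Sum>i<n. (cmod (fourier_coeff g (h i)))\<^sup>2) = (\<Sum>k\<in>h ` {..<n}. (cmod (fourier_coeff g k))\<^sup>2)"
      using assms(2) by (subst sum.reindex) (auto intro: inj_on_subset)
    also have "\<dots> \<le> B"
      using bessel_inequality[OF g, of "h ` {..<n}"] by (simp add: B_def field_simps)
    finally show ?thesis .
  qed
  then have "summable (\<lambda>n. (cmod (fourier_coeff g (h n)))\<^sup>2)"
    by (intro summableI_nonneg_bounded[of _ B]) auto
  then have "(\<lambda>n. sqrt ((cmod (fourier_coeff g (h n)))\<^sup>2)) \<longlonglongrightarrow> sqrt 0"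
    by (intro tendsto_real_sqrt summable_LIMSEQ_zero)
  then show ?thesis by (simp add: tendsto_norm_zero_iff)
qed

lemma periodic_int:
  assumes "\<And>x::real. f (x + 2 * pi) = f x"
  shows "f (x + 2 * pi * of_int n) = f x"
proof -
  have "f (x + 2 * pi * of_nat n) = f x" for x n
  proof (induction n)
    case (Suc n)
    have "x + 2 * pi * of_nat (Suc n) = (x + 2 * pi * of_nat n) + 2 * pi" by (simp add: algebra_simps)
    then show ?case using assms Suc by metis
  qed simp
  from this[of x "nat n"] this[of "x + 2 * pi * of_int n" "nat (- n)"]
  show ?thesis by (cases "n \<ge> 0") auto
qed

lemma has_vector_derivative_quotient:
  assumes "(f has_vector_derivative f') (at x)"
  shows "((\<lambda>t. (f t - f x) /\<^sub>R (t - x)) \<longlongrightarrow> f') (at x)"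
proof (rule LIM_zero_cancel, rule tendsto_norm_zero_cancel, rule Lim_transform_eventually)
  show "((\<lambda>t. norm (f t - f x - (t - x) *\<^sub>R f') / norm (t - x)) \<longlongrightarrow> 0) (at x)"
    using assms by (simp add: has_vector_derivative_def has_derivative_iff_norm)
  show "\<forall>\<^sub>F t in at x. norm (f t - f x - (t - x) *\<^sub>R f') / norm (t - x) = norm ((f t - f x) /\<^sub>R (t - x) - f')"
    using eventually_neq_at_within[of x x UNIV]
  proof eventually_elim
    case (elim t)
    then have "(f t - f x) /\<^sub>R (t - x) - f' = (f t - f x - (t - x) *\<^sub>R f') /\<^sub>R (t - x)"
      by (simp add: scaleR_diff_right)
    then show ?case by (simp add: divide_inverse_commute)
  qed
qed

text \<open>
  Divide \<open>f - f x\<close> by \<open>cis \<theta> - cis x\<close> to get a continuous function \<open>g\<close>.  The Fourier coefficients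
  of \<open>f - f x\<close>, weighted by \<open>cis (k x)\<close>, are then consecutive differences of those of \<open>g\<close>.  The partial sums
  telescope, and the two end terms vanish in the limit by the Riemann-Lebesgue lemma.
\<close>
lemma fourier_inversion:
  assumes per: "\<And>x. f (x + 2 * pi) = f x" and rap: "rapid (fourier_coeff f)"
    and d: "\<And>x. (f has_vector_derivative f' x) (at x)"
  shows "f x = fourier_series (fourier_coeff f) x"
proof -
  \<comment> \<open>the value at the singular points is the limit of the quotient there\<close>
  define g where "g \<theta> = (if cis \<theta> = cis x then f' \<theta> / (\<i> * cis \<theta>) else (f \<theta> - f x) / (cis \<theta> - cis x))" for \<theta>
  have fx: "f \<theta> = f x" if cis_eq: "cis \<theta> = cis x" for \<theta>
  proof -
    obtain n :: int where "\<theta> = x + 2 * pi * of_int n"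
      using arg_cong[OF cis_eq, of Re] arg_cong[OF cis_eq, of Im] sin_cos_eq_iff[of \<theta> x] by auto
    then show ?thesis using periodic_int[of f, OF per] by simp
  qed
  have fg: "f \<theta> - f x = g \<theta> * cis \<theta> - cis x * g \<theta>" for \<theta>
    using fx[of \<theta>] by (auto simp: g_def field_simps)
  have cf: "isCont f \<theta>" for \<theta> using d by (rule has_vector_derivative_continuous)
  have dc: "(cis has_vector_derivative \<i> * cis \<theta>) (at \<theta>)" for \<theta>
    using has_vector_derivative_cis[of 1 \<theta> UNIV] by simp
  have cc: "isCont cis \<theta>" for \<theta> using dc by (rule has_vector_derivative_continuous)
  have cg: "isCont g \<theta>" for \<theta>
  proof (cases "cis \<theta> = cis x")
    case False
    have "\<forall>\<^sub>F t in nhds \<theta>. cis t \<noteq> cis x"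
    proof -
      have "isCont (\<lambda>t. cis t - cis x) \<theta>" by (intro continuous_intros cc)
      then have "\<forall>\<^sub>F t in at \<theta>. cis t - cis x \<noteq> 0"
        using False by (intro tendsto_imp_eventually_ne[of _ "cis \<theta> - cis x"]) (auto simp: isCont_def)
      with False show ?thesis by (simp add: eventually_nhds_conv_at)
    qed
    then have ev: "\<forall>\<^sub>F t in nhds \<theta>. g t = (f t - f x) / (cis t - cis x)"
      by eventually_elim (simp add: g_def)
    have "isCont (\<lambda>t. (f t - f x) / (cis t - cis x)) \<theta>"
      using False by (intro continuous_intros cf cc) auto
    then show ?thesis using isCont_cong[OF ev] by simp
  next
    case True
    have "\<forall>\<^sub>F t in at \<theta>. cis t \<noteq> cis x"
    proof -
      have "((\<lambda>t. (cis t - cis \<theta>) /\<^sub>R (t - \<theta>)) \<longlongrightarrow> \<i> * cis \<theta>) (at \<theta>)"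
        by (rule has_vector_derivative_quotient[OF dc])
      then have "\<forall>\<^sub>F t in at \<theta>. (cis t - cis \<theta>) /\<^sub>R (t - \<theta>) \<noteq> 0"
        by (rule tendsto_imp_eventually_ne) auto
      then show ?thesis by eventually_elim (use True in auto)
    qed
    then have ev: "\<forall>\<^sub>F t in at \<theta>. ((f t - f \<theta>) /\<^sub>R (t - \<theta>)) / ((cis t - cis \<theta>) /\<^sub>R (t - \<theta>)) = g t"
      using eventually_neq_at_within[of \<theta> \<theta> UNIV]
    proof eventually_elim
      case (elim t)
      then have "of_real (t - \<theta>) \<noteq> (0 :: complex)" by (simp del: of_real_diff)
      with elim show ?case
        by (simp add: g_def True fx[OF True] scaleR_conv_of_real del: of_real_diff)
    qed
    have "((\<lambda>t. ((f t - f \<theta>) /\<^sub>R (t - \<theta>)) / ((cis t - cis \<theta>) /\<^sub>R (t - \<theta>))) \<longlongrightarrow> f' \<theta> / (\<i> * cis \<theta>)) (at \<theta>)"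
      by (intro tendsto_divide has_vector_derivative_quotient d dc) auto
    then have "(g \<longlongrightarrow> f' \<theta> / (\<i> * cis \<theta>)) (at \<theta>)"
      using Lim_transform_eventually ev by fast
    moreover have "g \<theta> = f' \<theta> / (\<i> * cis \<theta>)" using True by (simp add: g_def)
    ultimately show ?thesis unfolding isCont_def by simp
  qed
  have cg': "continuous_on {0..2 * pi} g" by (intro continuous_at_imp_continuous_on ballI cg)
  have coeff: "fourier_coeff f k - (if k = 0 then f x else 0) = fourier_coeff g (k - 1) - cis x * fourier_coeff g k" for k
  proof -
    have c: "continuous_on {0..2 * pi} f" by (intro continuous_at_imp_continuous_on ballI cf)
    have k0: "fourier_coeff (\<lambda>_. f x) k = (if k = 0 then f x else 0)"
      using fourier_coeff_sum[of "{0}" "\<lambda>_. f x" k] by simp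
    have "integral {0..2 * pi} (\<lambda>\<theta>. f \<theta> * cis (- of_int k * \<theta>)) - integral {0..2 * pi} (\<lambda>\<theta>. f x * cis (- of_int k * \<theta>))
        = integral {0..2 * pi} (\<lambda>\<theta>. f \<theta> * cis (- of_int k * \<theta>) - f x * cis (- of_int k * \<theta>))"
      by (intro integral_diff[symmetric] integrable_continuous_real continuous_intros c continuous_on_cis)
    also have "\<dots> = integral {0..2 * pi} (\<lambda>\<theta>. g \<theta> * cis (- of_int (k - 1) * \<theta>) - cis x * (g \<theta> * cis (- of_int k * \<theta>)))"
    proof (intro integral_cong)
      fix \<theta>
      have w: "cis (- of_int (k - 1) * \<theta>) = cis \<theta> * cis (- of_int k * \<theta>)"
        by (simp add: cis_mult algebra_simps)
      have "(f \<theta> - f x) * cis (- of_int k * \<theta>) = (g \<theta> * cis \<theta> - cis x * g \<theta>) * cis (- of_int k * \<theta>)"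
        by (simp only: fg)
      then show "f \<theta> * cis (- of_int k * \<theta>) - f x * cis (- of_int k * \<theta>)
          = g \<theta> * cis (- of_int (k - 1) * \<theta>) - cis x * (g \<theta> * cis (- of_int k * \<theta>))"
        unfolding w by (simp only: left_diff_distrib right_diff_distrib mult_ac)
    qed
    also have "\<dots> = integral {0..2 * pi} (\<lambda>\<theta>. g \<theta> * cis (- of_int (k - 1) * \<theta>))
        - integral {0..2 * pi} (\<lambda>\<theta>. cis x * (g \<theta> * cis (- of_int k * \<theta>)))"
      by (intro integral_diff integrable_continuous_real continuous_intros cg' continuous_on_cis)
    finally have *: "integral {0..2 * pi} (\<lambda>\<theta>. f \<theta> * cis (- of_int k * \<theta>)) - integral {0..2 * pi} (\<lambda>\<theta>. f x * cis (- of_int k * \<theta>))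
        = integral {0..2 * pi} (\<lambda>\<theta>. g \<theta> * cis (- of_int (k - 1) * \<theta>))
          - cis x * integral {0..2 * pi} (\<lambda>\<theta>. g \<theta> * cis (- of_int k * \<theta>))"
      by simp
    show ?thesis unfolding k0[symmetric] fourier_coeff_def times_divide_eq_right diff_divide_distrib[symmetric] * ..
  qed
  define u where "u K = cis (of_int K * x) * fourier_coeff g (K - 1)" for K :: int
  define P where "P n = (\<Sum>k\<in>{- int n..int n}. fourier_coeff f k * cis (of_int k * x))" for n
  have tele: "P n - f x = u (- int n) - u (int n + 1)" for n
  proof -
    have "(\<Sum>k\<in>{- int n..int n}. u k - u (k + 1)) = u (- int n) - u (int n + 1)"
    proof (induction n)
      case (Suc n)
      have "{- int (Suc n)..int (Suc n)} = insert (- int (Suc n)) (insert (int (Suc n)) {- int n..int n})" by auto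
      then show ?case using Suc by (simp add: algebra_simps)
    qed simp
    moreover have "u k - u (k + 1) = fourier_coeff f k * cis (of_int k * x) - (if k = 0 then f x else 0)" for k
    proof -
      have "u k - u (k + 1) = cis (of_int k * x) * (fourier_coeff g (k - 1) - cis x * fourier_coeff g k)"
        by (simp add: u_def algebra_simps cis_mult[symmetric])
      then show ?thesis unfolding coeff[symmetric] by (auto simp: algebra_simps)
    qed
    ultimately show ?thesis by (simp add: P_def sum_subtractf)
  qed
  have lim0: "(\<lambda>n. u (h n)) \<longlonglongrightarrow> 0" if "inj h" for h :: "nat \<Rightarrow> int"
  proof -
    have "(\<lambda>n. fourier_coeff g (h n - 1)) \<longlonglongrightarrow> 0"
      by (rule riemann_lebesgue[OF cg']) (use that in \<open>auto simp: inj_def\<close>)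
    then have "(\<lambda>n. norm (fourier_coeff g (h n - 1))) \<longlonglongrightarrow> 0" by (rule tendsto_norm_zero)
    then have "(\<lambda>n. norm (u (h n))) \<longlonglongrightarrow> 0" by (simp add: u_def norm_mult)
    then show ?thesis by (rule tendsto_norm_zero_cancel)
  qed
  have "(\<lambda>n. u (- int n) - u (int n + 1)) \<longlonglongrightarrow> 0 - 0"
    by (intro tendsto_diff lim0) (auto simp: inj_def)
  then have "(\<lambda>n. P n - f x) \<longlonglongrightarrow> 0" by (simp add: tele)
  then have P1: "P \<longlonglongrightarrow> f x" by (simp add: LIM_zero_cancel)
  have "filterlim (\<lambda>n. {- int n..int n}) (finite_subsets_at_top UNIV) sequentially"
    unfolding filterlim_finite_subsets_at_top
  proof (intro allI impI)
    fix X :: "int set" assume "finite X \<and> X \<subseteq> UNIV"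
    then obtain B where B: "\<And>k. k \<in> X \<Longrightarrow> \<bar>k\<bar> \<le> B" using finite_imageI[of X abs] 
      by (metis Max_ge finite_imageI imageI)
    have "X \<subseteq> {- int n..int n}" if "n \<ge> nat B" for n
      using B that by fastforce
    then show "\<forall>\<^sub>F n in sequentially. finite {- int n..int n} \<and> X \<subseteq> {- int n..int n} \<and> {- int n..int n} \<subseteq> UNIV"
      unfolding eventually_sequentially by auto
  qed
  from filterlim_compose[OF infsum_tendsto[OF fourier_series_summable[OF rap, of x]] this]
  have "P \<longlonglongrightarrow> fourier_series (fourier_coeff f) x" unfolding P_def fourier_series_def .
  with P1 show ?thesis using LIMSEQ_unique by blast
qed

lemma rapid_fourier_coeff:
  assumes per: "\<And>n x. g n (x + 2 * pi) = g n x"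
    and d: "\<And>n x. (g n has_vector_derivative g (Suc n) x) (at x)"
  shows "rapid (fourier_coeff (g 0))"
proof -
  have cont: "continuous_on {0..2 * pi} (g n)" for n
    by (intro continuous_at_imp_continuous_on ballI has_vector_derivative_continuous[OF d])
  have step: "fourier_coeff (g (Suc n)) k = \<i> * of_int k * fourier_coeff (g n) k" for n k
  proof -
    have "((\<lambda>\<theta>. g n \<theta> * (\<i> * of_real (- of_int k) * cis (- of_int k * \<theta>)) + g (Suc n) \<theta> * cis (- of_int k * \<theta>))
        has_integral g n (2 * pi) * cis (- of_int k * (2 * pi)) - g n 0 * cis (- of_int k * 0)) {0..2 * pi}"
      by (rule fundamental_theorem_of_calculus)
        (use pi_ge_zero in \<open>simp, intro has_vector_derivative_mult has_vector_derivative_cis has_vector_derivative_at_within[OF d]\<close>)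
    moreover have "g n (2 * pi) * cis (- of_int k * (2 * pi)) - g n 0 * cis (- of_int k * 0) = 0"
      using per[of n 0] cis_int_period[of "- k" 0] by simp
    ultimately have "integral {0..2 * pi} (\<lambda>\<theta>. (\<i> * of_real (- of_int k)) * (g n \<theta> * cis (- of_int k * \<theta>)) + g (Suc n) \<theta> * cis (- of_int k * \<theta>)) = 0"
      by (intro integral_unique) (simp add: mult_ac)
    moreover have "integral {0..2 * pi} (\<lambda>\<theta>. (\<i> * of_real (- of_int k)) * (g n \<theta> * cis (- of_int k * \<theta>)) + g (Suc n) \<theta> * cis (- of_int k * \<theta>))
        = (\<i> * of_real (- of_int k)) * integral {0..2 * pi} (\<lambda>\<theta>. g n \<theta> * cis (- of_int k * \<theta>))
          + integral {0..2 * pi} (\<lambda>\<theta>. g (Suc n) \<theta> * cis (- of_int k * \<theta>))"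
      by (subst integral_add) (auto intro!: integrable_continuous_real continuous_intros cont continuous_on_cis)
    ultimately have "integral {0..2 * pi} (\<lambda>\<theta>. g (Suc n) \<theta> * cis (- of_int k * \<theta>))
        = \<i> * of_int k * integral {0..2 * pi} (\<lambda>\<theta>. g n \<theta> * cis (- of_int k * \<theta>))"
      by (simp add: eq_neg_iff_add_eq_0 add.commute)
    then show ?thesis by (simp add: fourier_coeff_def)
  qed
  have iter: "fourier_coeff (g n) k = (\<i> * of_int k) ^ n * fourier_coeff (g 0) k" for n k
    by (induction n) (simp_all add: step)
  have bd: "\<exists>B. \<forall>k. cmod (fourier_coeff (g n) k) \<le> B" for n
  proof -
    obtain B where B: "\<And>\<theta>. \<theta> \<in> {0..2 * pi} \<Longrightarrow> cmod (g n \<theta>) \<le> B"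
      using compact_imp_bounded[OF compact_continuous_image[OF cont compact_Icc]]
      unfolding bounded_iff by (metis image_eqI)
    have "cmod (fourier_coeff (g n) k) \<le> B" for k
    proof -
      have "cmod (integral {0..2 * pi} (\<lambda>\<theta>. g n \<theta> * cis (- of_int k * \<theta>))) \<le> B * (2 * pi - 0)"
        by (rule integral_bound) (auto intro!: continuous_intros cont continuous_on_cis simp: norm_mult B)
      then show ?thesis by (simp add: fourier_coeff_def norm_divide field_simps)
    qed
    then show ?thesis by blast
  qed
  show ?thesis
    unfolding rapid_def
  proof
    fix r
    obtain B0 where B0: "\<And>k. cmod (fourier_coeff (g 0) k) \<le> B0" using bd by blast
    obtain B1 where B1: "\<And>k. cmod (fourier_coeff (g r) k) \<le> B1" using bd by blast
    have "cmod (fourier_coeff (g 0) k) \<le> 2 ^ r * (B0 + B1) / wt k ^ r" for k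
    proof -
      have b: "B0 \<ge> 0" "B1 \<ge> 0" using order_trans[OF norm_ge_zero B0] order_trans[OF norm_ge_zero B1] by auto
      have "wt k ^ r * cmod (fourier_coeff (g 0) k) \<le> 2 ^ r * (B0 + B1)"
      proof (cases "k = 0")
        case True
        have "cmod (fourier_coeff (g 0) k) \<le> 1 * (B0 + B1)" using B0[of k] b by simp
        also have "\<dots> \<le> 2 ^ r * (B0 + B1)" using b by (intro mult_right_mono) (auto simp: one_le_power)
        finally show ?thesis using True by (simp add: wt_def)
      next
        case False
        have "wt k \<le> 2 * \<bar>real_of_int k\<bar>" using False by (simp add: wt_def)
        then have "wt k ^ r \<le> 2 ^ r * \<bar>real_of_int k\<bar> ^ r"
          unfolding power_mult_distrib[symmetric] by (intro power_mono) auto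
        then have "wt k ^ r * cmod (fourier_coeff (g 0) k) \<le> 2 ^ r * \<bar>real_of_int k\<bar> ^ r * cmod (fourier_coeff (g 0) k)"
          by (rule mult_right_mono) simp
        also have "\<dots> = 2 ^ r * cmod (fourier_coeff (g r) k)"
          by (simp add: iter[of r] norm_mult norm_power)
        also have "\<dots> \<le> 2 ^ r * (B0 + B1)" using B1[of k] b by simp
        finally show ?thesis .
      qed
      then show ?thesis by (simp add: field_simps)
    qed
    then show "\<exists>C. \<forall>k. cmod (fourier_coeff (g 0) k) \<le> C / wt k ^ r" by blast
  qed
qed

lemma smooth_circle_fourier:
  fixes a :: "real \<Rightarrow> real"
  assumes "smooth_circle a"
  defines "c \<equiv> fourier_coeff (\<lambda>\<theta>. of_real (a \<theta>))"
  shows "rapid c" and "of_real (a \<theta>) = fourier_series c \<theta>" and "c (- k) = cnj (c k)"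
proof -
  define D where "D = (\<lambda>g (x::real). vector_derivative g (at x) :: real)"
  define g where "g n x = complex_of_real ((D ^^ n) a x)" for n x
  have diff: "(D ^^ n) a differentiable at x" for n x
    using assms(1) by (simp add: smooth_circle_def D_def)
  have per: "(D ^^ n) a (x + 2 * pi) = (D ^^ n) a x" for n x
  proof (induction n arbitrary: x)
    case 0
    then show ?case using assms(1) by (simp add: smooth_circle_def)
  next
    case (Suc n)
    have h: "((D ^^ n) a has_vector_derivative (D ^^ Suc n) a y) (at y)" for y
      using diff[of n y] by (simp add: D_def vector_derivative_works)
    have "((\<lambda>x. (D ^^ n) a (x + 2 * pi)) has_vector_derivative (D ^^ Suc n) a (x + 2 * pi)) (at x)"
      using vector_diff_chain_at[of "\<lambda>x. x + 2 * pi" 1 x "(D ^^ n) a" "(D ^^ Suc n) a (x + 2 * pi)"] h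
      by (simp add: o_def has_vector_derivative_add_const)
    then have "((D ^^ n) a has_vector_derivative (D ^^ Suc n) a (x + 2 * pi)) (at x)"
      by (simp add: Suc)
    then show ?case using h[of x] vector_derivative_unique_at by blast
  qed
  have gd: "(g n has_vector_derivative g (Suc n) x) (at x)" for n x
    unfolding g_def
    by (rule has_vector_derivative_of_real)
      (use diff[of n x] in \<open>simp add: D_def vector_derivative_works has_real_derivative_iff_has_vector_derivative\<close>)
  have g0: "g 0 = (\<lambda>\<theta>. of_real (a \<theta>))" by (simp add: g_def fun_eq_iff)
  have "rapid (fourier_coeff (g 0))"
    by (rule rapid_fourier_coeff[where g = g]) (simp_all add: gd, simp add: g_def per)
  then show r: "rapid c" by (simp add: c_def g0)
  have "g 0 \<theta> = fourier_series (fourier_coeff (g 0)) \<theta>"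
    by (rule fourier_inversion[OF _ _ gd]) (use r in \<open>auto simp: c_def g0 per[of 0, simplified]\<close>)
  then show "of_real (a \<theta>) = fourier_series c \<theta>" by (simp add: c_def g0)
  show "c (- k) = cnj (c k)"
    by (simp add: c_def fourier_coeff_def integral_cnj cis_cnj)
qed

section \<open>The Dirichlet-to-Neumann operator of the cylinder\<close>

definition bdry_series :: "(idx \<Rightarrow> complex) \<Rightarrow> complex bdry_fun" where
  "bdry_series c i = fourier_series (\<lambda>k. c (i, k))"

definition bdry_rapid :: "(idx \<Rightarrow> complex) \<Rightarrow> bool" where
  "bdry_rapid c \<longleftrightarrow> (\<forall>i. rapid (\<lambda>k. c (i, k)))"

fun flip :: "bdry \<Rightarrow> bdry" where
  "flip Lower = Upper"
| "flip Upper = Lower"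

text \<open>
  The entries \<open>\<alpha>\<close> and \<open>-\<beta>\<close> of the square root \<open>G\<close> of the Dirichlet-to-Neumann operator on the
  \<open>k\<close>-th mode.  The value at \<open>k = 0\<close> is the limit \<open>k \<rightarrow> 0\<close>.
\<close>
definition root_diag :: "real \<Rightarrow> int \<Rightarrow> real" where
  "root_diag l k = sqrt (if k = 0 then 1 / (2 * l) else \<bar>real_of_int k\<bar> / (1 - exp (- (2 * \<bar>real_of_int k\<bar> * l))))"

definition root_off :: "real \<Rightarrow> int \<Rightarrow> real" where
  "root_off l k = exp (- (\<bar>real_of_int k\<bar> * l)) * root_diag l k"

definition DN_symbol :: "real \<Rightarrow> (idx \<Rightarrow> complex) \<Rightarrow> idx \<Rightarrow> complex" where
  "DN_symbol l c = (\<lambda>(i, k). of_real ((root_diag l k)\<^sup>2 + (root_off l k)\<^sup>2) * c (i, k)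
     - of_real (2 * root_diag l k * root_off l k) * c (flip i, k))"

lemma one_minus_exp_pos:
  assumes "l > 0" "k \<noteq> (0::int)"
  shows "1 - exp (- (2 * \<bar>real_of_int k\<bar> * l)) > 0"
  using assms by simp

lemma root_diag_sq:
  assumes "l > 0"
  shows "(root_diag l k)\<^sup>2 = (if k = 0 then 1 / (2 * l) else \<bar>real_of_int k\<bar> / (1 - exp (- (2 * \<bar>real_of_int k\<bar> * l))))"
proof -
  have "(if k = 0 then 1 / (2 * l) else \<bar>real_of_int k\<bar> / (1 - exp (- (2 * \<bar>real_of_int k\<bar> * l)))) \<ge> 0"
    using assms one_minus_exp_pos[OF assms, of k] by (auto intro!: divide_nonneg_pos)
  then show ?thesis unfolding root_diag_def by (rule real_sqrt_pow2)
qed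

lemma root_diag_pos: "l > 0 \<Longrightarrow> root_diag l k > 0"
  unfolding root_diag_def using one_minus_exp_pos[of l k] by simp

lemma root_off_pos: "l > 0 \<Longrightarrow> root_off l k > 0"
  unfolding root_off_def using root_diag_pos by simp

lemma root_diag_sq_le:
  assumes "l > 0"
  shows "(root_diag l k)\<^sup>2 \<le> (1 / (2 * l) + 1 / (1 - exp (- (2 * l)))) * wt k"
proof (cases "k = 0")
  case True
  then show ?thesis using assms by (simp add: root_diag_sq wt_def)
next
  case False
  have e: "exp (- (2 * \<bar>real_of_int k\<bar> * l)) \<le> exp (- (2 * l))"
    using False assms by (simp add: mult_le_cancel_right1)
  have p: "1 - exp (- (2 * l)) > 0" using assms by simp
  have "\<bar>real_of_int k\<bar> / (1 - exp (- (2 * \<bar>real_of_int k\<bar> * l))) \<le> wt k / (1 - exp (- (2 * l)))"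
    using e p by (intro frac_le) (auto simp: wt_def)
  also have "\<dots> \<le> (1 / (2 * l) + 1 / (1 - exp (- (2 * l)))) * wt k"
    using assms by (simp add: algebra_simps)
  finally show ?thesis using False by (simp add: root_diag_sq[OF assms])
qed

lemma root_off_le: "l > 0 \<Longrightarrow> root_off l k \<le> root_diag l k"
  unfolding root_off_def using root_diag_pos[of l k] by (simp add: mult_le_cancel_right1)

text \<open>
  The solution of \<open>\<phi>'' = k\<^sup>2 \<phi>\<close> with \<open>\<phi>(0) = 0\<close> and \<open>\<phi>(l) = 1\<close>.
\<close>
definition profile :: "real \<Rightarrow> int \<Rightarrow> real \<Rightarrow> real" where
  "profile l k t = (if k = 0 then t / l else sinh (\<bar>real_of_int k\<bar> * t) / sinh (\<bar>real_of_int k\<bar> * l))"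

definition profile' :: "real \<Rightarrow> int \<Rightarrow> real \<Rightarrow> real" where
  "profile' l k t = (if k = 0 then 1 / l else \<bar>real_of_int k\<bar> * cosh (\<bar>real_of_int k\<bar> * t) / sinh (\<bar>real_of_int k\<bar> * l))"

lemma profile_derivs:
  "(profile l k has_real_derivative profile' l k t) (at t within S)"
  "(profile' l k has_real_derivative (real_of_int k)\<^sup>2 * profile l k t) (at t within S)"
proof -
  define s where "s = \<bar>real_of_int k\<bar>"
  have s2: "(real_of_int k)\<^sup>2 = s * s" by (simp add: s_def power2_eq_square)
  have "((\<lambda>t. sinh (s * t) / sinh (s * l)) has_real_derivative s * cosh (s * t) / sinh (s * l)) (at t within S)"
    by (rule DERIV_cdivide) (auto intro!: derivative_eq_intros)
  moreover have "((\<lambda>t. t / l) has_real_derivative 1 / l) (at t within S)"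
    by (rule DERIV_cdivide) (rule DERIV_ident)
  ultimately show "(profile l k has_real_derivative profile' l k t) (at t within S)"
    by (cases "k = 0") (simp_all add: profile_def[abs_def] profile'_def s_def)
  have "((\<lambda>t. s * cosh (s * t) / sinh (s * l)) has_real_derivative s * s * sinh (s * t) / sinh (s * l)) (at t within S)"
    by (rule DERIV_cdivide) (auto intro!: derivative_eq_intros)
  then show "(profile' l k has_real_derivative (real_of_int k)\<^sup>2 * profile l k t) (at t within S)"
    unfolding s2 by (cases "k = 0") (simp_all add: profile_def profile'_def[abs_def] s_def)
qed

lemma exp_sinh: "1 - exp (- (2 * x)) = 2 * exp (- x) * sinh (x::real)"
  and exp_cosh: "1 + exp (- (2 * x)) = 2 * exp (- x) * cosh (x::real)"
proof -
  have "exp (- x) * exp x = 1" "exp (- x) * exp (- x) = exp (- (2 * x))"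
    by (simp_all add: mult_exp_exp)
  then show "1 - exp (- (2 * x)) = 2 * exp (- x) * sinh x" "1 + exp (- (2 * x)) = 2 * exp (- x) * cosh x"
    by (simp_all add: sinh_field_def cosh_field_def distrib_left right_diff_distrib)
qed

lemma profile_endpoints:
  assumes "l > 0"
  shows "profile l k 0 = 0" "profile l k l = 1"
    "profile' l k 0 = 2 * root_diag l k * root_off l k"
    "profile' l k l = (root_diag l k)\<^sup>2 + (root_off l k)\<^sup>2"
proof -
  show "profile l k 0 = 0" "profile l k l = 1" using assms by (auto simp: profile_def)
  show "profile' l k 0 = 2 * root_diag l k * root_off l k"
  proof (cases "k = 0")
    case True
    then show ?thesis using assms root_diag_sq[OF assms, of k]
      by (simp add: profile'_def root_off_def power2_eq_square field_simps)
  next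
    case False
    define x where "x = \<bar>real_of_int k\<bar> * l"
    have x: "x > 0" using False assms by (simp add: x_def)
    have "2 * root_diag l k * root_off l k = 2 * exp (- x) * (root_diag l k)\<^sup>2"
      by (simp add: root_off_def x_def power2_eq_square)
    also have "\<dots> = \<bar>real_of_int k\<bar> * (2 * exp (- x) / (1 - exp (- (2 * x))))"
      using False by (simp add: root_diag_sq[OF assms] x_def mult.assoc)
    also have "2 * exp (- x) / (1 - exp (- (2 * x))) = 1 / sinh x"
      by (simp add: exp_sinh)
    finally show ?thesis using False by (simp add: profile'_def x_def)
  qed
  show "profile' l k l = (root_diag l k)\<^sup>2 + (root_off l k)\<^sup>2"
  proof (cases "k = 0")
    case True
    then show ?thesis using assms root_diag_sq[OF assms, of k]
      by (simp add: profile'_def root_off_def field_simps)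
  next
    case False
    define x where "x = \<bar>real_of_int k\<bar> * l"
    have x: "x > 0" using False assms by (simp add: x_def)
    have "(root_diag l k)\<^sup>2 + (root_off l k)\<^sup>2 = (1 + exp (- (2 * x))) * (root_diag l k)\<^sup>2"
      by (simp add: root_off_def x_def power_mult_distrib exp_double[symmetric] algebra_simps)
    also have "\<dots> = \<bar>real_of_int k\<bar> * ((1 + exp (- (2 * x))) / (1 - exp (- (2 * x))))"
      using False by (simp add: root_diag_sq[OF assms] x_def mult.assoc)
    also have "(1 + exp (- (2 * x))) / (1 - exp (- (2 * x))) = cosh x / sinh x"
      by (simp add: exp_sinh exp_cosh)
    finally show ?thesis using False by (simp add: profile'_def x_def)
  qed
qed

lemma profile_bounds:
  assumes "l > 0" "0 \<le> t" "t \<le> l"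
  shows "\<bar>profile l k t\<bar> \<le> 1" "\<bar>profile' l k t\<bar> \<le> 2 * (root_diag l k)\<^sup>2"
proof -
  show "\<bar>profile l k t\<bar> \<le> 1"
  proof (cases "k = 0")
    case False
    have "sinh (\<bar>real_of_int k\<bar> * t) \<le> sinh (\<bar>real_of_int k\<bar> * l)"
      using assms by (simp add: mult_left_mono)
    then show ?thesis using False assms by (simp add: profile_def abs_mult)
  qed (use assms in \<open>simp add: profile_def\<close>)
  have "\<bar>profile' l k t\<bar> \<le> profile' l k l"
  proof (cases "k = 0")
    case False
    have "cosh (\<bar>real_of_int k\<bar> * t) \<le> cosh (\<bar>real_of_int k\<bar> * l)"
      using assms by (subst cosh_real_nonneg_le_iff) (auto simp: mult_left_mono)
    then show ?thesis using False assms by (simp add: profile'_def abs_mult divide_right_mono mult_left_mono)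
  qed (use assms in \<open>simp add: profile'_def\<close>)
  also have "\<dots> \<le> 2 * (root_diag l k)\<^sup>2"
    using power_mono[OF root_off_le[OF assms(1), of k], of 2] root_off_pos[OF assms(1), of k]
    by (simp add: profile_endpoints[OF assms(1)])
  finally show "\<bar>profile' l k t\<bar> \<le> 2 * (root_diag l k)\<^sup>2" .
qed

definition mode_series :: "(int \<Rightarrow> real \<Rightarrow> complex) \<Rightarrow> real \<Rightarrow> real \<Rightarrow> complex" where
  "mode_series p \<theta> t = fourier_series (\<lambda>k. p k t) \<theta>"

text \<open>
  A family of profiles \<open>p\<close> with derivatives \<open>q\<close> and \<open>r\<close>, dominated by a rapidly decaying sequence.  This is what
  term-by-term differentiation up to the boundary needs.
\<close>
definition tame :: "real \<Rightarrow> (int \<Rightarrow> real \<Rightarrow> complex) \<Rightarrow> (int \<Rightarrow> real \<Rightarrow> complex) \<Rightarrow> (int \<Rightarrow> real \<Rightarrow> complex) \<Rightarrow> bool" where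
  "tame l p q r \<longleftrightarrow>
     (\<forall>k. \<forall>t\<in>{0..l}. (p k has_vector_derivative q k t) (at t within {0..l}) \<and>
        (q k has_vector_derivative r k t) (at t within {0..l})) \<and>
     (\<exists>M. rapid (\<lambda>k. of_real (M k)) \<and> (\<forall>k. \<forall>t\<in>{0..l}. cmod (p k t) \<le> M k \<and> cmod (q k t) \<le> M k \<and> cmod (r k t) \<le> M k))"

lemma rapid_bounded:
  assumes "rapid (\<lambda>k. of_real (M k))" "\<And>k. cmod (c k) \<le> M k"
  shows "rapid c"
  unfolding rapid_def
proof
  fix r
  obtain C where C: "\<And>r k. cmod (of_real (M k)) \<le> C r / wt k ^ r"
    using rapidE[OF assms(1)] by metis
  have "cmod (c k) \<le> C r / wt k ^ r" for k
    using assms(2)[of k] C[of k r] by (simp add: abs_le_iff)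
  then show "\<exists>C. \<forall>k. cmod (c k) \<le> C / wt k ^ r" by blast
qed

lemma tame_rapid: "tame l p q r \<Longrightarrow> t \<in> {0..l} \<Longrightarrow> rapid (\<lambda>k. p k t)"
  unfolding tame_def by (blast intro: rapid_bounded)

lemma tame_continuous:
  assumes "tame l p q r"
  shows "continuous_on (UNIV \<times> {0..l}) (\<lambda>(\<theta>, t). mode_series p \<theta> t)"
proof -
  obtain M where M: "rapid (\<lambda>k. of_real (M k))" "\<And>k t. t \<in> {0..l} \<Longrightarrow> cmod (p k t) \<le> M k"
    using assms unfolding tame_def by blast
  have M0: "M k \<ge> 0" if "l \<ge> 0" for k using order_trans[OF norm_ge_zero M(2)[of 0 k]] that by simp
  show ?thesis
  proof (cases "l \<ge> 0")
    case True
    have "uniform_limit (UNIV \<times> {0..l}) (\<lambda>X z. \<Sum>k\<in>X. (\<lambda>(\<theta>, t). p k t * cis (of_int k * \<theta>)) z)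
        (\<lambda>z. \<Sum>\<^sub>\<infinity>k. (\<lambda>(\<theta>, t). p k t * cis (of_int k * \<theta>)) z) (finite_subsets_at_top UNIV)"
    proof (rule Weierstrass_m_test_general)
      show "M summable_on UNIV" using rapid_abs_summable[OF M(1)] M0[OF True] by simp
    qed (use M(2) in \<open>auto simp: norm_mult\<close>)
    moreover have "continuous_on (UNIV \<times> {0..l}) (\<lambda>z. \<Sum>k\<in>X. (\<lambda>(\<theta>, t). p k t * cis (of_int k * \<theta>)) z)" for X
    proof -
      have "continuous_on {0..l} (p k)" for k
        unfolding continuous_on_eq_continuous_within
        using assms by (auto simp: tame_def intro: has_vector_derivative_continuous)
      then have "continuous_on (UNIV \<times> {0..l}) (\<lambda>z::real \<times> real. p k (snd z))" for k
        by (rule continuous_on_compose2[OF _ continuous_on_snd[OF continuous_on_id]]) auto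
      then show ?thesis
        by (simp add: case_prod_unfold) (intro continuous_intros continuous_on_cis)
    qed
    ultimately have "continuous_on (UNIV \<times> {0..l}) (\<lambda>z. \<Sum>\<^sub>\<infinity>k. (\<lambda>(\<theta>, t). p k t * cis (of_int k * \<theta>)) z)"
      by (intro uniform_limit_theorem[where F = "finite_subsets_at_top UNIV"]) auto
    then show ?thesis by (simp add: mode_series_def fourier_series_def case_prod_unfold)
  qed auto
qed

lemma tame_theta_derivative:
  assumes "tame l p q r" "t \<in> {0..l}"
  shows "((\<lambda>s. mode_series p s t) has_vector_derivative mode_series (\<lambda>k t. \<i> * of_int k * p k t) \<theta> t) (at \<theta>)"
  unfolding mode_series_def by (rule fourier_series_has_vector_derivative[OF tame_rapid[OF assms]])

lemma tame_t_derivative: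
  assumes "tame l p q r" "t \<in> {0..l}"
  shows "((\<lambda>s. mode_series p \<theta> s) has_vector_derivative mode_series q \<theta> t) (at t within {0..l})"
proof -
  obtain M where M: "rapid (\<lambda>k. of_real (M k))"
    "\<And>k t. t \<in> {0..l} \<Longrightarrow> cmod (p k t) \<le> M k \<and> cmod (q k t) \<le> M k \<and> cmod (r k t) \<le> M k"
    using assms unfolding tame_def by blast
  have M0: "M k \<ge> 0" for k using order_trans[OF norm_ge_zero] M(2)[OF assms(2)] by blast
  have d: "((\<lambda>t. p k t * cis (of_int k * \<theta>)) has_vector_derivative q k z * cis (of_int k * \<theta>)) (at z within {0..l})"
    "((\<lambda>t. q k t * cis (of_int k * \<theta>)) has_vector_derivative r k z * cis (of_int k * \<theta>)) (at z within {0..l})"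
    if "z \<in> {0..l}" for k z
    using assms(1) that by (auto simp: tame_def intro!: has_vector_derivative_mult_left)
  show ?thesis
    unfolding mode_series_def fourier_series_def
  proof (rule infsum_has_vector_derivative[where M = M and f'' = "\<lambda>k t. r k t * cis (of_int k * \<theta>)"])
    show "M summable_on UNIV" using rapid_abs_summable[OF M(1)] M0 by simp
  qed (use d assms(2) M(2) in \<open>auto simp: norm_mult\<close>)
qed

lemma tame_scale:
  assumes "tame l p q r" and e: "\<And>k. cmod (e k) \<le> wt k ^ s"
  shows "tame l (\<lambda>k t. e k * p k t) (\<lambda>k t. e k * q k t) (\<lambda>k t. e k * r k t)"
proof -
  obtain M where M: "rapid (\<lambda>k. of_real (M k))"
    "\<And>k t. t \<in> {0..l} \<Longrightarrow> cmod (p k t) \<le> M k \<and> cmod (q k t) \<le> M k \<and> cmod (r k t) \<le> M k"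
    using assms unfolding tame_def by blast
  have "rapid (\<lambda>k. of_real (wt k ^ s) * of_real (M k))"
    by (rule rapid_multiplier[OF M(1), where B = 1 and s = s]) (simp add: norm_power)
  then have "rapid (\<lambda>k. of_real (wt k ^ s * M k))" by simp
  moreover have "\<forall>k. \<forall>t\<in>{0..l}. cmod (e k * p k t) \<le> wt k ^ s * M k \<and> cmod (e k * q k t) \<le> wt k ^ s * M k
      \<and> cmod (e k * r k t) \<le> wt k ^ s * M k"
    unfolding norm_mult using e M(2) by (auto intro!: mult_mono)
  moreover have "\<forall>k. \<forall>t\<in>{0..l}. ((\<lambda>t. e k * p k t) has_vector_derivative e k * q k t) (at t within {0..l}) \<and>
      ((\<lambda>t. e k * q k t) has_vector_derivative e k * r k t) (at t within {0..l})"
    using assms(1) unfolding tame_def by (auto intro!: has_vector_derivative_mult_right)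
  ultimately show ?thesis
    unfolding tame_def
    by - (rule conjI, assumption, rule exI[of _ "\<lambda>k. wt k ^ s * M k"], rule conjI, assumption+)
qed

text \<open>
  Here \<open>v\<close> need only agree with the series inside the cylinder, so that the lemma also applies to
  partial derivatives, whose values outside are arbitrary.
\<close>
lemma tame_partials:
  assumes t: "tame l p q r" and v: "\<And>\<theta> t. 0 < t \<Longrightarrow> t < l \<Longrightarrow> v (\<theta>, t) = mode_series p \<theta> t"
    and "0 < t" "t < l"
  shows "((\<lambda>s. v (s, t)) has_vector_derivative mode_series (\<lambda>k t. \<i> * of_int k * p k t) \<theta> t) (at \<theta>)"
    and "((\<lambda>s. v (\<theta>, s)) has_vector_derivative mode_series q \<theta> t) (at t)"
    and "partial_theta v (\<theta>, t) = mode_series (\<lambda>k t. \<i> * of_int k * p k t) \<theta> t"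
    and "partial_t v (\<theta>, t) = mode_series q \<theta> t"
proof -
  show 1: "((\<lambda>s. v (s, t)) has_vector_derivative mode_series (\<lambda>k t. \<i> * of_int k * p k t) \<theta> t) (at \<theta>)"
    using tame_theta_derivative[OF t, of t \<theta>] assms(3,4) by (simp add: v)
  have "((\<lambda>s. mode_series p \<theta> s) has_vector_derivative mode_series q \<theta> t) (at t)"
    using tame_t_derivative[OF t, of t \<theta>] assms(3,4) by (simp add: at_within_Icc_at)
  then show 2: "((\<lambda>s. v (\<theta>, s)) has_vector_derivative mode_series q \<theta> t) (at t)"
    by (rule has_vector_derivative_transform_within_open[of _ _ _ "{0<..<l}"]) (use assms in auto)
  show "partial_theta v (\<theta>, t) = mode_series (\<lambda>k t. \<i> * of_int k * p k t) \<theta> t"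
    using vector_derivative_at[OF 1] by (simp add: partial_theta_def)
  show "partial_t v (\<theta>, t) = mode_series q \<theta> t"
    using vector_derivative_at[OF 2] by (simp add: partial_t_def)
qed

lemma tame_C1:
  assumes t: "tame l p q r" and t2: "tame l q r r'"
    and v: "\<And>\<theta> t. 0 < t \<Longrightarrow> t < l \<Longrightarrow> v (\<theta>, t) = mode_series p \<theta> t"
  shows "C1_on (UNIV \<times> {0<..<l}) v"
  unfolding C1_on_def
proof (intro conjI)
  note P = tame_partials[OF t v]
  show "\<forall>(\<theta>, t)\<in>UNIV \<times> {0<..<l}. (\<lambda>s. v (s, t)) differentiable at \<theta> \<and> (\<lambda>s. v (\<theta>, s)) differentiable at t"
    using differentiableI_vector[OF P(1)] differentiableI_vector[OF P(2)] by auto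
  have "tame l (\<lambda>k t. \<i> * of_int k * p k t) (\<lambda>k t. \<i> * of_int k * q k t) (\<lambda>k t. \<i> * of_int k * r k t)"
    by (rule tame_scale[OF t, where s = 1]) (simp add: norm_mult wt_def)
  from continuous_on_subset[OF tame_continuous[OF this], of "UNIV \<times> {0<..<l}"]
  show "continuous_on (UNIV \<times> {0<..<l}) (partial_theta v)"
    by (rule continuous_on_eq) (use P(3) in auto)
  from continuous_on_subset[OF tame_continuous[OF t2], of "UNIV \<times> {0<..<l}"]
  show "continuous_on (UNIV \<times> {0<..<l}) (partial_t v)"
    by (rule continuous_on_eq) (use P(4) in auto)
qed

definition modes :: "real \<Rightarrow> (idx \<Rightarrow> complex) \<Rightarrow> int \<Rightarrow> real \<Rightarrow> complex" where
  "modes l c k t = c (Lower, k) * of_real (profile l k (l - t)) + c (Upper, k) * of_real (profile l k t)"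

definition modes' :: "real \<Rightarrow> (idx \<Rightarrow> complex) \<Rightarrow> int \<Rightarrow> real \<Rightarrow> complex" where
  "modes' l c k t = c (Upper, k) * of_real (profile' l k t) - c (Lower, k) * of_real (profile' l k (l - t))"

lemma norm_of_int_sq_le_wt: "cmod ((of_int k)\<^sup>2) \<le> wt k ^ 2"
proof -
  have "cmod ((of_int k)\<^sup>2) = \<bar>real_of_int k\<bar> ^ 2" unfolding norm_power norm_of_int ..
  also have "\<dots> \<le> wt k ^ 2" by (intro power_mono) (auto simp: wt_def)
  finally show ?thesis .
qed

lemma tame_modes:
  assumes l: "l > 0" and c: "bdry_rapid c"
  shows "tame l (modes l c) (modes' l c) (\<lambda>k t. (of_int k)\<^sup>2 * modes l c k t)"
    and "tame l (modes' l c) (\<lambda>k t. (of_int k)\<^sup>2 * modes l c k t) (\<lambda>k t. (of_int k)\<^sup>2 * modes' l c k t)"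
proof -
  \<comment> \<open>both profiles and their derivatives are at most \<open>B (1 + |k|)\<close>\<close>
  define B where "B = 1 + 2 * (1 / (2 * l) + 1 / (1 - exp (- (2 * l))))"
  have B1: "B \<ge> 1" using l by (simp add: B_def)
  define M where "M k = B * wt k * cmod (c (Lower, k)) + B * wt k * cmod (c (Upper, k))" for k
  define N where "N k = wt k ^ 2 * M k" for k
  have d0: "((\<lambda>t. of_real (profile l k t)) has_vector_derivative complex_of_real (profile' l k t)) (at t within S)"
    "((\<lambda>t. of_real (profile' l k t)) has_vector_derivative complex_of_real ((real_of_int k)\<^sup>2 * profile l k t)) (at t within S)"
    "((\<lambda>t. of_real (profile l k (l - t))) has_vector_derivative complex_of_real (- profile' l k (l - t))) (at t within S)"
    "((\<lambda>t. of_real (profile' l k (l - t))) has_vector_derivative complex_of_real (- ((real_of_int k)\<^sup>2 * profile l k (l - t)))) (at t within S)"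
    for k t S
  proof -
    have neg: "((\<lambda>t. l - t) has_real_derivative - 1) (at t within S)"
      by (auto intro!: derivative_eq_intros)
    show "((\<lambda>t. of_real (profile l k t)) has_vector_derivative complex_of_real (profile' l k t)) (at t within S)"
      "((\<lambda>t. of_real (profile' l k t)) has_vector_derivative complex_of_real ((real_of_int k)\<^sup>2 * profile l k t)) (at t within S)"
      by (intro has_vector_derivative_of_real profile_derivs)+
    show "((\<lambda>t. of_real (profile l k (l - t))) has_vector_derivative complex_of_real (- profile' l k (l - t))) (at t within S)"
      using has_vector_derivative_of_real[OF DERIV_chain'[OF neg profile_derivs(1)]] by simp
    show "((\<lambda>t. of_real (profile' l k (l - t))) has_vector_derivative complex_of_real (- ((real_of_int k)\<^sup>2 * profile l k (l - t)))) (at t within S)"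
      using has_vector_derivative_of_real[OF DERIV_chain'[OF neg profile_derivs(2)]] by simp
  qed
  have d: "(modes l c k has_vector_derivative modes' l c k t) (at t within {0..l})" for k t
    unfolding modes_def[abs_def] modes'_def
    using has_vector_derivative_add[OF has_vector_derivative_mult_right[OF d0(3), of "c (Lower, k)"]
        has_vector_derivative_mult_right[OF d0(1), of "c (Upper, k)"]] by simp
  have d': "(modes' l c k has_vector_derivative (of_int k)\<^sup>2 * modes l c k t) (at t within {0..l})" for k t
    unfolding modes_def modes'_def[abs_def]
    using has_vector_derivative_diff[OF has_vector_derivative_mult_right[OF d0(2), of "c (Upper, k)"]
        has_vector_derivative_mult_right[OF d0(4), of "c (Lower, k)"]] by (simp add: algebra_simps)
  have d'': "((\<lambda>t. (of_int k)\<^sup>2 * modes l c k t) has_vector_derivative (of_int k)\<^sup>2 * modes' l c k t) (at t within {0..l})" for k t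
    by (intro has_vector_derivative_mult_right d)
  have pb: "\<bar>profile l k t\<bar> \<le> B * wt k" "\<bar>profile' l k t\<bar> \<le> B * wt k" if "t \<in> {0..l}" for k t
  proof -
    have "1 * 1 \<le> B * wt k" using B1 by (intro mult_mono) auto
    then show "\<bar>profile l k t\<bar> \<le> B * wt k" using profile_bounds(1)[OF l, of t k] that by auto
    have "\<bar>profile' l k t\<bar> \<le> 2 * (root_diag l k)\<^sup>2" using profile_bounds(2)[OF l, of t k] that by auto
    also have "\<dots> \<le> 2 * ((1 / (2 * l) + 1 / (1 - exp (- (2 * l)))) * wt k)"
      using root_diag_sq_le[OF l, of k] by simp
    also have "\<dots> \<le> B * wt k" by (simp add: B_def algebra_simps)
    finally show "\<bar>profile' l k t\<bar> \<le> B * wt k" .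
  qed
  have b: "cmod (modes l c k t) \<le> M k" "cmod (modes' l c k t) \<le> M k" if t: "t \<in> {0..l}" for k t
  proof -
    have t': "l - t \<in> {0..l}" using t by auto
    have "cmod (modes l c k t) \<le> cmod (c (Lower, k)) * \<bar>profile l k (l - t)\<bar> + cmod (c (Upper, k)) * \<bar>profile l k t\<bar>"
      unfolding modes_def by (rule order_trans[OF norm_triangle_ineq]) (simp add: norm_mult)
    also have "\<dots> \<le> cmod (c (Lower, k)) * (B * wt k) + cmod (c (Upper, k)) * (B * wt k)"
      by (intro add_mono mult_left_mono pb t t') auto
    finally show "cmod (modes l c k t) \<le> M k" by (simp add: M_def mult_ac)
    have "cmod (modes' l c k t) \<le> cmod (c (Upper, k)) * \<bar>profile' l k t\<bar> + cmod (c (Lower, k)) * \<bar>profile' l k (l - t)\<bar>"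
      unfolding modes'_def by (rule order_trans[OF norm_triangle_ineq4]) (simp add: norm_mult)
    also have "\<dots> \<le> cmod (c (Upper, k)) * (B * wt k) + cmod (c (Lower, k)) * (B * wt k)"
      by (intro add_mono mult_left_mono pb t t') auto
    finally show "cmod (modes' l c k t) \<le> M k" by (simp add: M_def mult_ac)
  qed
  have rM: "rapid (\<lambda>k. of_real (N k))"
    unfolding rapid_def
  proof
    fix r
    obtain C where C: "\<And>r k. cmod (c (Lower, k)) \<le> C r / wt k ^ r"
      using c rapidE unfolding bdry_rapid_def by metis
    obtain E where E: "\<And>r k. cmod (c (Upper, k)) \<le> E r / wt k ^ r"
      using c rapidE unfolding bdry_rapid_def by metis
    have "cmod (of_real (N k)) \<le> (B * C (r + 3) + B * E (r + 3)) / wt k ^ r" for k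
    proof -
      have "cmod (of_real (N k)) = wt k ^ 2 * (B * wt k * cmod (c (Lower, k)) + B * wt k * cmod (c (Upper, k)))"
        using B1 unfolding norm_of_real N_def M_def by (intro abs_of_nonneg) simp
      also have "\<dots> \<le> wt k ^ 2 * (B * wt k * (C (r + 3) / wt k ^ (r + 3)) + B * wt k * (E (r + 3) / wt k ^ (r + 3)))"
        using B1 C E by (intro mult_left_mono add_mono) auto
      also have "\<dots> = (B * C (r + 3) + B * E (r + 3)) / wt k ^ r"
        by (simp add: power_add power2_eq_square power3_eq_cube field_simps)
      finally show ?thesis .
    qed
    then show "\<exists>C. \<forall>k. cmod (of_real (N k)) \<le> C / wt k ^ r" by blast
  qed
  have M0: "M k \<ge> 0" for k using B1 by (simp add: M_def)
  have MN: "M k \<le> N k" for k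
    using mult_right_mono[OF wt_power_ge_1[of k 2] M0[of k]] by (simp add: N_def)
  have k2: "cmod ((of_int k)\<^sup>2 * z) \<le> N k" if "cmod z \<le> M k" for k z
  proof -
    show ?thesis unfolding N_def norm_mult
      using that by (intro mult_mono norm_of_int_sq_le_wt) auto
  qed
  show "tame l (modes l c) (modes' l c) (\<lambda>k t. (of_int k)\<^sup>2 * modes l c k t)"
    unfolding tame_def
    using d d' rM b[THEN order_trans[OF _ MN]] b[THEN k2] by blast
  show "tame l (modes' l c) (\<lambda>k t. (of_int k)\<^sup>2 * modes l c k t) (\<lambda>k t. (of_int k)\<^sup>2 * modes' l c k t)"
    unfolding tame_def
    using d'' d' rM b[THEN order_trans[OF _ MN]] b[THEN k2] by blast
qed

lemma is_harmonic_extension_mode_series: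
  assumes l: "l > 0" and c: "bdry_rapid c"
  shows "is_harmonic_extension l (bdry_series c) (\<lambda>(\<theta>, t). mode_series (modes l c) \<theta> t)"
proof -
  let ?p = "modes l c" and ?q = "modes' l c"
  let ?r = "\<lambda>k t. (of_int k)\<^sup>2 * ?p k t" and ?r' = "\<lambda>k t. (of_int k)\<^sup>2 * ?q k t"
  let ?d = "\<lambda>p k t. \<i> * of_int k * p k t"
  define u where "u = (\<lambda>(\<theta>, t). mode_series ?p \<theta> t)"
  note T = tame_modes[OF l c]
  have T3: "tame l ?r ?r' (\<lambda>k t. (of_int k)\<^sup>2 * ?r k t)"
    by (rule tame_scale[OF T(1), where s = 2]) (rule norm_of_int_sq_le_wt)
  have Td: "tame l (?d ?p) (?d ?q) (?d ?r)" "tame l (?d ?q) (?d ?r) (?d ?r')"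
    by (rule tame_scale[OF T(1), where s = 1] tame_scale[OF T(2), where s = 1]; simp add: norm_mult wt_def)+
  have u: "u (\<theta>, t) = mode_series ?p \<theta> t" for \<theta> t by (simp add: u_def)
  note P = tame_partials[OF T(1), of u, OF u]
  note Pt = tame_partials[OF Td(1), of "partial_theta u", OF P(3)]
  note Pq = tame_partials[OF T(2), of "partial_t u", OF P(4)]
  have "C2_on (UNIV \<times> {0<..<l}) u"
    unfolding C2_on_def
    by (intro conjI tame_C1[OF T u] tame_C1[OF Td P(3)] tame_C1[OF T(2) T3 P(4)])
  moreover have "laplacian u z = 0" if zS: "z \<in> UNIV \<times> {0<..<l}" for z
  proof -
    obtain \<theta> t where z: "z = (\<theta>, t)" "0 < t" "t < l" using zS by auto
    have "mode_series (?d (?d ?p)) \<theta> t + mode_series ?r \<theta> t = 0"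
    proof -
      have "mode_series (?d (?d ?p)) \<theta> t = - mode_series ?r \<theta> t"
        unfolding mode_series_def fourier_series_def infsum_uminus[symmetric]
      proof (rule infsum_cong)
        fix k
        have "\<i> * of_int k * (\<i> * of_int k * ?p k t) * cis (of_int k * \<theta>)
            = (\<i> * \<i>) * (?r k t * cis (of_int k * \<theta>))"
          by (simp only: power2_eq_square mult_ac)
        then show "\<i> * of_int k * (\<i> * of_int k * ?p k t) * cis (of_int k * \<theta>)
            = - (?r k t * cis (of_int k * \<theta>))" by simp
      qed
      then show ?thesis by simp
    qed
    then show ?thesis using Pt(3)[of t \<theta>] Pq(4)[of t \<theta>] z by (simp add: laplacian_def)
  qed
  moreover have "u (\<theta>, height l i) = bdry_series c i \<theta>" for i \<theta>
    using profile_endpoints(1,2)[OF l] by (cases i) (simp_all add: u_def mode_series_def modes_def bdry_series_def)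
  moreover have "u (\<theta> + 2 * pi, t) = u (\<theta>, t)" for \<theta> t
    by (simp add: u_def mode_series_def fourier_series_periodic)
  moreover have "continuous_on (UNIV \<times> {0..l}) u"
    unfolding u_def by (rule tame_continuous[OF T(1)])
  ultimately have "is_harmonic_extension l (bdry_series c) u"
    unfolding is_harmonic_extension_def by blast
  then show ?thesis by (simp only: u_def)
qed

text \<open>
  Otherwise the first derivative, which vanishes at the maximum, would be positive immediately to the right.
\<close>
lemma second_derivative_at_max:
  fixes g :: "real \<Rightarrow> real"
  assumes S: "open S" "x \<in> S" and g: "\<And>y. y \<in> S \<Longrightarrow> (g has_real_derivative g' y) (at y)"
    and g': "(g' has_real_derivative D) (at x)" and max: "\<And>y. y \<in> S \<Longrightarrow> g y \<le> g x"
  shows "D \<le> 0"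
proof (rule ccontr)
  assume "\<not> D \<le> 0"
  obtain e where e: "e > 0" "ball x e \<subseteq> S" using S open_contains_ball by blast
  have "g' x = 0"
    proof (rule DERIV_local_max[OF g[OF S(2)] e(1)], intro allI impI)
    fix y assume "\<bar>x - y\<bar> < e"
    then have "y \<in> ball x e" by (simp add: dist_real_def)
    then show "g y \<le> g x" using e(2) max by blast
  qed
  moreover obtain d where d: "d > 0" "\<And>h. h > 0 \<Longrightarrow> h < d \<Longrightarrow> g' x < g' (x + h)"
    using DERIV_pos_inc_right[OF g'] \<open>\<not> D \<le> 0\<close> by auto
  define h where "h = min d e / 2"
  have h: "h > 0" "h < d" "h < e" using d(1) e(1) by (auto simp: h_def)
  have inS: "y \<in> S" if "x \<le> y" "y \<le> x + h" for y
  proof -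
    have "y \<in> ball x e" using that h by (simp add: dist_real_def)
    then show ?thesis using e(2) by blast
  qed
  obtain y where y: "x < y" "y < x + h" "g (x + h) - g x = (x + h - x) * g' y"
    using MVT2[of x "x + h" g g'] h(1) g inS by auto
  have "g' y > 0" using d(2)[of "y - x"] y h \<open>g' x = 0\<close> by auto
  then have "h * g' y > 0" using h(1) by simp
  then have "g (x + h) > g x" using y(3) by simp
  then show False using max[OF inS[of "x + h"]] h(1) by simp
qed

lemma C1_on_derivs:
  assumes "C1_on (UNIV \<times> {0<..<l}) u" "0 < t" "t < l"
  shows "((\<lambda>s. u (s, t)) has_vector_derivative partial_theta u (\<theta>, t)) (at \<theta>)"
    and "((\<lambda>s. u (\<theta>, s)) has_vector_derivative partial_t u (\<theta>, t)) (at t)"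
  using assms by (auto simp: C1_on_def partial_theta_def partial_t_def vector_derivative_works)

text \<open>
  The maximum principle.  Adding \<open>e t\<^sup>2\<close> to the real part of a multiple of the difference makes the Laplacian
  positive, so the maximum over the cylinder cannot be interior.  By periodicity a maximum over one
  period is a maximum over all of \<open>\<real> \<times> [0, l]\<close>, so the edges \<open>\<theta> = 0\<close> and \<open>\<theta> = 2\<pi>\<close> need no separate treatment.
\<close>
lemma harmonic_difference_le:
  assumes l: "l > 0" and u: "is_harmonic_extension l f u" and v: "is_harmonic_extension l f v"
    and t0: "t0 \<in> {0..l}" and e: "e > 0"
  shows "Re (z * (u (\<theta>0, t0) - v (\<theta>0, t0))) \<le> e * l\<^sup>2"
proof -
  define w where "w = (\<lambda>(\<theta>, t). Re (z * (u (\<theta>, t) - v (\<theta>, t))) + e * t\<^sup>2)"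
  have per: "w (\<theta> + 2 * pi, t) = w (\<theta>, t)" if "t \<in> {0..l}" for \<theta> t
    using u v that by (simp add: w_def is_harmonic_extension_def)
  have wbd: "w (\<theta>, t) \<le> e * l\<^sup>2" if "t = 0 \<or> t = l" for \<theta> t
  proof -
    have "\<forall>i. u (\<theta>, height l i) = v (\<theta>, height l i)" using u v by (simp add: is_harmonic_extension_def)
    from this[rule_format, of Lower] this[rule_format, of Upper] have "u (\<theta>, t) = v (\<theta>, t)" using that by auto
    then show ?thesis using that e l by (auto simp: w_def)
  qed
  have "continuous_on (UNIV \<times> {0..l}) w"
  proof -
    have "continuous_on (UNIV \<times> {0..l}) u" "continuous_on (UNIV \<times> {0..l}) v"
      using u v by (simp_all add: is_harmonic_extension_def)
    then have "continuous_on (UNIV \<times> {0..l}) (\<lambda>x. Re (z * (u x - v x)) + e * (snd x)\<^sup>2)"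
      by (intro continuous_intros)
    then show ?thesis by (simp add: w_def case_prod_unfold)
  qed
  then have "continuous_on ({0..2 * pi} \<times> {0..l}) w" by (rule continuous_on_subset) auto
  moreover have "compact ({0..2 * pi} \<times> {0..l})" by (intro compact_Times compact_Icc)
  moreover have "{0..2 * pi} \<times> {0..l} \<noteq> {}" using l by auto
  ultimately obtain m where m: "m \<in> {0..2 * pi} \<times> {0..l}" "\<And>y. y \<in> {0..2 * pi} \<times> {0..l} \<Longrightarrow> w y \<le> w m"
    using continuous_attains_sup[of "{0..2 * pi} \<times> {0..l}" w] by auto
  obtain \<theta>m tm where mm: "m = (\<theta>m, tm)" by (cases m)
  have max: "w (\<theta>, t) \<le> w (\<theta>m, tm)" if t: "t \<in> {0..l}" for \<theta> t
  proof -
    define n where "n = \<lfloor>\<theta> / (2 * pi)\<rfloor>"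
    define \<theta>' where "\<theta>' = \<theta> - 2 * pi * of_int n"
    have "of_int n \<le> \<theta> / (2 * pi)" "\<theta> / (2 * pi) < of_int n + 1" by (auto simp: n_def)
    then have "0 \<le> \<theta>'" "\<theta>' \<le> 2 * pi" by (auto simp: \<theta>'_def field_simps)
    then have "w (\<theta>', t) \<le> w m" using t by (intro m(2)) auto
    moreover have "w (\<theta>' + 2 * pi * of_int n, t) = w (\<theta>', t)"
      using periodic_int[of "\<lambda>\<theta>. w (\<theta>, t)"] per[OF t] by simp
    ultimately show ?thesis by (simp add: mm \<theta>'_def)
  qed
  have "tm = 0 \<or> tm = l"
  proof (rule ccontr)
    assume "\<not> (tm = 0 \<or> tm = l)"
    then have tm: "0 < tm" "tm < l" using m(1) mm by auto
    have C: "C2_on (UNIV \<times> {0<..<l}) u" "C2_on (UNIV \<times> {0<..<l}) v"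
      and lap: "laplacian u (\<theta>m, tm) = 0" "laplacian v (\<theta>m, tm) = 0"
      using u v tm by (auto simp: is_harmonic_extension_def)
    note D1 = C1_on_derivs[of l u] C1_on_derivs[of l v]
    note Dt = C1_on_derivs[of l "partial_theta u"] C1_on_derivs[of l "partial_theta v"]
    note Dq = C1_on_derivs[of l "partial_t u"] C1_on_derivs[of l "partial_t v"]
    have re: "((\<lambda>s. Re (z * (f1 s - f2 s))) has_real_derivative Re (z * (d1 - d2))) (at x)"
      if "(f1 has_vector_derivative d1) (at x)" "(f2 has_vector_derivative d2) (at x)" for f1 f2 :: "real \<Rightarrow> complex" and d1 d2 x
      unfolding has_real_derivative_iff_has_vector_derivative
      by (intro bounded_linear.has_vector_derivative[OF bounded_linear_Re] has_vector_derivative_mult_right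
          has_vector_derivative_diff that)
    have th: "Re (z * (partial_theta (partial_theta u) (\<theta>m, tm) - partial_theta (partial_theta v) (\<theta>m, tm))) \<le> 0"
    proof (rule second_derivative_at_max[where S = UNIV and x = \<theta>m and g = "\<lambda>s. w (s, tm)"
          and g' = "\<lambda>s. Re (z * (partial_theta u (s, tm) - partial_theta v (s, tm)))"])
      show "((\<lambda>s. w (s, tm)) has_real_derivative Re (z * (partial_theta u (y, tm) - partial_theta v (y, tm)))) (at y)" for y
        unfolding w_def prod.case
        using DERIV_add[OF re[OF D1(1)[of tm y] D1(3)[of tm y]] DERIV_const[of "e * tm\<^sup>2"]] C tm by (simp add: C2_on_def)
      show "((\<lambda>s. Re (z * (partial_theta u (s, tm) - partial_theta v (s, tm)))) has_real_derivative
          Re (z * (partial_theta (partial_theta u) (\<theta>m, tm) - partial_theta (partial_theta v) (\<theta>m, tm)))) (at \<theta>m)"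
        by (rule re[OF Dt(1) Dt(3)]) (use C tm in \<open>auto simp: C2_on_def\<close>)
    qed (use max tm in auto)
    have tt: "Re (z * (partial_t (partial_t u) (\<theta>m, tm) - partial_t (partial_t v) (\<theta>m, tm))) + 2 * e \<le> 0"
    proof (rule second_derivative_at_max[where S = "{0<..<l}" and x = tm and g = "\<lambda>s. w (\<theta>m, s)"
          and g' = "\<lambda>s. Re (z * (partial_t u (\<theta>m, s) - partial_t v (\<theta>m, s))) + 2 * e * s"])
      show "((\<lambda>s. w (\<theta>m, s)) has_real_derivative Re (z * (partial_t u (\<theta>m, y) - partial_t v (\<theta>m, y))) + 2 * e * y) (at y)"
        if "y \<in> {0<..<l}" for y
        unfolding w_def prod.case
        by (rule DERIV_add[OF re[OF D1(2) D1(4)]]) (use C that in \<open>auto simp: C2_on_def intro!: derivative_eq_intros\<close>)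
      show "((\<lambda>s. Re (z * (partial_t u (\<theta>m, s) - partial_t v (\<theta>m, s))) + 2 * e * s) has_real_derivative
          Re (z * (partial_t (partial_t u) (\<theta>m, tm) - partial_t (partial_t v) (\<theta>m, tm))) + 2 * e) (at tm)"
        by (rule DERIV_add[OF re[OF Dq(2) Dq(4)]]) (use C tm in \<open>auto simp: C2_on_def intro!: derivative_eq_intros\<close>)
    qed (use max tm in auto)
    have "Re (z * (laplacian u (\<theta>m, tm) - laplacian v (\<theta>m, tm))) + 2 * e \<le> 0"
      using th tt by (simp add: laplacian_def algebra_simps)
    then show False using lap e by simp
  qed
  then have "w (\<theta>0, t0) \<le> e * l\<^sup>2" using max[OF t0, of \<theta>0] wbd[of tm \<theta>m] by linarith
  moreover have "e * t0\<^sup>2 \<ge> 0" using e by simp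
  ultimately show ?thesis unfolding w_def prod.case by linarith
qed

lemma harmonic_extension_unique:
  assumes l: "l > 0" and u: "is_harmonic_extension l f u" and v: "is_harmonic_extension l f v"
    and t: "t \<in> {0..l}"
  shows "u (\<theta>, t) = v (\<theta>, t)"
proof -
  define d where "d = u (\<theta>, t) - v (\<theta>, t)"
  have "Re (z * d) \<le> 0" for z
  proof (rule field_le_epsilon)
    fix e :: real assume "e > 0"
    then show "Re (z * d) \<le> 0 + e"
      using harmonic_difference_le[OF l u v t, of "e / l\<^sup>2" z \<theta>] l by (simp add: d_def)
  qed
  from this[of "cnj d"] have "Re (cnj d * d) \<le> 0" .
  moreover have "cnj d * d = of_real ((cmod d)\<^sup>2)" by (simp add: complex_norm_square mult.commute del: of_real_power)
  ultimately have "d = 0" by simp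
  then show ?thesis by (simp add: d_def)
qed

theorem DN_bdry_series:
  assumes l: "l > 0" and c: "bdry_rapid c"
  shows "DN l (bdry_series c) = bdry_series (DN_symbol l c)"
proof (intro ext)
  fix i \<theta>
  define h where "h = harmonic_extension l (bdry_series c)"
  have ext: "is_harmonic_extension l (bdry_series c) h"
    unfolding h_def harmonic_extension_def by (rule someI[of "is_harmonic_extension l (bdry_series c)", OF is_harmonic_extension_mode_series[OF l c]])
  have eq: "h (\<theta>, t) = mode_series (modes l c) \<theta> t" if "t \<in> {0..l}" for t
    using harmonic_extension_unique[OF l ext is_harmonic_extension_mode_series[OF l c] that] by simp
  define T where "T = height l i"
  have T: "T \<in> {0..l}" using l by (cases i) (auto simp: T_def)
  have "((\<lambda>t. h (\<theta>, t)) has_vector_derivative mode_series (modes' l c) \<theta> T) (at T within {0..l})"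
    by (rule has_vector_derivative_transform[OF T _ tame_t_derivative[OF tame_modes(1)[OF l c] T]]) (simp add: eq)
  then have "vector_derivative (\<lambda>t. h (\<theta>, t)) (at T within {0..l}) = mode_series (modes' l c) \<theta> T"
    using vector_derivative_within_cbox[of 0 l T] l T by simp
  then have "DN l (bdry_series c) i \<theta> = normal_sign i * mode_series (modes' l c) \<theta> T"
    by (simp add: DN_def h_def T_def)
  also have "\<dots> = bdry_series (DN_symbol l c) i \<theta>"
    unfolding mode_series_def bdry_series_def fourier_series_def infsum_cmult_right'[symmetric]
    by (cases i) (simp_all add: T_def modes'_def DN_symbol_def profile_endpoints[OF l] algebra_simps)
  finally show "DN l (bdry_series c) i \<theta> = bdry_series (DN_symbol l c) i \<theta>" .
qed

lemma D_op_bdry_series: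
  assumes c: "bdry_rapid c"
  shows "D_op (bdry_series c) = bdry_series (\<lambda>(i, k). of_int k * c (i, k))"
proof (intro ext)
  fix i \<theta>
  have "vector_derivative (bdry_series c i) (at \<theta>) = fourier_series (\<lambda>k. \<i> * of_int k * c (i, k)) \<theta>"
    using c unfolding bdry_series_def bdry_rapid_def
    by (intro vector_derivative_at fourier_series_has_vector_derivative) auto
  then show "D_op (bdry_series c) i \<theta> = bdry_series (\<lambda>(i, k). of_int k * c (i, k)) i \<theta>"
    unfolding D_op_def bdry_series_def fourier_series_def by (simp add: infsum_cmult_right'[symmetric] mult.assoc)
qed

section \<open>Boundary operators as infinite matrices\<close>

type_synonym symbol = "int \<Rightarrow> bdry \<Rightarrow> bdry \<Rightarrow> complex"

text \<open>
  Symbols are \<open>2 \<times> 2\<close> matrices depending on the frequency.  They cover \<open>\<Lambda>\<close>, \<open>D\<close>, \<open>JD\<close> and the identity.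
\<close>
definition symbol_op :: "symbol \<Rightarrow> (idx \<Rightarrow> complex) \<Rightarrow> idx \<Rightarrow> complex" where
  "symbol_op m c = (\<lambda>(i, k). \<Sum>j\<in>UNIV. m k i j * c (j, k))"

definition bounded_symbol :: "symbol \<Rightarrow> bool" where
  "bounded_symbol m \<longleftrightarrow> (\<exists>B s. \<forall>k i j. cmod (m k i j) \<le> B * wt k ^ s)"

definition DN_sym :: "real \<Rightarrow> symbol" where
  "DN_sym l k i j = (if i = j then of_real ((root_diag l k)\<^sup>2 + (root_off l k)\<^sup>2)
     else - of_real (2 * root_diag l k * root_off l k))"

definition D_sym :: symbol where
  "D_sym k i j = (if i = j then of_int k else 0)"

definition id_sym :: symbol where
  "id_sym k i j = (if i = j then 1 else 0)"

text \<open>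
  The matrix of a Fourier multiplier followed by multiplication by the function with Fourier coefficients \<open>A\<close>.
\<close>
definition toeplitz :: "(bdry \<Rightarrow> int \<Rightarrow> complex) \<Rightarrow> symbol \<Rightarrow> idx mat" where
  "toeplitz A m p q = A (fst p) (snd p - snd q) * m (snd q) (fst p) (fst q)"

lemma sum_bdry: "(\<Sum>i\<in>UNIV. f i) = f Lower + (f Upper :: 'a::comm_monoid_add)"
  by (simp add: UNIV_bdry)

lemma sum_bdry_split: "(\<Sum>j\<in>UNIV. f j) = f i + (f (flip i) :: 'a::comm_monoid_add)"
  by (cases i) (simp_all add: sum_bdry add.commute)

lemma flip_neq [simp]: "flip i \<noteq> i" "i \<noteq> flip i" and flip_flip [simp]: "flip (flip i) = i"
  by (cases i; simp)+

lemma DN_symbol_eq: "DN_symbol l = symbol_op (DN_sym l)"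
proof (intro ext)
  fix c p
  show "DN_symbol l c p = symbol_op (DN_sym l) c p"
    by (cases p) (simp add: DN_symbol_def symbol_op_def sum_bdry_split[of _ "fst p"] DN_sym_def)
qed

lemma D_symbol_eq: "symbol_op D_sym c = (\<lambda>(i, k). of_int k * c (i, k))"
proof (rule ext)
  fix p
  show "symbol_op D_sym c p = (\<lambda>(i, k). of_int k * c (i, k)) p"
    by (cases p; cases "fst p") (simp_all add: symbol_op_def D_sym_def sum_bdry)
qed

lemma bounded_symbolI: "(\<And>k i j. cmod (m k i j) \<le> B * wt k ^ s) \<Longrightarrow> bounded_symbol m"
  unfolding bounded_symbol_def by blast

lemma bounded_D_sym: "bounded_symbol D_sym"
  by (rule bounded_symbolI[where B = 1 and s = 1]) (simp add: D_sym_def wt_def)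

lemma bounded_id_sym: "bounded_symbol id_sym"
  by (rule bounded_symbolI[where B = 1 and s = 0]) (simp add: id_sym_def)

lemma bounded_DN_sym:
  assumes "l > 0" shows "bounded_symbol (DN_sym l)"
proof (rule bounded_symbolI[where s = 1])
  fix k i j
  have p: "0 < root_diag l k" "0 < root_off l k" "root_off l k \<le> root_diag l k"
    using assms root_diag_pos root_off_pos root_off_le by auto
  have "(root_off l k)\<^sup>2 \<le> (root_diag l k)\<^sup>2" "root_diag l k * root_off l k \<le> (root_diag l k)\<^sup>2"
    using p by (auto simp: power2_eq_square intro!: mult_mono)
  then have "cmod (DN_sym l k i j) \<le> 2 * (root_diag l k)\<^sup>2"
    using p unfolding DN_sym_def by (auto simp: norm_mult simp flip: of_real_add of_real_power)
  also have "\<dots> \<le> 2 * ((1 / (2 * l) + 1 / (1 - exp (- (2 * l)))) * wt k)"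
    using root_diag_sq_le[OF assms, of k] by simp
  finally show "cmod (DN_sym l k i j) \<le> 2 * (1 / (2 * l) + 1 / (1 - exp (- (2 * l)))) * wt k ^ 1"
    by (simp only: power_one_right mult.assoc)
qed

lemma bdry_rapid_symbol_op:
  assumes m: "bounded_symbol m" and c: "bdry_rapid c"
  shows "bdry_rapid (symbol_op m c)"
  unfolding bdry_rapid_def rapid_def
proof (intro allI)
  fix i r
  obtain B s where B: "\<And>k i j. cmod (m k i j) \<le> B * wt k ^ s"
    using m unfolding bounded_symbol_def by blast
  have "\<exists>C. \<forall>k. cmod (m k i j * c (j, k)) \<le> C / wt k ^ r" for j
    using rapid_multiplier[of "\<lambda>k. c (j, k)" "\<lambda>k. m k i j", OF _ B] c
    unfolding bdry_rapid_def rapid_def by blast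
  then obtain C where C: "\<And>j k. cmod (m k i j * c (j, k)) \<le> C j / wt k ^ r" by metis
  have "cmod (symbol_op m c (i, k)) \<le> (\<Sum>j\<in>UNIV. C j) / wt k ^ r" for k
    unfolding symbol_op_def sum_divide_distrib prod.case by (rule order_trans[OF norm_sum]) (intro sum_mono C)
  then show "\<exists>C. \<forall>k. cmod (symbol_op m c (i, k)) \<le> C / wt k ^ r" by blast
qed

lemma wt_exp_bounded:
  assumes l: "l > 0"
  shows "\<exists>C. \<forall>k. wt k ^ r * exp (- (\<bar>real_of_int k\<bar> * l)) \<le> C"
proof (cases "r = 0")
  case True
  then show ?thesis using l by (intro exI[of _ 1]) simp
next
  case False
  \<comment> \<open>so that \<open>b (1 + x) \<le> 1 + l x / r\<close> for \<open>x \<ge> 0\<close>, and \<open>(1 + l x / r)\<^sup>r \<le> exp (l x)\<close>\<close>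
  define b where "b = min 1 (l / r)"
  have b: "b > 0" "b \<le> 1" "b \<le> l / r" using l False by (auto simp: b_def)
  have "wt k ^ r * exp (- (\<bar>real_of_int k\<bar> * l)) \<le> 1 / b ^ r" for k
  proof -
    have "b * wt k \<le> 1 + l / r * \<bar>real_of_int k\<bar>"
      using b(2) mult_right_mono[OF b(3), of "\<bar>real_of_int k\<bar>"] by (simp add: wt_def distrib_left)
    then have "(b * wt k) ^ r \<le> (1 + \<bar>real_of_int k\<bar> * l / r) ^ r"
      using b by (intro power_mono) (auto simp: mult_ac)
    also have "\<dots> \<le> exp (\<bar>real_of_int k\<bar> * l)"
    proof (rule exp_ge_one_plus_x_over_n_power_n)
      have "0 \<le> \<bar>real_of_int k\<bar> * l" using l by simp
      then show "- real r \<le> \<bar>real_of_int k\<bar> * l" by linarith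
    qed (use False in simp)
    finally have "b ^ r * wt k ^ r \<le> exp (\<bar>real_of_int k\<bar> * l)" by (simp add: power_mult_distrib)
    then show ?thesis using b by (simp add: exp_minus field_simps)
  qed
  then show ?thesis by blast
qed

lemma root_diff:
  assumes "l > 0" shows "(root_diag l k)\<^sup>2 - (root_off l k)\<^sup>2 = \<bar>real_of_int k\<bar>"
proof -
  have "(root_off l k)\<^sup>2 = exp (- (2 * \<bar>real_of_int k\<bar> * l)) * (root_diag l k)\<^sup>2"
    by (simp add: root_off_def power_mult_distrib exp_double[symmetric] mult_ac)
  then have "(root_diag l k)\<^sup>2 - (root_off l k)\<^sup>2 = (1 - exp (- (2 * \<bar>real_of_int k\<bar> * l))) * (root_diag l k)\<^sup>2"
    by (simp add: algebra_simps)
  also have "\<dots> = \<bar>real_of_int k\<bar>"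
    using assms by (cases "k = 0") (simp_all add: root_diag_sq[OF assms])
  finally show ?thesis .
qed

text \<open>
  The two operators differ by \<open>2\<beta>\<^sup>2\<close> on the diagonal and by \<open>2\<alpha>\<beta>\<close> off it, and \<open>\<beta> = exp (- |k| l) \<alpha>\<close>.
\<close>
lemma DN_sym_minus_abs_D:
  assumes l: "l > 0"
  shows "cmod (DN_sym l k i j - D_sym k i j * of_real (if k \<ge> 0 then 1 else - 1))
    \<le> 2 * exp (- (\<bar>real_of_int k\<bar> * l)) * (root_diag l k)\<^sup>2"
proof (cases "i = j")
  case True
  have "complex_of_int k * of_real (if k \<ge> 0 then 1 else - 1) = of_real \<bar>real_of_int k\<bar>" by simp
  then have "DN_sym l k i j - D_sym k i j * of_real (if k \<ge> 0 then 1 else - 1)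
      = of_real ((root_diag l k)\<^sup>2 + (root_off l k)\<^sup>2 - \<bar>real_of_int k\<bar>)"
    using True by (simp add: DN_sym_def D_sym_def split del: if_split)
  also have "(root_diag l k)\<^sup>2 + (root_off l k)\<^sup>2 - \<bar>real_of_int k\<bar> = 2 * root_off l k * root_off l k"
    unfolding root_diff[OF l, symmetric] by (simp add: power2_eq_square)
  finally have "cmod (DN_sym l k i j - D_sym k i j * of_real (if k \<ge> 0 then 1 else - 1)) = 2 * root_off l k * root_off l k"
    using root_off_pos[OF l, of k] by (simp add: norm_mult)
  also have "\<dots> \<le> 2 * root_off l k * root_diag l k"
    using root_off_le[OF l, of k] root_off_pos[OF l, of k] by (intro mult_left_mono) auto
  also have "\<dots> = 2 * exp (- (\<bar>real_of_int k\<bar> * l)) * (root_diag l k)\<^sup>2"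
    by (simp add: root_off_def power2_eq_square)
  finally show ?thesis .
next
  case False
  then show ?thesis using root_off_pos[OF l, of k] root_diag_pos[OF l, of k]
    by (simp add: DN_sym_def D_sym_def norm_mult) (simp add: root_off_def power2_eq_square)
qed

lemma op_trace_cong:
  assumes "\<And>p. L2_inner (T (fourier_basis p)) (fourier_basis p) = t p"
  shows "op_trace T = (\<Sum>\<^sub>\<infinity>p. t p)"
  unfolding op_trace_def assms ..

lemma L2_inner_fourier_basis:
  fixes c :: "idx \<Rightarrow> complex"
  assumes "bdry_rapid c"
  shows "L2_inner (bdry_series c) (fourier_basis p) = sqrt (2 * pi) * c p"
proof -
  obtain i k where p: "p = (i, k)" by (cases p)
  have "fourier_coeff (fourier_series (\<lambda>k. c (i, k))) k = c (i, k)"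
    using assms by (intro fourier_coeff_fourier_series) (simp add: bdry_rapid_def)
  then have I: "integral {0..2 * pi} (\<lambda>\<theta>. bdry_series c i \<theta> * cis (- of_int k * \<theta>)) = 2 * pi * c (i, k)"
    by (simp add: fourier_coeff_def bdry_series_def field_simps)
  have s: "complex_of_real (sqrt (2 * pi)) * of_real (sqrt (2 * pi)) = 2 * pi"
    by (simp flip: of_real_mult)
  have "L2_inner (bdry_series c) (fourier_basis p)
      = (\<Sum>j\<in>UNIV. integral {0..2 * pi} (\<lambda>\<theta>. bdry_series c j \<theta> * cnj (fourier_basis p j \<theta>)))"
    by (simp add: L2_inner_def UNIV_bdry)
  also have "\<dots> = integral {0..2 * pi} (\<lambda>\<theta>. bdry_series c i \<theta> * cnj (fourier_basis p i \<theta>))"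
    unfolding sum_bdry_split[of _ i] by (simp add: p fourier_basis_def)
  also have "\<dots> = integral {0..2 * pi} (\<lambda>\<theta>. 1 / sqrt (2 * pi) * (bdry_series c i \<theta> * cis (- of_int k * \<theta>)))"
    by (intro integral_cong) (simp add: p fourier_basis_def cis_cnj)
  also have "\<dots> = 1 / sqrt (2 * pi) * (2 * pi * c (i, k))"
    by (simp only: integral_mult_right I)
  also have "\<dots> = sqrt (2 * pi) * c p"
    unfolding p s[symmetric] by simp
  finally show ?thesis .
qed

lemma fourier_basis_eq: "fourier_basis p = bdry_series (\<lambda>q. idmat q p / sqrt (2 * pi))"
proof (intro ext)
  fix j \<theta>
  obtain i k where p: "p = (i, k)" by (cases p)
  have "fourier_series (\<lambda>n. idmat (j, n) p / sqrt (2 * pi)) \<theta>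
      = (\<Sum>n\<in>{k}. idmat (j, n) p / sqrt (2 * pi) * cis (of_int n * \<theta>))"
    unfolding fourier_series_def
    by (rule infsumI, rule has_sum_finite_neutralI[of "{k}"]) (auto simp: idmat_def p)
  then show "fourier_basis p j \<theta> = bdry_series (\<lambda>q. idmat q p / sqrt (2 * pi)) j \<theta>"
    by (simp add: fourier_basis_def p idmat_def bdry_series_def)
qed

lemma bdry_rapid_column:
  assumes "finite_order X"
  shows "bdry_rapid (\<lambda>q. X UNIV q p / b)"
  unfolding bdry_rapid_def rapid_def
proof (intro allI)
  fix i r
  obtain s C where C: "\<And>r. C r \<ge> 0"
    "\<And>r I p q. cmod (X I p q) \<le> C r * wt (snd p) ^ s / wt (snd p - snd q) ^ r"
    using finite_orderE[OF assms] by metis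
  define n where "n = snd p"
  have "cmod (X UNIV (i, k) p / b) \<le> C (r + s) * wt n ^ (r + s) / cmod b / wt k ^ r" for k
  proof -
    have "wt k \<le> wt n * wt (k - n)" by (rule wt_diff_le(1))
    then have "wt k ^ (r + s) \<le> wt n ^ (r + s) * wt (k - n) ^ (r + s)"
      unfolding power_mult_distrib[symmetric] by (intro power_mono) auto
    then have *: "wt k ^ s / wt (k - n) ^ (r + s) \<le> wt n ^ (r + s) / wt k ^ r"
      by (simp add: divide_simps power_add mult_ac)
    have "cmod (X UNIV (i, k) p) \<le> C (r + s) * (wt k ^ s / wt (k - n) ^ (r + s))"
      using C(2)[of UNIV "(i, k)" p "r + s"] by (simp add: n_def)
    also have "\<dots> \<le> C (r + s) * (wt n ^ (r + s) / wt k ^ r)"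
      by (intro mult_left_mono * C(1))
    finally have "cmod (X UNIV (i, k) p) / cmod b \<le> C (r + s) * (wt n ^ (r + s) / wt k ^ r) / cmod b"
      by (rule divide_right_mono) simp
    then show ?thesis by (simp add: norm_divide mult_ac)
  qed
  then show "\<exists>C. \<forall>k. cmod (X UNIV (i, k) p / b) \<le> C / wt k ^ r" by blast
qed

locale boundary_weight =
  fixes l :: real and A :: "bdry \<Rightarrow> int \<Rightarrow> complex"
  assumes l: "l > 0" and rapid_A: "\<And>i. rapid (A i)" and A_minus: "\<And>i k. A i (- k) = cnj (A i k)"
begin

lemma A_bound:
  obtains C where "\<And>r. C r \<ge> 0" "\<And>r i k. cmod (A i k) \<le> C r / wt k ^ r"
proof -
  obtain C0 where C0: "\<And>r. C0 r \<ge> 0" "\<And>r k. cmod (A Lower k) \<le> C0 r / wt k ^ r"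
    using rapidE[OF rapid_A[of Lower]] by metis
  obtain C1 where C1: "\<And>r. C1 r \<ge> 0" "\<And>r k. cmod (A Upper k) \<le> C1 r / wt k ^ r"
    using rapidE[OF rapid_A[of Upper]] by metis
  show thesis
  proof (rule that[of "\<lambda>r. C0 r + C1 r"])
    show "0 \<le> C0 r + C1 r" for r using C0(1) C1(1) by simp
    show "cmod (A i k) \<le> (C0 r + C1 r) / wt k ^ r" for r i k
      using C0(1)[of r] C1(1)[of r] C0(2)[where r = r and k = k] C1(2)[where r = r and k = k]
      by (cases i) (auto simp: add_divide_distrib intro: order_trans add_increasing add_increasing2)
  qed
qed

lemma finite_order_toeplitz:
  assumes "bounded_symbol m" shows "finite_order (\<lambda>_. toeplitz A m)"
proof -
  obtain B s where B: "\<And>k i j. cmod (m k i j) \<le> B * wt k ^ s"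
    using assms unfolding bounded_symbol_def by blast
  have B0: "B \<ge> 0" using order_trans[OF norm_ge_zero B[of 0 Lower Lower]] by (simp add: wt_def)
  obtain C where C: "\<And>r. C r \<ge> 0" "\<And>r i k. cmod (A i k) \<le> C r / wt k ^ r"
    using A_bound by metis
  show ?thesis
  proof (rule finite_order_constI[where s = s])
    fix r
    have "cmod (toeplitz A m p q) \<le> C (r + s) * B * wt (snd p) ^ s / wt (snd p - snd q) ^ r" for p q
    proof -
      define d P n where "d = wt (snd p - snd q)" "P = wt (snd p)" "n = wt (snd q)"
      have pos: "d \<ge> 1" "P \<ge> 1" "n \<ge> 1" by (simp_all add: d_P_n_def)
      have "n \<le> P * d" unfolding d_P_n_def by (rule wt_diff_le(2))
      then have n: "n ^ s \<le> P ^ s * d ^ s" using pos by (simp add: power_mono flip: power_mult_distrib)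
      have "cmod (toeplitz A m p q) \<le> (C (r + s) / d ^ (r + s)) * (B * n ^ s)"
        unfolding toeplitz_def norm_mult d_P_n_def by (rule mult_mono[OF C(2) B]) (simp_all add: C(1))
      also have "\<dots> \<le> (C (r + s) / d ^ (r + s)) * (B * (P ^ s * d ^ s))"
        using n B0 C(1) pos by (intro mult_left_mono) auto
      also have "\<dots> = C (r + s) * B * P ^ s / d ^ r"
        using pos by (simp add: power_add field_simps)
      finally show ?thesis by (simp add: d_P_n_def)
    qed
    then show "\<exists>C. \<forall>p q. cmod (toeplitz A m p q) \<le> C * wt (snd p) ^ s / wt (snd p - snd q) ^ r" by blast
  qed
qed

definition aDN :: "idx mat" where "aDN = toeplitz A (DN_sym l)"
definition aD :: "idx mat" where "aD = toeplitz A D_sym"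

lemma finite_order_aDN: "finite_order (\<lambda>_. aDN)" and finite_order_aD: "finite_order (\<lambda>_. aD)"
  unfolding aDN_def aD_def
  by (intro finite_order_toeplitz bounded_DN_sym bounded_D_sym l)+

lemma smoothing_aDN_minus_abs_aD:
  "smoothing (\<lambda>_ p q. aDN p q - aD p q * of_real (sgn_idx q))"
proof (rule smoothing_constI)
  fix r
  obtain C where C: "\<And>r. C r \<ge> 0" "\<And>r i k. cmod (A i k) \<le> C r / wt k ^ r"
    using A_bound by metis
  define B where "B = 1 / (2 * l) + 1 / (1 - exp (- (2 * l)))"
  have B0: "B \<ge> 0" using l by (simp add: B_def)
  obtain E where E: "\<And>k. wt k ^ (2 * r + 1) * exp (- (\<bar>real_of_int k\<bar> * l)) \<le> E"
    using wt_exp_bounded[OF l] by blast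
  have E0: "E \<ge> 0" by (rule order_trans[OF _ E[of 0]]) simp
  have "cmod (aDN p q - aD p q * of_real (sgn_idx q)) \<le> C r * (2 * B * E) / (wt (snd p) * wt (snd q)) ^ r" for p q
  proof -
    obtain i k j n where pq: "p = (i, k)" "q = (j, n)" by (metis surj_pair)
    define S where "S = DN_sym l n i j - D_sym n i j * of_real (if n \<ge> 0 then 1 else - 1)"
    have "aDN p q - aD p q * of_real (sgn_idx q) = A i (k - n) * S"
      by (simp add: aDN_def aD_def toeplitz_def pq sgn_idx_def S_def algebra_simps)
    then have 1: "cmod (aDN p q - aD p q * of_real (sgn_idx q)) = cmod (A i (k - n)) * cmod S"
      by (simp add: norm_mult)
    have "cmod S \<le> 2 * exp (- (\<bar>real_of_int n\<bar> * l)) * (root_diag l n)\<^sup>2"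
      unfolding S_def by (rule DN_sym_minus_abs_D[OF l])
    also have "\<dots> \<le> 2 * exp (- (\<bar>real_of_int n\<bar> * l)) * (B * wt n)"
      unfolding B_def by (intro mult_left_mono root_diag_sq_le l) auto
    also have "\<dots> = 2 * B * (wt n ^ (2 * r + 1) * exp (- (\<bar>real_of_int n\<bar> * l))) / wt n ^ (2 * r)"
      by simp
    also have "\<dots> \<le> 2 * B * E / wt n ^ (2 * r)"
      using B0 E by (intro divide_right_mono mult_left_mono) auto
    finally have 2: "cmod S \<le> 2 * B * E / wt n ^ (2 * r)" .
    have "cmod (A i (k - n)) * cmod S \<le> (C r / wt (k - n) ^ r) * (2 * B * E / wt n ^ (2 * r))"
      by (rule mult_mono[OF C(2) 2]) (simp_all add: C(1))
    also have "\<dots> = C r * (2 * B * E) / (wt (k - n) ^ r * wt n ^ (2 * r))" by simp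
    also have "\<dots> \<le> C r * (2 * B * E) / (wt k * wt n) ^ r"
    proof (rule divide_left_mono)
      have "wt k * wt n \<le> wt (k - n) * wt n * wt n"
        using wt_diff_le(1)[of k n] by (simp add: mult_ac)
      then have "(wt k * wt n) ^ r \<le> (wt (k - n) * wt n * wt n) ^ r" by (intro power_mono) auto
      then show "(wt k * wt n) ^ r \<le> wt (k - n) ^ r * wt n ^ (2 * r)"
        unfolding power_mult_distrib mult_2 power_add by (simp only: mult.assoc)
    qed (use C(1) B0 E0 in auto)
    finally show ?thesis using 1 by (simp add: pq)
  qed
  then show "\<exists>C. \<forall>p q. cmod (aDN p q - aD p q * of_real (sgn_idx q)) \<le> C / (wt (snd p) * wt (snd q)) ^ r"
    by blast
qed

lemma convolution_symbol_op:
  assumes m: "bounded_symbol m" and c: "bdry_rapid c"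
  shows "convolution (A i) (\<lambda>k. symbol_op m c (i, k)) k = (\<Sum>\<^sub>\<infinity>q. toeplitz A m (i, k) q * c q)"
proof -
  obtain B s where B: "\<And>k i j. cmod (m k i j) \<le> B * wt k ^ s"
    using m unfolding bounded_symbol_def by blast
  obtain C where C: "\<And>r. C r \<ge> 0" "\<And>r i k. cmod (A i k) \<le> C r / wt k ^ r"
    using A_bound by metis
  have s: "(\<lambda>n. toeplitz A m (i, k) (j, n) * c (j, n)) summable_on UNIV" for j
  proof (rule abs_summable_summable, rule Infinite_Sum.abs_summable_on_comparison_test')
    show "(\<lambda>n. C 0 * B * cmod (c (j, n)) * wt n ^ s) summable_on UNIV"
      using c by (intro rapid_summable) (simp add: bdry_rapid_def)
    fix n
    have "cmod (A i (k - n)) * cmod (m n i j) \<le> C 0 * (B * wt n ^ s)"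
      using C(2)[of i "k - n" 0] by (intro mult_mono B) (auto simp: C(1))
    then have "cmod (A i (k - n)) * cmod (m n i j) * cmod (c (j, n)) \<le> C 0 * (B * wt n ^ s) * cmod (c (j, n))"
      by (rule mult_right_mono) simp
    then show "norm (toeplitz A m (i, k) (j, n) * c (j, n)) \<le> C 0 * B * cmod (c (j, n)) * wt n ^ s"
      by (simp add: toeplitz_def norm_mult mult_ac)
  qed
  have "(\<Sum>\<^sub>\<infinity>q. toeplitz A m (i, k) q * c q) = (\<Sum>j\<in>UNIV. \<Sum>\<^sub>\<infinity>n. toeplitz A m (i, k) (j, n) * c (j, n))"
    by (rule infsum_idx[OF s])
  also have "\<dots> = (\<Sum>\<^sub>\<infinity>n. \<Sum>j\<in>UNIV. toeplitz A m (i, k) (j, n) * c (j, n))"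
    unfolding sum_bdry by (rule infsum_add[OF s s, symmetric])
  finally show ?thesis
    by (simp add: convolution_def symbol_op_def toeplitz_def sum_distrib_left mult_ac)
qed

lemma mult_op_bdry_series:
  assumes a: "\<And>i \<theta>. of_real (a i \<theta>) = fourier_series (A i) \<theta>"
    and T: "T (bdry_series c) = bdry_series (symbol_op m c)"
    and m: "bounded_symbol m" and c: "bdry_rapid c"
  shows "mult_op a T (bdry_series c) = bdry_series (\<lambda>p. \<Sum>\<^sub>\<infinity>q. toeplitz A m p q * c q)"
proof (intro ext)
  fix i \<theta>
  have r: "rapid (\<lambda>k. symbol_op m c (i, k))"
    using bdry_rapid_symbol_op[OF m c] by (simp add: bdry_rapid_def)
  show "mult_op a T (bdry_series c) i \<theta> = bdry_series (\<lambda>p. \<Sum>\<^sub>\<infinity>q. toeplitz A m p q * c q) i \<theta>"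
    unfolding mult_op_def T a
    by (simp add: bdry_series_def fourier_series_mult[OF rapid_A r] convolution_symbol_op[OF m c, symmetric, abs_def])
qed

lemma power_bdry_series:
  assumes a: "\<And>i \<theta>. of_real (a i \<theta>) = fourier_series (A i) \<theta>"
    and T: "\<And>c. bdry_rapid c \<Longrightarrow> T (bdry_series c) = bdry_series (symbol_op m c)"
    and m: "bounded_symbol m"
  shows "(mult_op a T ^^ n) (fourier_basis p)
    = bdry_series (\<lambda>q. matprod UNIV (replicate n (toeplitz A m)) q p / sqrt (2 * pi))"
proof (induction n)
  case 0
  then show ?case by (simp add: fourier_basis_eq)
next
  case (Suc n)
  define X where "X = matprod UNIV (replicate n (toeplitz A m))"
  have rap: "bdry_rapid (\<lambda>q. X q p / sqrt (2 * pi))"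
    unfolding X_def
    using bdry_rapid_column[OF finite_order_power[OF finite_order_toeplitz[OF m]]] .
  have "(mult_op a T ^^ Suc n) (fourier_basis p) = mult_op a T (bdry_series (\<lambda>q. X q p / sqrt (2 * pi)))"
    by (simp add: Suc X_def)
  also have "\<dots> = bdry_series (\<lambda>q. \<Sum>\<^sub>\<infinity>r. toeplitz A m q r * (X r p / sqrt (2 * pi)))"
    by (rule mult_op_bdry_series[where c = "\<lambda>q. X q p / sqrt (2 * pi)" and T = T, OF a T[OF rap] m rap])
  also have "(\<lambda>q. \<Sum>\<^sub>\<infinity>r. toeplitz A m q r * (X r p / sqrt (2 * pi)))
      = (\<lambda>q. matprod UNIV (replicate (Suc n) (toeplitz A m)) q p / sqrt (2 * pi))"
  proof (rule ext)
    fix q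
    show "(\<Sum>\<^sub>\<infinity>r. toeplitz A m q r * (X r p / sqrt (2 * pi)))
        = matprod UNIV (replicate (Suc n) (toeplitz A m)) q p / sqrt (2 * pi)"
      using infsum_cmult_left'[of "\<lambda>r. toeplitz A m q r * X r p" "1 / complex_of_real (sqrt (2 * pi))" UNIV]
      by (simp add: matprod_Cons matmul_def X_def)
  qed
  finally show ?case .
qed

lemma op_trace_power_diff:
  assumes a: "\<And>i \<theta>. of_real (a i \<theta>) = fourier_series (A i) \<theta>"
  shows "op_trace (power_diff l a n)
    = (\<Sum>\<^sub>\<infinity>p. matprod UNIV (replicate n aDN) p p - matprod UNIV (replicate n aD) p p)"
proof (rule op_trace_cong)
  fix p
  define X Y where "X = matprod UNIV (replicate n aDN)" "Y = matprod UNIV (replicate n aD)"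
  have DN: "(mult_op a (DN l) ^^ n) (fourier_basis p) = bdry_series (\<lambda>q. X q p / sqrt (2 * pi))"
    unfolding X_Y_def aDN_def
    by (rule power_bdry_series[OF a]) (simp_all add: DN_bdry_series[OF l] DN_symbol_eq bounded_DN_sym[OF l])
  have D: "(mult_op a D_op ^^ n) (fourier_basis p) = bdry_series (\<lambda>q. Y q p / sqrt (2 * pi))"
    unfolding X_Y_def aD_def
    by (rule power_bdry_series[OF a]) (simp_all add: D_op_bdry_series D_symbol_eq bounded_D_sym)
  have rX: "bdry_rapid (\<lambda>q. X q p / sqrt (2 * pi))" and rY: "bdry_rapid (\<lambda>q. Y q p / sqrt (2 * pi))"
    unfolding X_Y_def
    using bdry_rapid_column[OF finite_order_power[OF finite_order_aDN]]
      bdry_rapid_column[OF finite_order_power[OF finite_order_aD]] by blast+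
  define c where "c = (\<lambda>q. X q p / sqrt (2 * pi) - Y q p / sqrt (2 * pi))"
  have rc: "bdry_rapid c"
    unfolding bdry_rapid_def rapid_def
  proof (intro allI)
    fix i r
    obtain C where C: "\<And>k. cmod (X (i, k) p / sqrt (2 * pi)) \<le> C / wt k ^ r"
      using rX unfolding bdry_rapid_def rapid_def by blast
    obtain E where E: "\<And>k. cmod (Y (i, k) p / sqrt (2 * pi)) \<le> E / wt k ^ r"
      using rY unfolding bdry_rapid_def rapid_def by blast
    have "cmod (c (i, k)) \<le> (C + E) / wt k ^ r" for k
      unfolding c_def add_divide_distrib by (rule order_trans[OF norm_triangle_ineq4 add_mono[OF C E]])
    then show "\<exists>C. \<forall>k. cmod (c (i, k)) \<le> C / wt k ^ r" by blast
  qed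
  have "power_diff l a n (fourier_basis p) = bdry_series c"
  proof (intro ext)
    fix i \<theta>
    have sX: "(\<lambda>k. X (i, k) p / sqrt (2 * pi) * cis (of_int k * \<theta>)) summable_on UNIV"
      and sY: "(\<lambda>k. Y (i, k) p / sqrt (2 * pi) * cis (of_int k * \<theta>)) summable_on UNIV"
      using fourier_series_summable[of "\<lambda>k. X (i, k) p / sqrt (2 * pi)" \<theta>]
        fourier_series_summable[of "\<lambda>k. Y (i, k) p / sqrt (2 * pi)" \<theta>] rX rY
      unfolding bdry_rapid_def by blast+
    have "power_diff l a n (fourier_basis p) i \<theta>
        = fourier_series (\<lambda>k. X (i, k) p / sqrt (2 * pi)) \<theta> - fourier_series (\<lambda>k. Y (i, k) p / sqrt (2 * pi)) \<theta>"
      by (simp add: power_diff_def DN D bdry_series_def)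
    also have "\<dots> = fourier_series (\<lambda>k. c (i, k)) \<theta>"
      unfolding fourier_series_def
      using has_sum_diff[OF has_sum_infsum[OF sX] has_sum_infsum[OF sY]]
      by (intro infsumI[symmetric]) (simp add: c_def left_diff_distrib)
    finally show "power_diff l a n (fourier_basis p) i \<theta> = bdry_series c i \<theta>"
      by (simp add: bdry_series_def)
  qed
  then have "L2_inner (power_diff l a n (fourier_basis p)) (fourier_basis p) = sqrt (2 * pi) * c p"
    using L2_inner_fourier_basis[OF rc] by simp
  also have "\<dots> = X p p - Y p p"
    by (simp add: c_def right_diff_distrib)
  finally show "L2_inner (power_diff l a n (fourier_basis p)) (fourier_basis p)
      = matprod UNIV (replicate n aDN) p p - matprod UNIV (replicate n aD) p p"
    by (simp add: X_Y_def)
qed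

text \<open>
  For even exponents the sign \<open>S\<^sup>n\<close> is trivial, so the difference of the powers is smoothing and its truncated
  traces converge.
\<close>
lemma trace_limit:
  assumes a: "\<And>i \<theta>. of_real (a i \<theta>) = fourier_series (A i) \<theta>" and n: "even n"
  shows "(\<lambda>N. mtrace (mode_box N) (matprod (mode_box N) (replicate n aDN)) - mtrace (mode_box N) (matprod (mode_box N) (replicate n aD)))
    \<longlonglongrightarrow> op_trace (power_diff l a n)"
proof -
  define Z where "Z = (\<lambda>I p q. matprod I (replicate n aDN) p q - matprod I (replicate n aD) p q)"
  have "sgn_idx q ^ n = 1" for q using n by (auto simp: sgn_idx_def)
  then have "smoothing Z"
    using smoothing_power_diff[OF finite_order_aDN finite_order_aD smoothing_aDN_minus_abs_aD, of n]
    by (simp add: Z_def)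
  from smoothing_trace[OF this]
  have "(\<lambda>N. mtrace (mode_box N) (Z (mode_box N))) \<longlonglongrightarrow> op_trace (power_diff l a n)"
    unfolding op_trace_power_diff[OF a] by (simp add: mtrace_def Z_def)
  then show ?thesis by (simp add: mtrace_finite[OF finite_box] Z_def sum_subtractf)
qed

end

section \<open>A lower bound for the trace\<close>

fun bdry_sign :: "bdry \<Rightarrow> real" where
  "bdry_sign Lower = 1"
| "bdry_sign Upper = - 1"

text \<open>
  The diagonal of \<open>K = J sgn D\<close>.
\<close>
definition kappa :: "idx \<Rightarrow> real" where
  "kappa p = bdry_sign (fst p) * sgn_idx p"

lemma bdry_sign_cases: "bdry_sign i = 1 \<or> bdry_sign i = - 1"
  by (cases i) auto

lemma kappa_cases: "kappa p = 1 \<or> kappa p = - 1"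
  using bdry_sign_cases[of "fst p"] by (auto simp: kappa_def sgn_idx_def)

definition signed_D_sym :: symbol where
  "signed_D_sym k i j = (if i = j then of_int k * of_real (bdry_sign i) else 0)"

definition root_mat :: "real \<Rightarrow> idx mat" where
  "root_mat l p q = (if snd p = snd q then
     of_real (if fst p = fst q then root_diag l (snd p) else - root_off l (snd p)) else 0)"

text \<open>
  The product \<open>G X G\<close>.  As \<open>G\<close> preserves frequencies, only finite sums over the components occur.
\<close>
definition sandwich :: "real \<Rightarrow> idx mat \<Rightarrow> idx mat" where
  "sandwich l X p q = (\<Sum>i\<in>UNIV. \<Sum>j\<in>UNIV.
     root_mat l p (i, snd p) * X (i, snd p) (j, snd q) * root_mat l (j, snd q) q)"

lemma block_sum:
  fixes f :: "idx \<Rightarrow> complex"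
  assumes "p \<in> mode_box N" "\<And>r. snd r \<noteq> snd p \<Longrightarrow> f r = 0"
  shows "(\<Sum>r\<in>mode_box N. f r) = (\<Sum>i\<in>UNIV. f (i, snd p))"
proof -
  have "(\<Sum>r\<in>mode_box N. f r) = (\<Sum>r\<in>range (\<lambda>i. (i, snd p)). f r)"
  proof (rule sum.mono_neutral_right[OF finite_box])
    show "range (\<lambda>i. (i, snd p)) \<subseteq> mode_box N" using assms(1) by (auto simp: mode_box_def)
    show "\<forall>r\<in>mode_box N - range (\<lambda>i. (i, snd p)). f r = 0"
    proof
      fix r assume "r \<in> mode_box N - range (\<lambda>i. (i, snd p))"
      then have "snd r \<noteq> snd p" by (cases r) auto
      then show "f r = 0" by (rule assms(2))
    qed
  qed
  also have "\<dots> = (\<Sum>i\<in>UNIV. f (i, snd p))"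
    by (subst sum.reindex) (auto simp: inj_on_def)
  finally show ?thesis .
qed

lemma matprod_replicate_cong:
  assumes "finite I" "\<And>p q. p \<in> I \<Longrightarrow> q \<in> I \<Longrightarrow> X p q = Y p q" "p \<in> I"
  shows "matprod I (replicate n X) p q = matprod I (replicate n Y) p q"
  using assms(3)
proof (induction n arbitrary: p)
  case (Suc n)
  have "(\<Sum>r\<in>I. X p r * matprod I (replicate n X) r q) = (\<Sum>r\<in>I. Y p r * matprod I (replicate n Y) r q)"
    by (intro sum.cong refl) (simp add: assms(2) Suc)
  then show ?case by (simp add: matprod_Cons matmul_finite[OF assms(1)])
qed simp

context boundary_weight
begin

definition a_mat :: "idx mat" where "a_mat = toeplitz A id_sym"
definition aDJ :: "idx mat" where "aDJ = toeplitz A signed_D_sym"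

text \<open>
  The word \<open>(aDJ)\<^sup>d a\<close>.
\<close>
fun core :: "nat \<Rightarrow> family" where
  "core 0 = (\<lambda>I. a_mat)"
| "core (Suc d) = (\<lambda>I. matmul I aDJ (core d I))"

lemma bounded_signed_D_sym: "bounded_symbol signed_D_sym"
proof (rule bounded_symbolI[where B = 1 and s = 1])
  show "cmod (signed_D_sym k i j) \<le> 1 * wt k ^ 1" for k i j
    by (cases i) (simp_all add: signed_D_sym_def wt_def)
qed

lemma finite_order_aDJ: "finite_order (\<lambda>_. aDJ)"
  unfolding aDJ_def by (rule finite_order_toeplitz[OF bounded_signed_D_sym])

lemma finite_order_core: "finite_order (core d)"
proof (induction d)
  case 0
  then show ?case unfolding a_mat_def core.simps by (rule finite_order_toeplitz[OF bounded_id_sym])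
next
  case (Suc d)
  from finite_order_mul[OF finite_order_aDJ this] show ?case by (simp add: family_mul_def)
qed

lemma aD_power_block:
  assumes "finite I"
  shows "fst p \<noteq> fst q \<Longrightarrow> matprod I (replicate n aD) p q = 0"
    and "matprod I (replicate n aDJ) p q = matprod I (replicate n aD) p q * of_real (bdry_sign (fst q)) ^ n"
proof -
  have zero: "matprod I (replicate n aD) p q = 0" if "fst p \<noteq> fst q" for n p q
    using that
  proof (induction n arbitrary: p)
    case (Suc n)
    have "aD p r * matprod I (replicate n aD) r q = 0" for r
    proof (cases "fst p = fst r")
      case True
      then show ?thesis using Suc by simp
    qed (simp add: aD_def toeplitz_def D_sym_def)
    then show ?case
      by (simp add: matprod_Cons matmul_finite[OF assms] sum.neutral del: mult_eq_0_iff)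
  qed (auto simp: idmat_def)
  show "fst p \<noteq> fst q \<Longrightarrow> matprod I (replicate n aD) p q = 0" by (rule zero)
  show "matprod I (replicate n aDJ) p q = matprod I (replicate n aD) p q * of_real (bdry_sign (fst q)) ^ n"
  proof (induction n arbitrary: p)
    case (Suc n)
    have "aDJ p r * matprod I (replicate n aDJ) r q
        = aD p r * matprod I (replicate n aD) r q * of_real (bdry_sign (fst q)) ^ Suc n" for r
    proof (cases "fst r = fst q \<and> fst p = fst r")
      case True
      then show ?thesis unfolding Suc
        by (simp add: aDJ_def aD_def toeplitz_def signed_D_sym_def D_sym_def)
    next
      case False
      then consider "fst r \<noteq> fst q" | "fst p \<noteq> fst r" by blast
      then show ?thesis
      proof cases
        case 1
        then show ?thesis using zero[of r q n] by (simp add: Suc)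
      next
        case 2
        then show ?thesis by (simp add: aDJ_def aD_def toeplitz_def signed_D_sym_def D_sym_def)
      qed
    qed
    then show ?case by (simp add: matprod_Cons matmul_finite[OF assms] sum_distrib_right)
  qed simp
qed

lemma mtrace_aDJ_power:
  assumes "finite I" "even n"
  shows "mtrace I (matprod I (replicate n aDJ)) = mtrace I (matprod I (replicate n aD))"
proof -
  have "complex_of_real (bdry_sign i) ^ n = 1" for i
    using bdry_sign_cases[of i] assms(2) by auto
  then show ?thesis by (simp add: aD_power_block(2)[OF assms(1)] mtrace_finite[OF assms(1)])
qed

lemma root_mat_sym: "root_mat l q p = root_mat l p q" "cnj (root_mat l p q) = root_mat l p q"
  by (auto simp: root_mat_def)

lemma a_mat_hermitian: "a_mat q p = cnj (a_mat p q)"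
  using A_minus[of "fst p" "snd p - snd q"] by (auto simp: a_mat_def toeplitz_def id_sym_def)

lemma root_mat_zero: "snd r \<noteq> snd p \<Longrightarrow> root_mat l p r = 0" "snd r \<noteq> snd p \<Longrightarrow> root_mat l r p = 0"
  by (auto simp: root_mat_def)

text \<open>
  The identities \<open>G G = \<Lambda>\<close> and \<open>G K G = J D\<close>.  In the second the off-diagonal entries cancel because \<open>J\<close>
  has opposite signs on the two components, and the diagonal is \<open>(\<alpha>\<^sup>2 - \<beta>\<^sup>2) sgn k = k\<close> up to the sign of \<open>J\<close>.
\<close>
lemma a_root_root:
  assumes "q \<in> mode_box N"
  shows "matmul (mode_box N) (matmul (mode_box N) a_mat (root_mat l)) (root_mat l) p q = aDN p q"
    and "matmul (mode_box N) (matmul (mode_box N) a_mat (\<lambda>p q. root_mat l p q * of_real (kappa q))) (root_mat l) p q = aDJ p q"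
proof -
  obtain i k j n where pq: "p = (i, k)" "q = (j, n)" by (metis surj_pair)
  have in_box: "(j, n) \<in> mode_box N" for j using assms by (simp add: pq mode_box_def)
  have r: "complex_of_real \<bar>real_of_int n\<bar> * of_real (if n \<ge> 0 then 1 else - 1) = of_int n" by simp
  have gen: "matmul (mode_box N) (matmul (mode_box N) a_mat (\<lambda>p q. root_mat l p q * c q)) (root_mat l) p q
      = (\<Sum>j'\<in>UNIV. A i (k - n) * (root_mat l (i, n) (j', n) * c (j', n)) * root_mat l (j', n) q)" for c
  proof -
    have "matmul (mode_box N) a_mat (\<lambda>p q. root_mat l p q * c q) p (j', n)
        = A i (k - n) * (root_mat l (i, n) (j', n) * c (j', n))" for j'
      using block_sum[OF in_box, where f = "\<lambda>r. a_mat p r * (root_mat l r (j', n) * c (j', n))"] 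
      by (cases i) (simp_all add: matmul_finite[OF finite_box] root_mat_zero sum_bdry a_mat_def toeplitz_def id_sym_def pq)
    then show ?thesis
      using block_sum[OF in_box, where f = "\<lambda>r. matmul (mode_box N) a_mat (\<lambda>p q. root_mat l p q * c q) p r * root_mat l r q"]
      by (simp add: matmul_finite[OF finite_box, where X = "matmul (mode_box N) a_mat _"] root_mat_zero pq)
  qed
  show "matmul (mode_box N) (matmul (mode_box N) a_mat (root_mat l)) (root_mat l) p q = aDN p q"
  proof -
    have "(\<Sum>j'\<in>UNIV. A i (k - n) * (root_mat l (i, n) (j', n) * 1) * root_mat l (j', n) q) = aDN p q"
      by (cases i; cases j) (simp_all add: pq sum_bdry root_mat_def aDN_def toeplitz_def DN_sym_def power2_eq_square algebra_simps)
    then show ?thesis using gen[of "\<lambda>_. 1"] by simp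
  qed
  define x y \<sigma> where "x = complex_of_real (root_diag l n)" and "y = complex_of_real (root_off l n)"
    and "\<sigma> = complex_of_real (sgn_idx (Lower, n))"
  have rm: "root_mat l (i, n) (j, n) = (if i = j then x else - y)" for i j
    by (simp add: root_mat_def x_def y_def)
  have kap: "complex_of_real (kappa (i, n)) = of_real (bdry_sign i) * \<sigma>" for i
    by (simp add: kappa_def \<sigma>_def sgn_idx_def)
  have "x * x - y * y = of_real \<bar>real_of_int n\<bar>"
    unfolding root_diff[OF l, of n, symmetric] by (simp add: x_def y_def power2_eq_square)
  then have e: "of_int n = (x * x - y * y) * \<sigma>"
    using r by (simp add: \<sigma>_def sgn_idx_def split: if_splits)
  have "(\<Sum>j'\<in>UNIV. A i (k - n) * (root_mat l (i, n) (j', n) * of_real (kappa (j', n))) * root_mat l (j', n) (j, n))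
      = A i (k - n) * (if i = j then (x * x - y * y) * \<sigma> * of_real (bdry_sign i) else 0)"
    unfolding rm kap by (cases i; cases j) (simp_all add: sum_bdry algebra_simps)
  also have "\<dots> = aDJ p q"
    unfolding e[symmetric] by (simp add: pq aDJ_def toeplitz_def signed_D_sym_def)
  finally show "matmul (mode_box N) (matmul (mode_box N) a_mat (\<lambda>p q. root_mat l p q * of_real (kappa q))) (root_mat l) p q = aDJ p q"
    using gen[of "\<lambda>q. of_real (kappa q)"] by (simp only: pq)
qed

text \<open>
  Cyclicity of the trace moves one factor \<open>G\<close> around, which exchanges \<open>a\<Lambda>\<close> with \<open>H = G a G\<close> and \<open>aDJ\<close> with \<open>HK\<close>.
  The truncated index sets contain both components of each frequency, so \<open>G\<close> is unaffected by the truncation.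
\<close>
theorem finite_trace_difference:
  assumes I: "I = mode_box N"
  shows "(\<Sum>p\<in>I. \<Sum>q\<in>I. (1 - kappa p * kappa q) * (cmod (sandwich l (core d I) p q))\<^sup>2)
    \<le> Re (mtrace I (matprod I (replicate (2 * Suc d) aDN))) - Re (mtrace I (matprod I (replicate (2 * Suc d) aD)))"
proof -
  define G where "G = root_mat l"
  define G' where "G' = (\<lambda>p q. G p q * of_real (kappa q))"
  define X Y where "X = matmul I a_mat G" and "Y = matmul I a_mat G'"
  define H where "H = matmul I G X"
  have fin: "finite I" using I finite_box by simp
  have XG: "matmul I X G p q = aDN p q" and YG: "matmul I Y G p q = aDJ p q" if "q \<in> I" for p q
    using a_root_root[of q N p] that by (simp_all add: I X_def Y_def G_def G'_def)
  have herm: "H q p = cnj (H p q)" for p q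
  proof -
    have "H q p = (\<Sum>r\<in>I. \<Sum>s\<in>I. G q r * (a_mat r s * G s p))"
      by (simp add: H_def X_def matmul_finite[OF fin] sum_distrib_left)
    also have "\<dots> = (\<Sum>s\<in>I. \<Sum>r\<in>I. G q r * (a_mat r s * G s p))" by (rule sum.swap)
    also have "\<dots> = (\<Sum>s\<in>I. \<Sum>r\<in>I. cnj (G p s * (a_mat s r * G r q)))"
    proof (intro sum.cong refl)
      fix s r
      show "G q r * (a_mat r s * G s p) = cnj (G p s * (a_mat s r * G r q))"
        unfolding complex_cnj_mult G_def root_mat_sym(2)
        by (simp add: a_mat_hermitian[of r s] root_mat_sym(1)[of r q] root_mat_sym(1)[of p s])
    qed
    also have "\<dots> = cnj (H p q)"
      by (simp add: H_def X_def matmul_finite[OF fin] sum_distrib_left)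
    finally show ?thesis .
  qed
  interpret hermitian_word I H kappa
    by unfold_locales (rule fin, rule herm, rule kappa_cases)
  have twF: "twist kappa H False = H" by (simp add: twist_def)
  have twT: "twist kappa H True = matmul I G Y"
    by (simp add: twist_def fun_eq_iff H_def X_def Y_def G'_def matmul_finite[OF fin] sum_distrib_right mult.assoc)
  have trF: "mtrace I (word (replicate n False)) = mtrace I (matprod I (replicate n aDN))" if "n > 0" for n
  proof -
    have "mtrace I (word (replicate n False)) = mtrace I (matprod I (replicate n (matmul I X G)))"
      unfolding word_def map_replicate twF unfolding H_def by (rule mtrace_power_commute[OF fin that])
    also have "\<dots> = mtrace I (matprod I (replicate n aDN))"
      unfolding mtrace_finite[OF fin] by (intro sum.cong refl matprod_replicate_cong[OF fin XG])
    finally show ?thesis .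
  qed
  have trT: "mtrace I (word (replicate n True)) = mtrace I (matprod I (replicate n aD))" if "n > 0" "even n" for n
  proof -
    have "mtrace I (word (replicate n True)) = mtrace I (matprod I (replicate n (matmul I Y G)))"
      unfolding word_def map_replicate twT by (rule mtrace_power_commute[OF fin that(1)])
    also have "\<dots> = mtrace I (matprod I (replicate n aDJ))"
      unfolding mtrace_finite[OF fin] by (intro sum.cong refl matprod_replicate_cong[OF fin YG])
    finally show ?thesis using mtrace_aDJ_power[OF fin that(2)] by simp
  qed
  have wordE: "word (replicate d True @ [False]) p q = sandwich l (core d I) p q" if "p \<in> I" "q \<in> I" for p q
  proof -
    \<comment> \<open>equal to \<open>core d I\<close> on \<open>I\<close> only, since \<open>Y G\<close> agrees with \<open>aDJ\<close> only there\<close>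
    define core' where "core' d = foldr (matmul I) (replicate d (matmul I Y G)) a_mat" for d
    have 1: "word (replicate d True @ [False]) p q = matmul I G (matmul I (core' d) G) p q" if "q \<in> I" for d p q
    proof (induction d arbitrary: p)
      case 0
      have "word (replicate 0 True @ [False]) p q = matmul I H idmat p q"
        by (simp add: word_def twF matprod_Cons)
      then show ?case using matmul_idmat[OF fin that] by (simp add: H_def X_def core'_def)
    next
      case (Suc d)
      have "word (replicate (Suc d) True @ [False]) p q
          = (\<Sum>r\<in>I. matmul I G Y p r * word (replicate d True @ [False]) r q)"
        by (simp add: word_def twT matprod_Cons matmul_finite[OF fin])
      also have "\<dots> = matmul I (matmul I G Y) (matmul I G (matmul I (core' d) G)) p q"
        by (simp add: Suc matmul_finite[OF fin, of "matmul I G Y"])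
      also have "\<dots> = matmul I G (matmul I (core' (Suc d)) G) p q"
        by (simp add: core'_def matmul_assoc[OF fin])
      finally show ?case .
    qed
    have 2: "core' d r s = core d I r s" if "r \<in> I" for d r s
      using that
    proof (induction d arbitrary: r)
      case (Suc d)
      have "core' (Suc d) r s = (\<Sum>t\<in>I. matmul I Y G r t * core' d t s)"
        by (simp add: core'_def matmul_finite[OF fin, of "matmul I Y G"])
      also have "\<dots> = (\<Sum>t\<in>I. aDJ r t * core d I t s)"
        by (intro sum.cong refl) (simp add: YG Suc)
      finally show ?case by (simp add: matmul_finite[OF fin])
    qed (simp add: core'_def)
    have inI: "(i, snd p) \<in> I" "(i, snd q) \<in> I" for i using that by (auto simp: I mode_box_def)
    have 3: "matmul I (core' d) G r q = (\<Sum>j\<in>UNIV. core' d r (j, snd q) * G (j, snd q) q)" for r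
      unfolding matmul_finite[OF fin] unfolding I
      by (rule block_sum) (use that in \<open>auto simp: I G_def root_mat_zero\<close>)
    have "word (replicate d True @ [False]) p q = (\<Sum>r\<in>I. G p r * matmul I (core' d) G r q)"
      unfolding 1[OF that(2)] by (simp add: matmul_finite[OF fin, of G])
    also have "\<dots> = (\<Sum>i\<in>UNIV. G p (i, snd p) * matmul I (core' d) G (i, snd p) q)"
      unfolding I by (rule block_sum) (use that in \<open>auto simp: I G_def root_mat_zero\<close>)
    also have "\<dots> = sandwich l (core d I) p q"
      unfolding 3 sandwich_def sum_distrib_left
      by (intro sum.cong refl) (simp add: 2[OF inI(1)] G_def mult.assoc)
    finally show ?thesis .
  qed
  show ?thesis
  proof -
    have "(\<Sum>p\<in>I. \<Sum>q\<in>I. (1 - kappa p * kappa q) * (cmod (sandwich l (core d I) p q))\<^sup>2)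
        = (\<Sum>p\<in>I. \<Sum>q\<in>I. (1 - kappa p * kappa q) * (cmod (word (replicate d True @ [False]) p q))\<^sup>2)"
      by (intro sum.cong refl) (simp only: wordE)
    moreover have "2 * Suc d > 0" "even (2 * Suc d)" by simp_all
    ultimately show ?thesis
      using trace_power_difference[of d] by (simp only: trF trT)
  qed
qed

theorem op_trace_lower_bound:
  assumes a: "\<And>i \<theta>. of_real (a i \<theta>) = fourier_series (A i) \<theta>" and F: "finite F"
  shows "(\<Sum>(p, q)\<in>F. (1 - kappa p * kappa q) * (cmod (sandwich l (core d UNIV) p q))\<^sup>2)
    \<le> Re (op_trace (power_diff l a (2 * Suc d)))"
proof (rule tendsto_le)
  define f where "f = (\<lambda>I p q. (1 - kappa p * kappa q) * (cmod (sandwich l (core d I) p q))\<^sup>2)"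
  show "(\<lambda>N. Re (mtrace (mode_box N) (matprod (mode_box N) (replicate (2 * Suc d) aDN))
      - mtrace (mode_box N) (matprod (mode_box N) (replicate (2 * Suc d) aD)))) \<longlonglongrightarrow> Re (op_trace (power_diff l a (2 * Suc d)))"
    by (intro tendsto_Re trace_limit[OF a]) simp
  have "(\<lambda>N. core d (mode_box N) r s) \<longlonglongrightarrow> core d UNIV r s" for r s
    using stable_finite_order[OF finite_order_core[of d]] unfolding stable_def by blast
  then have "(\<lambda>N. f (mode_box N) p q) \<longlonglongrightarrow> f UNIV p q" for p q
    unfolding f_def sandwich_def by (intro tendsto_intros)
  then have "(\<lambda>N. \<Sum>(p, q)\<in>F. f (mode_box N) p q) \<longlonglongrightarrow> (\<Sum>(p, q)\<in>F. f UNIV p q)"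
    unfolding case_prod_unfold by (intro tendsto_sum)
  then show "(\<lambda>N. \<Sum>(p, q)\<in>F. f (mode_box N) p q) \<longlonglongrightarrow>
      (\<Sum>(p, q)\<in>F. (1 - kappa p * kappa q) * (cmod (sandwich l (core d UNIV) p q))\<^sup>2)"
    by (simp only: f_def)
  have "\<forall>\<^sub>F N in sequentially. \<forall>z\<in>F. z \<in> mode_box N \<times> mode_box N"
    by (intro eventually_ball_finite[OF F] ballI)
      (use eventually_conj[OF eventually_in_box eventually_in_box] in \<open>auto simp: mem_Times_iff\<close>)
  then show "\<forall>\<^sub>F N in sequentially. (\<Sum>(p, q)\<in>F. f (mode_box N) p q)
      \<le> Re (mtrace (mode_box N) (matprod (mode_box N) (replicate (2 * Suc d) aDN))
          - mtrace (mode_box N) (matprod (mode_box N) (replicate (2 * Suc d) aD)))"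
  proof eventually_elim
    case (elim N)
    have "f (mode_box N) p q \<ge> 0" for p q
      using kappa_cases[of p] kappa_cases[of q] by (auto simp: f_def)
    then have "(\<Sum>(p, q)\<in>F. f (mode_box N) p q) \<le> (\<Sum>(p, q)\<in>mode_box N \<times> mode_box N. f (mode_box N) p q)"
      using elim by (intro sum_mono2) (auto simp: finite_box)
    also have "\<dots> \<le> Re (mtrace (mode_box N) (matprod (mode_box N) (replicate (2 * Suc d) aDN))
          - mtrace (mode_box N) (matprod (mode_box N) (replicate (2 * Suc d) aD)))"
      unfolding sum.cartesian_product[symmetric] f_def minus_complex.sel
      by (rule finite_trace_difference) simp
    finally show ?case .
  qed
qed simp

end

section \<open>From the trace to the Sobolev norm\<close>

lemma rapid_zero: "rapid (\<lambda>_. 0)"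
  unfolding rapid_def by (auto intro!: exI[of _ 0])

lemma rapid_add:
  assumes "rapid b" "rapid c" shows "rapid (\<lambda>k. b k + c k)"
  unfolding rapid_def
proof
  fix r
  obtain B where B: "\<And>k. cmod (b k) \<le> B / wt k ^ r" using assms(1) unfolding rapid_def by blast
  obtain C where C: "\<And>k. cmod (c k) \<le> C / wt k ^ r" using assms(2) unfolding rapid_def by blast
  have "cmod (b k + c k) \<le> (B + C) / wt k ^ r" for k
    unfolding add_divide_distrib by (rule order_trans[OF norm_triangle_ineq add_mono[OF B C]])
  then show "\<exists>C. \<forall>k. cmod (b k + c k) \<le> C / wt k ^ r" by blast
qed

lemma rapid_times_int: "rapid c \<Longrightarrow> rapid (\<lambda>k. of_int k * c k)"
  by (rule rapid_multiplier[where B = 1 and s = 1]) (auto simp: wt_def)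

lemma convolution_has_sum:
  assumes "rapid a" "rapid c"
  shows "((\<lambda>j. a (k - j) * c j) has_sum convolution a c k) UNIV"
proof -
  obtain C where C: "\<And>r. C r \<ge> 0" "\<And>r k. cmod (a k) \<le> C r / wt k ^ r"
    using rapidE[OF assms(1)] by metis
  have "cmod (a (k - j) * c j) \<le> C 0 * cmod (c j) * wt j ^ 0" for j
    using C(2)[of "k - j" 0] by (simp add: norm_mult mult_right_mono)
  then have "(\<lambda>j. cmod (a (k - j) * c j)) summable_on UNIV"
    by (rule Infinite_Sum.abs_summable_on_comparison_test'[OF rapid_summable[OF assms(2)]])
  then show ?thesis
    unfolding convolution_def by (intro has_sum_infsum) (rule abs_summable_summable)
qed

lemma has_sum_finite_sum:
  fixes f :: "'t \<Rightarrow> 'k \<Rightarrow> complex"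
  assumes "finite T" "\<And>t. t \<in> T \<Longrightarrow> (f t has_sum g t) S"
  shows "((\<lambda>x. \<Sum>t\<in>T. f t x) has_sum (\<Sum>t\<in>T. g t)) S"
  using assms by (induction T rule: finite_induct) (auto intro!: has_sum_add)

lemma convolution_zero [simp]: "convolution a (\<lambda>_. 0) = (\<lambda>_. 0)"
  by (simp add: convolution_def fun_eq_iff)

text \<open>
  The coefficient of \<open>n\<^sup>j\<close> in the entry of \<open>(aD)\<^sup>d a\<close> from frequency \<open>n\<close> to \<open>n + N\<close>.  Applying \<open>aD\<close> to
  frequency \<open>n + M\<close> produces the factor \<open>n + M\<close>, whence the two convolutions.
\<close>
primrec word_coeff :: "(int \<Rightarrow> complex) \<Rightarrow> nat \<Rightarrow> nat \<Rightarrow> int \<Rightarrow> complex" where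
  "word_coeff a 0 = (\<lambda>j. if j = 0 then a else (\<lambda>_. 0))"
| "word_coeff a (Suc d) = (\<lambda>j N. (if j = 0 then 0 else convolution a (word_coeff a d (j - 1)) N)
     + convolution a (\<lambda>M. of_int M * word_coeff a d j M) N)"

lemma rapid_word_coeff: "rapid a \<Longrightarrow> rapid (word_coeff a d j)"
proof (induction d arbitrary: j)
  case (Suc d)
  have "rapid (\<lambda>N. if j = 0 then 0 else convolution a (word_coeff a d (j - 1)) N)"
    by (cases "j = 0") (simp_all add: rapid_zero rapid_convolution Suc)
  then show ?case
    by (simp only: word_coeff.simps) (intro rapid_add rapid_convolution rapid_times_int Suc)
qed (simp add: rapid_zero)

lemma word_coeff_zero: "j > d \<Longrightarrow> word_coeff a d j = (\<lambda>_. 0)"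
  by (induction d arbitrary: j) (auto simp: fun_eq_iff convolution_def)

lemma word_coeff_lead: "word_coeff a (Suc d) (Suc d) = convolution a (word_coeff a d d)"
  by (simp add: word_coeff_zero[of d "Suc d"])

lemma fourier_series_word_coeff:
  assumes "rapid a"
  shows "fourier_series (word_coeff a d d) \<theta> = fourier_series a \<theta> ^ Suc d"
proof (induction d)
  case (Suc d)
  then show ?case
    unfolding word_coeff_lead by (simp add: fourier_series_mult[OF assms rapid_word_coeff[OF assms], symmetric])
qed simp

lemma cmod_word_coeff_le:
  assumes "rapid a"
  shows "cmod (word_coeff a d d N) \<le> (\<Sum>\<^sub>\<infinity>k. cmod (a k)) ^ Suc d"
proof (induction d arbitrary: N)
  case 0
  have "cmod (a N) \<le> (\<Sum>\<^sub>\<infinity>k. cmod (a k))"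
    using finite_sum_le_infsum[OF rapid_abs_summable[OF assms], of "{N}"] by simp
  then show ?case by simp
next
  case (Suc d)
  define S where "S = (\<Sum>\<^sub>\<infinity>k. cmod (a k))"
  have b: "bij_betw (\<lambda>j. N - j) UNIV (UNIV :: int set)"
    by (rule bij_betw_byWitness[of _ "\<lambda>j. N - j"]) auto
  have hs: "((\<lambda>j. cmod (a (N - j)) * S ^ Suc d) has_sum S * S ^ Suc d) UNIV"
    unfolding S_def
    using has_sum_reindex_bij_betw[OF b, of "\<lambda>k. cmod (a k)"] has_sum_infsum[OF rapid_abs_summable[OF assms]]
    by (intro has_sum_cmult_left) simp
  have "cmod (convolution a (word_coeff a d d) N) \<le> S * S ^ Suc d"
  proof (rule norm_infsum_le[OF convolution_has_sum[OF assms rapid_word_coeff[OF assms]] hs])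
    show "cmod (a (N - j) * word_coeff a d d j) \<le> cmod (a (N - j)) * S ^ Suc d" for j
      unfolding norm_mult S_def by (intro mult_left_mono Suc.IH) simp
  qed
  then show ?case unfolding word_coeff_lead by (simp add: S_def)
qed

lemma infsum_idx_single:
  fixes f :: "idx \<Rightarrow> complex"
  assumes "\<And>r. fst r \<noteq> i \<Longrightarrow> f r = 0"
  shows "(\<Sum>\<^sub>\<infinity>r. f r) = (\<Sum>\<^sub>\<infinity>k. f (i, k))"
proof -
  have "(\<Sum>\<^sub>\<infinity>r. f r) = infsum f (range (Pair i))"
    by (rule infsum_cong_neutral) (use assms in \<open>auto simp: image_iff\<close>)
  also have "\<dots> = (\<Sum>\<^sub>\<infinity>k. f (i, k))"
    by (subst infsum_reindex) (auto simp: inj_on_def o_def)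
  finally show ?thesis .
qed

lemma two_by_two_lower_bound:
  fixes M M' :: complex
  assumes "x * y \<ge> 0"
  shows "(x - y)\<^sup>2 * ((cmod M)\<^sup>2 + (cmod M')\<^sup>2)
    \<le> (cmod (of_real x * M + of_real y * M'))\<^sup>2 + (cmod (of_real x * M' + of_real y * M))\<^sup>2"
proof -
  have "(cmod (of_real x * M + of_real y * M'))\<^sup>2 + (cmod (of_real x * M' + of_real y * M))\<^sup>2
      - (x - y)\<^sup>2 * ((cmod M)\<^sup>2 + (cmod M')\<^sup>2) = 2 * (x * y) * (cmod (M + M'))\<^sup>2"
    unfolding cmod_power2 by (simp add: power2_eq_square algebra_simps)
  moreover have "\<dots> \<ge> 0" using assms by simp
  ultimately show ?thesis by linarith
qed

text \<open>
  The two sides differ by a square, since \<open>|k|\<close> is \<open>\<alpha>\<^sup>2 - \<beta>\<^sup>2\<close>.  The bound does not involve \<open>l\<close>.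
\<close>
lemma root_product_lower_bound:
  assumes "l > 0"
  shows "\<bar>real_of_int k\<bar> * \<bar>real_of_int n\<bar> \<le> (root_diag l k * root_diag l n - root_off l k * root_off l n)\<^sup>2"
proof -
  have "(root_diag l k * root_diag l n - root_off l k * root_off l n)\<^sup>2 - \<bar>real_of_int k\<bar> * \<bar>real_of_int n\<bar>
      = (root_diag l k * root_off l n - root_off l k * root_diag l n)\<^sup>2"
    unfolding root_diff[OF assms, symmetric] by (simp add: power2_eq_square algebra_simps)
  then show ?thesis using zero_le_power2[of "root_diag l k * root_off l n - root_off l k * root_diag l n"] by linarith
qed

lemma root_diag_sq_ge:
  assumes "l > 0" shows "min (1 / (2 * l)) (1 / 2) * wt k \<le> (root_diag l k)\<^sup>2"
proof (cases "k = 0")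
  case True
  then show ?thesis using assms by (simp add: root_diag_sq wt_def)
next
  case False
  have "min (1 / (2 * l)) (1 / 2) * wt k \<le> 1 / 2 * wt k" by (intro mult_right_mono) auto
  also have "\<dots> \<le> \<bar>real_of_int k\<bar>" using False by (simp add: wt_def)
  also have "\<dots> \<le> (root_diag l k)\<^sup>2"
    using root_diff[OF assms, of k] zero_le_power2[of "root_off l k"] by linarith
  finally show ?thesis .
qed

definition low_const :: "real \<Rightarrow> real" where
  "low_const l = (min (1 / (2 * l)) (1 / 2) * (1 - exp (- l)) / 2)\<^sup>2"

lemma low_const_pos: "l > 0 \<Longrightarrow> low_const l > 0"
  unfolding low_const_def by (simp add: min_def)

text \<open>
  Splitting \<open>N\<close> into nearly equal halves makes both \<open>\<alpha>\<^sup>2\<close> factors at least of order \<open>N\<close>.  In contrast to the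
  bound by \<open>|k| |n|\<close> this one is positive when one of the halves is \<open>0\<close>, which happens for \<open>N = \<plusminus>1\<close>.
\<close>
lemma root_product_lower_bound_low:
  assumes l: "l > 0" and N: "N \<noteq> 0"
  defines "k \<equiv> N div 2" and "n \<equiv> N div 2 - N"
  shows "low_const l * (wt N)\<^sup>2 \<le> (root_diag l k * root_diag l n - root_off l k * root_off l n)\<^sup>2"
proof -
  define c where "c = min (1 / (2 * l)) (1 / 2)"
  have c: "c > 0" using l by (simp add: c_def)
  have kn: "wt N \<le> 2 * wt k" "wt N \<le> 2 * wt n" "\<bar>k\<bar> + \<bar>n\<bar> \<ge> 1"
  proof -
    have *: "1 + \<bar>N\<bar> \<le> 2 * (1 + \<bar>k\<bar>)" "1 + \<bar>N\<bar> \<le> 2 * (1 + \<bar>n\<bar>)"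
      unfolding k_def n_def by presburger+
    have "real_of_int (1 + \<bar>N\<bar>) \<le> of_int (2 * (1 + \<bar>k\<bar>))" "real_of_int (1 + \<bar>N\<bar>) \<le> of_int (2 * (1 + \<bar>n\<bar>))"
      using * by (simp_all only: of_int_le_iff)
    then show "wt N \<le> 2 * wt k" "wt N \<le> 2 * wt n" by (simp_all add: wt_def)
    show "\<bar>k\<bar> + \<bar>n\<bar> \<ge> 1" using N unfolding k_def n_def by presburger
  qed
  have e: "exp (- (\<bar>real_of_int k\<bar> * l)) * exp (- (\<bar>real_of_int n\<bar> * l)) \<le> exp (- l)"
  proof -
    have "1 \<le> \<bar>real_of_int k\<bar> + \<bar>real_of_int n\<bar>" using kn(3) by linarith
    then have "1 * l \<le> (\<bar>real_of_int k\<bar> + \<bar>real_of_int n\<bar>) * l" using l by (intro mult_right_mono) auto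
    then show ?thesis by (simp add: mult_exp_exp algebra_simps)
  qed
  have el: "1 - exp (- l) \<ge> 0" using l by simp
  have d: "root_diag l k > 0" "root_diag l n > 0" using root_diag_pos[OF l] by auto
  define E where "E = exp (- (\<bar>real_of_int k\<bar> * l)) * exp (- (\<bar>real_of_int n\<bar> * l))"
  have "(root_diag l k * root_diag l n - root_off l k * root_off l n)\<^sup>2
      = (root_diag l k)\<^sup>2 * (root_diag l n)\<^sup>2 * (1 - E)\<^sup>2"
    by (simp add: root_off_def E_def power2_eq_square algebra_simps)
  moreover have "(c * (wt N / 2)) * (c * (wt N / 2)) * (1 - exp (- l))\<^sup>2
      \<le> (root_diag l k)\<^sup>2 * (root_diag l n)\<^sup>2 * (1 - E)\<^sup>2"
  proof (intro mult_mono)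
    show "c * (wt N / 2) \<le> (root_diag l k)\<^sup>2"
      using order_trans[OF mult_left_mono[of "wt N / 2" "wt k" c] root_diag_sq_ge[OF l, of k, folded c_def]] kn c by simp
    show "c * (wt N / 2) \<le> (root_diag l n)\<^sup>2"
      using order_trans[OF mult_left_mono[of "wt N / 2" "wt n" c] root_diag_sq_ge[OF l, of n, folded c_def]] kn c by simp
    show "(1 - exp (- l))\<^sup>2 \<le> (1 - E)\<^sup>2" using e el by (intro power_mono) (auto simp: E_def)
  qed (use c in auto)
  moreover have "low_const l * (wt N)\<^sup>2 = (c * (wt N / 2)) * (c * (wt N / 2)) * (1 - exp (- l))\<^sup>2"
    unfolding low_const_def c_def[symmetric] by (simp add: power2_eq_square)
  ultimately show ?thesis by simp
qed

context boundary_weight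
begin

lemma core_entry:
  "core d UNIV (i, k) (j, n) = (if i = j
     then of_real (bdry_sign i) ^ d * (\<Sum>t\<le>d. word_coeff (A i) d t (k - n) * of_int n ^ t) else 0)"
proof (induction d arbitrary: i k)
  case 0
  then show ?case by (simp add: a_mat_def toeplitz_def id_sym_def)
next
  case (Suc d)
  define J where "J = complex_of_real (bdry_sign i)"
  define N where "N = k - n"
  have step: "core (Suc d) UNIV (i, k) (j, n) = (\<Sum>\<^sub>\<infinity>M. aDJ (i, k) (i, M + n) * core d UNIV (i, M + n) (j, n))"
  proof -
    have "core (Suc d) UNIV (i, k) (j, n) = (\<Sum>\<^sub>\<infinity>r. aDJ (i, k) r * core d UNIV r (j, n))"
      by (simp add: matmul_def)
    also have "\<dots> = (\<Sum>\<^sub>\<infinity>k'. aDJ (i, k) (i, k') * core d UNIV (i, k') (j, n))"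
      by (rule infsum_idx_single) (auto simp: aDJ_def toeplitz_def signed_D_sym_def)
    also have "\<dots> = (\<Sum>\<^sub>\<infinity>M. aDJ (i, k) (i, M + n) * core d UNIV (i, M + n) (j, n))"
      by (rule infsum_reindex_bij_witness[of _ "\<lambda>M. M + n" "\<lambda>k'. k' - n"]) auto
    finally show ?thesis .
  qed
  show ?case
  proof (cases "i = j")
    case False
    then show ?thesis unfolding step by (simp add: Suc)
  next
    case True
    let ?w = "word_coeff (A i) d"
    have rw: "rapid (?w t)" "rapid (\<lambda>M. of_int M * ?w t M)" for t
      by (intro rapid_times_int rapid_word_coeff rapid_A)+
    define G where "G t = convolution (A i) (\<lambda>M. of_int M * ?w t M) N * of_int n ^ t" for t
    define H where "H t = convolution (A i) (?w t) N * of_int n ^ Suc t" for t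
    have hs: "((\<lambda>M. \<Sum>t\<le>d. A i (N - M) * (of_int M * ?w t M) * of_int n ^ t + A i (N - M) * ?w t M * of_int n ^ Suc t)
        has_sum (\<Sum>t\<le>d. G t + H t)) UNIV"
      unfolding G_def H_def
      by (intro has_sum_finite_sum has_sum_add has_sum_cmult_left convolution_has_sum rapid_A rw) auto
    have "aDJ (i, k) (i, M + n) * core d UNIV (i, M + n) (j, n)
        = J ^ Suc d * (\<Sum>t\<le>d. A i (N - M) * (of_int M * ?w t M) * of_int n ^ t + A i (N - M) * ?w t M * of_int n ^ Suc t)" for M
    proof -
      have "aDJ (i, k) (i, M + n) = A i (N - M) * of_int (M + n) * J"
        by (simp add: aDJ_def toeplitz_def signed_D_sym_def J_def N_def algebra_simps)
      moreover have "core d UNIV (i, M + n) (j, n) = J ^ d * (\<Sum>t\<le>d. ?w t M * of_int n ^ t)"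
        using True by (simp add: Suc J_def)
      moreover have "A i (N - M) * of_int (M + n) * (\<Sum>t\<le>d. ?w t M * of_int n ^ t)
          = (\<Sum>t\<le>d. A i (N - M) * (of_int M * ?w t M) * of_int n ^ t + A i (N - M) * ?w t M * of_int n ^ Suc t)"
        unfolding sum_distrib_left by (intro sum.cong refl) (simp add: algebra_simps)
      ultimately show ?thesis by (simp add: mult_ac)
    qed
    then have "core (Suc d) UNIV (i, k) (j, n) = J ^ Suc d * (\<Sum>t\<le>d. G t + H t)"
      unfolding step using has_sum_cmult_right[OF hs, of "J ^ Suc d"] by (simp only:) (rule infsumI)
    also have "(\<Sum>t\<le>d. G t + H t) = (\<Sum>t\<le>Suc d. word_coeff (A i) (Suc d) t N * of_int n ^ t)"
    proof -
      have "G (Suc d) = 0" by (simp add: G_def word_coeff_zero)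
      then have "(\<Sum>t\<le>d. G t) = (\<Sum>t\<le>Suc d. G t)" by simp
      moreover have "(\<Sum>t\<le>d. H t) = (\<Sum>t\<le>Suc d. if t = 0 then 0 else H (t - 1))"
        by (subst sum.atMost_Suc_shift) simp
      ultimately have "(\<Sum>t\<le>d. G t + H t) = (\<Sum>t\<le>Suc d. (if t = 0 then 0 else H (t - 1)) + G t)"
        by (simp add: sum.distrib add.commute del: sum.atMost_Suc)
      also have "\<dots> = (\<Sum>t\<le>Suc d. word_coeff (A i) (Suc d) t N * of_int n ^ t)"
        by (intro sum.cong refl) (auto simp: G_def H_def distrib_right simp flip: power_Suc)
      finally show ?thesis .
    qed
    finally show ?thesis using True by (simp add: J_def N_def)
  qed
qed

definition word_poly :: "nat \<Rightarrow> bdry \<Rightarrow> int \<Rightarrow> int \<Rightarrow> complex" where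
  "word_poly d i k n = (\<Sum>t\<le>d. word_coeff (A i) d t (k - n) * of_int n ^ t)"

lemma cmod_core_diag: "cmod (core d UNIV (i, k) (i, n)) = cmod (word_poly d i k n)"
  using bdry_sign_cases[of i] by (auto simp: core_entry word_poly_def norm_mult norm_power)

lemma sandwich_diag:
  "sandwich l (core d UNIV) (i, k) (i, n)
    = of_real (root_diag l k * root_diag l n) * core d UNIV (i, k) (i, n)
      + of_real (root_off l k * root_off l n) * core d UNIV (flip i, k) (flip i, n)"
  by (cases i) (simp_all add: sandwich_def sum_bdry core_entry root_mat_def mult_ac)

text \<open>
  For frequencies of opposite sign \<open>\<kappa>\<close> takes opposite values at the two ends of an entry within one
  component.  Conjugation by \<open>G\<close> mixes the two components by a symmetric \<open>2 \<times> 2\<close> matrix with entries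
  \<open>x \<ge> y > 0\<close>, whose smallest singular value is \<open>x - y\<close>.
\<close>
lemma sandwich_pair_lower_bound:
  assumes "(k \<ge> 0) \<noteq> (n \<ge> 0)"
  shows "2 * (root_diag l k * root_diag l n - root_off l k * root_off l n)\<^sup>2 * (\<Sum>i\<in>UNIV. (cmod (word_poly d i k n))\<^sup>2)
    \<le> (\<Sum>i\<in>UNIV. (1 - kappa (i, k) * kappa (i, n)) * (cmod (sandwich l (core d UNIV) (i, k) (i, n)))\<^sup>2)"
proof -
  have k: "1 - kappa (i, k) * kappa (i, n) = 2" for i
    using assms by (cases i) (auto simp: kappa_def sgn_idx_def)
  have "0 \<le> (root_diag l k * root_diag l n) * (root_off l k * root_off l n)"
    using root_diag_pos[OF l] root_off_pos[OF l] by (simp add: less_imp_le)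
  from two_by_two_lower_bound[OF this, of "core d UNIV (Lower, k) (Lower, n)" "core d UNIV (Upper, k) (Upper, n)"]
  show ?thesis by (simp add: k sum_bdry sandwich_diag cmod_core_diag)
qed

context
  fixes a :: "real bdry_fun"
  assumes a: "\<And>i \<theta>. of_real (a i \<theta>) = fourier_series (A i) \<theta>"
begin

lemma op_trace_ge_pairs:
  assumes T: "finite T" and opp: "\<And>k n. (k, n) \<in> T \<Longrightarrow> (k \<ge> 0) \<noteq> (n \<ge> 0)"
  shows "(\<Sum>(k, n)\<in>T. 2 * (root_diag l k * root_diag l n - root_off l k * root_off l n)\<^sup>2
      * (\<Sum>i\<in>UNIV. (cmod (word_poly d i k n))\<^sup>2)) \<le> Re (op_trace (power_diff l a (2 * Suc d)))"
proof -
  define h where "h = (\<lambda>(z, i). ((i::bdry, fst z :: int), (i, snd z :: int)))"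
  define f where "f = (\<lambda>(p, q). (1 - kappa p * kappa q) * (cmod (sandwich l (core d UNIV) p q))\<^sup>2)"
  have "(\<Sum>(k, n)\<in>T. 2 * (root_diag l k * root_diag l n - root_off l k * root_off l n)\<^sup>2
      * (\<Sum>i\<in>UNIV. (cmod (word_poly d i k n))\<^sup>2)) \<le> (\<Sum>z\<in>T. \<Sum>i\<in>UNIV. f (h (z, i)))"
    by (intro sum_mono) (use sandwich_pair_lower_bound opp in \<open>auto simp: f_def h_def\<close>)
  also have "\<dots> = (\<Sum>z\<in>T \<times> UNIV. f (h z))"
    by (simp add: sum.cartesian_product)
  also have "\<dots> = (\<Sum>z\<in>h ` (T \<times> UNIV). f z)"
    by (subst sum.reindex) (auto simp: inj_on_def h_def)
  also have "\<dots> \<le> Re (op_trace (power_diff l a (2 * Suc d)))"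
    unfolding f_def by (rule op_trace_lower_bound[OF a]) (use T in auto)
  finally show ?thesis .
qed

lemma op_trace_nonneg: "0 \<le> Re (op_trace (power_diff l a (2 * Suc d)))"
  using op_trace_ge_pairs[of "{}" d] by simp

text \<open>
  For each \<open>N\<close> collect the pairs of frequencies of opposite sign with difference \<open>N\<close>.  Different \<open>N\<close> use
  different entries of the matrix.
\<close>
lemma high_modes:
  assumes F: "finite F" "\<And>N. N \<in> F \<Longrightarrow> \<bar>N\<bar> \<ge> int (d + 4)"
  shows "(\<Sum>N\<in>F. \<Sum>i\<in>UNIV. \<bar>real_of_int N\<bar> ^ (2 * d + 3) * (cmod (word_coeff (A i) d d N))\<^sup>2)
    \<le> 4 ^ d * (2 * (real d + 4)) ^ (2 * d + 3) / 2 * Re (op_trace (power_diff l a (2 * Suc d)))"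
proof -
  define K where "K = (4 ^ d * (2 * (real d + 4)) ^ (2 * d + 3) :: real)"
  have K: "K > 0" by (simp add: K_def)
  \<comment> \<open>\<open>h (N, j)\<close> is the pair \<open>(k, n)\<close> with \<open>k - n = N\<close> and \<open>|n| = j\<close> for which \<open>n\<close> and \<open>N\<close> have opposite signs\<close>
  define T where "T = Sigma F (\<lambda>N. {1..<nat \<bar>N\<bar>})"
  define h where "h = (\<lambda>(N::int, j::nat). (N - sgn N * int j, - (sgn N * int j)))"
  define g where "g = (\<lambda>(k, n). 2 * (root_diag l k * root_diag l n - root_off l k * root_off l n)\<^sup>2
      * (\<Sum>i\<in>UNIV. (cmod (word_poly d i k n))\<^sup>2))"
  have fT: "finite T" unfolding T_def using F(1) by auto
  have inj: "inj_on h T"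
  proof (rule inj_onI)
    fix x y assume "x \<in> T" "y \<in> T" and eq: "h x = h y"
    then obtain N j N' j' where xy: "x = (N, j)" "y = (N', j')" and N: "N \<noteq> 0"
      unfolding T_def using F(2) by fastforce
    have "N = N'" "sgn N * int j = sgn N' * int j'" using eq by (auto simp: h_def xy)
    then show "x = y" using N by (simp add: xy sgn_if split: if_splits)
  qed
  have one: "\<bar>real_of_int N\<bar> ^ (2 * d + 3) * (cmod (word_coeff (A i) d d N))\<^sup>2 / K
      \<le> (\<Sum>j\<in>{1..<nat \<bar>N\<bar>}. real j * real (nat \<bar>N\<bar> - j) * (cmod (word_poly d i (N - sgn N * int j) (- (sgn N * int j))))\<^sup>2)"
    if "N \<in> F" for N i
  proof -
    define M where "M = nat \<bar>N\<bar>"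
    have M: "M \<ge> d + 4" "real M = \<bar>real_of_int N\<bar>" using F(2)[OF that] by (auto simp: M_def)
    have N: "N \<noteq> 0" using F(2)[OF that] by auto
    define c where "c t = word_coeff (A i) d t N * of_int (- sgn N) ^ t" for t
    have "cmod (c d) = cmod (word_coeff (A i) d d N)"
      using N by (simp add: c_def norm_mult norm_power sgn_if)
    moreover have "(\<Sum>t\<le>d. c t * of_nat j ^ t) = word_poly d i (N - sgn N * int j) (- (sgn N * int j))" for j
    proof -
      have "of_int (- (sgn N * int j)) ^ t = (of_int (- sgn N) ^ t * of_nat j ^ t :: complex)" for t
        by (simp flip: power_mult_distrib)
      then show ?thesis unfolding word_poly_def c_def by (simp add: mult.assoc)
    qed
    ultimately show ?thesis
      using weighted_polynomial_lower_bound[OF M(1), of c] by (simp add: M K_def M_def[symmetric])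
  qed
  have pair: "2 * (real j * real (nat \<bar>N\<bar> - j) * (\<Sum>i\<in>UNIV. (cmod (word_poly d i (N - sgn N * int j) (- (sgn N * int j))))\<^sup>2))
      \<le> g (h (N, j))" if "(N, j) \<in> T" for N j
  proof -
    define k n where "k = N - sgn N * int j" and "n = - (sgn N * int j)"
    have j: "1 \<le> j" "int j < \<bar>N\<bar>" "N \<noteq> 0" using that F(2)[of N] by (auto simp: T_def)
    have "\<bar>real_of_int n\<bar> = real j" using j by (simp add: n_def abs_mult sgn_if)
    moreover have "\<bar>real_of_int k\<bar> = real (nat \<bar>N\<bar> - j)"
      using j by (cases "N > 0") (auto simp: k_def sgn_if)
    ultimately have "real j * real (nat \<bar>N\<bar> - j) \<le> (root_diag l k * root_diag l n - root_off l k * root_off l n)\<^sup>2"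
      using root_product_lower_bound[OF l, of k n] by (simp add: mult.commute)
    then have "2 * (real j * real (nat \<bar>N\<bar> - j)) * (\<Sum>i\<in>UNIV. (cmod (word_poly d i k n))\<^sup>2)
        \<le> 2 * (root_diag l k * root_diag l n - root_off l k * root_off l n)\<^sup>2 * (\<Sum>i\<in>UNIV. (cmod (word_poly d i k n))\<^sup>2)"
      by (intro mult_right_mono sum_nonneg) auto
    then show ?thesis by (simp add: g_def h_def k_def n_def mult.assoc)
  qed
  have opp: "(k \<ge> 0) \<noteq> (n \<ge> 0)" if kn: "(k, n) \<in> h ` T" for k n
  proof -
    obtain N j where "(N, j) \<in> T" "h (N, j) = (k, n)" using kn by auto
    then have "k = N - sgn N * int j" "n = - (sgn N * int j)" "1 \<le> j" "int j < \<bar>N\<bar>" "N \<noteq> 0"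
      using F(2)[of N] by (auto simp: T_def h_def)
    then show ?thesis by (cases "N > 0") (auto simp: sgn_if)
  qed
  have "(\<Sum>N\<in>F. \<Sum>i\<in>UNIV. \<bar>real_of_int N\<bar> ^ (2 * d + 3) * (cmod (word_coeff (A i) d d N))\<^sup>2 / K)
      \<le> (\<Sum>N\<in>F. \<Sum>i\<in>UNIV. \<Sum>j\<in>{1..<nat \<bar>N\<bar>}. real j * real (nat \<bar>N\<bar> - j) * (cmod (word_poly d i (N - sgn N * int j) (- (sgn N * int j))))\<^sup>2)"
    by (intro sum_mono one)
  also have "\<dots> = (\<Sum>N\<in>F. \<Sum>j\<in>{1..<nat \<bar>N\<bar>}. real j * real (nat \<bar>N\<bar> - j) * (\<Sum>i\<in>UNIV. (cmod (word_poly d i (N - sgn N * int j) (- (sgn N * int j))))\<^sup>2))"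
    by (simp add: sum_bdry sum.distrib distrib_left)
  also have "\<dots> = (\<Sum>(N, j)\<in>T. real j * real (nat \<bar>N\<bar> - j) * (\<Sum>i\<in>UNIV. (cmod (word_poly d i (N - sgn N * int j) (- (sgn N * int j))))\<^sup>2))"
    unfolding T_def by (rule sum.Sigma) (use F(1) in auto)
  also have "\<dots> \<le> (\<Sum>z\<in>T. g (h z) / 2)"
    by (intro sum_mono) (use pair in fastforce)
  also have "\<dots> = (\<Sum>z\<in>h ` T. g z) / 2"
    by (simp add: sum.reindex[OF inj] sum_divide_distrib)
  also have "\<dots> \<le> Re (op_trace (power_diff l a (2 * Suc d))) / 2"
    using op_trace_ge_pairs[OF finite_imageI[OF fT] opp, of h d] unfolding g_def by simp
  finally have "(\<Sum>N\<in>F. \<Sum>i\<in>UNIV. \<bar>real_of_int N\<bar> ^ (2 * d + 3) * (cmod (word_coeff (A i) d d N))\<^sup>2) / K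
      \<le> Re (op_trace (power_diff l a (2 * Suc d))) / 2"
    by (simp add: sum_divide_distrib)
  then show ?thesis unfolding K_def[symmetric] using K by (simp add: field_simps)
qed

lemma word_poly_0: "word_poly 0 i k n = A i (k - n)"
  by (simp add: word_poly_def)

text \<open>
  At frequency \<open>0\<close> the two entries of \<open>G\<close> coincide, and the entry joining the two components is a
  multiple of the sum of the two mean values.
\<close>
lemma zero_mode:
  assumes pos: "\<And>i. Im (A i 0) = 0" "\<And>i. Re (A i 0) \<ge> 0"
  shows "(\<Sum>i\<in>UNIV. (cmod (A i 0))\<^sup>2) \<le> 2 * l\<^sup>2 * Re (op_trace (power_diff l a 2))"
proof -
  define p q where "p = (Lower, 0 :: int)" and "q = (Upper, 0 :: int)"
  have k: "1 - kappa p * kappa q = 2" by (simp add: p_def q_def kappa_def sgn_idx_def)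
  have dd: "complex_of_real (root_diag l 0) * of_real (root_diag l 0) = of_real (1 / (2 * l))"
    using root_diag_sq[OF l, of 0] by (simp only: power2_eq_square of_real_mult[symmetric]) simp
  have oo: "root_off l 0 = root_diag l 0" by (simp add: root_off_def)
  have "sandwich l (core 0 UNIV) p q
      = - (of_real (root_diag l 0) * of_real (root_diag l 0) * (A Lower 0 + A Upper 0))"
    by (simp add: sandwich_def sum_bdry p_def q_def root_mat_def oo a_mat_def toeplitz_def id_sym_def algebra_simps)
  then have "cmod (sandwich l (core 0 UNIV) p q) = 1 / (2 * l) * cmod (A Lower 0 + A Upper 0)"
    unfolding dd using l by (simp add: norm_mult norm_divide)
  then have sq: "(cmod (sandwich l (core 0 UNIV) p q))\<^sup>2 = 1 / (4 * l\<^sup>2) * (cmod (A Lower 0 + A Upper 0))\<^sup>2"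
    by (simp add: power_mult_distrib power_divide)
  have "2 * (cmod (sandwich l (core 0 UNIV) p q))\<^sup>2 \<le> Re (op_trace (power_diff l a 2))"
    using op_trace_lower_bound[OF a, of "{(p, q)}" 0] by (simp add: k numeral_2_eq_2)
  moreover have "(\<Sum>i\<in>UNIV. (cmod (A i 0))\<^sup>2) \<le> (cmod (A Lower 0 + A Upper 0))\<^sup>2"
    using pos(1)[of Lower] pos(1)[of Upper] mult_nonneg_nonneg[OF pos(2)[of Lower] pos(2)[of Upper]]
    unfolding sum_bdry cmod_power2 by (simp add: power2_eq_square algebra_simps)
  ultimately show ?thesis using l unfolding sq by (simp add: field_simps)
qed

text \<open>
  One pair of frequencies of opposite sign for each difference \<open>N\<close> is enough, if it splits \<open>N\<close> into nearly
  equal halves.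
\<close>
lemma nonzero_modes:
  assumes F: "finite F" "0 \<notin> F"
  shows "(\<Sum>N\<in>F. (wt N)\<^sup>2 * (\<Sum>i\<in>UNIV. (cmod (A i N))\<^sup>2)) \<le> 1 / (2 * low_const l) * Re (op_trace (power_diff l a 2))"
proof -
  define h where "h N = (N div 2, N div 2 - N)" for N :: int
  define g where "g = (\<lambda>(k, n). 2 * (root_diag l k * root_diag l n - root_off l k * root_off l n)\<^sup>2
      * (\<Sum>i\<in>UNIV. (cmod (word_poly 0 i k n))\<^sup>2))"
  have c: "low_const l > 0" by (rule low_const_pos[OF l])
  have inj: "inj_on h F" by (auto simp: inj_on_def h_def)
  have opp: "(k \<ge> 0) \<noteq> (n \<ge> 0)" if kn: "(k, n) \<in> h ` F" for k n
  proof -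
    obtain N where N: "N \<in> F" "k = N div 2" "n = N div 2 - N" using kn by (auto simp: h_def)
    then have "N \<noteq> 0" using F(2) by auto
    then show ?thesis unfolding N(2,3) by linarith
  qed
  have "(\<Sum>N\<in>F. 2 * low_const l * ((wt N)\<^sup>2 * (\<Sum>i\<in>UNIV. (cmod (A i N))\<^sup>2))) \<le> (\<Sum>N\<in>F. g (h N))"
  proof (intro sum_mono)
    fix N assume "N \<in> F"
    then have N: "N \<noteq> 0" using F(2) by auto
    have "2 * (low_const l * (wt N)\<^sup>2) * (\<Sum>i\<in>UNIV. (cmod (A i N))\<^sup>2) \<le> g (h N)"
      unfolding g_def h_def prod.case word_poly_0 diff_diff_eq2 add_diff_cancel_left'
      using root_product_lower_bound_low[OF l N] by (intro mult_right_mono mult_left_mono sum_nonneg) auto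
    then show "2 * low_const l * ((wt N)\<^sup>2 * (\<Sum>i\<in>UNIV. (cmod (A i N))\<^sup>2)) \<le> g (h N)" by (simp add: mult_ac)
  qed
  also have "\<dots> = (\<Sum>z\<in>h ` F. g z)" by (simp add: sum.reindex[OF inj])
  also have "\<dots> \<le> Re (op_trace (power_diff l a 2))"
    using op_trace_ge_pairs[OF finite_imageI[OF F(1)] opp, of h 0] unfolding g_def by (simp add: numeral_2_eq_2)
  finally show ?thesis using c by (simp add: sum_distrib_left[symmetric] field_simps)
qed

lemma sum_coeff_sq_le:
  assumes pos: "\<And>i. Im (A i 0) = 0" "\<And>i. Re (A i 0) \<ge> 0"
  shows "(\<Sum>\<^sub>\<infinity>N. cmod (A i N))\<^sup>2
    \<le> (\<Sum>\<^sub>\<infinity>k. 1 / wt k ^ 2) * (2 * l\<^sup>2 + 1 / (2 * low_const l)) * Re (op_trace (power_diff l a 2))"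
proof -
  define Z where "Z = Re (op_trace (power_diff l a 2))"
  define W where "W = (\<Sum>\<^sub>\<infinity>k. 1 / wt k ^ 2)"
  define B where "B = W * (2 * l\<^sup>2 + 1 / (2 * low_const l)) * Z"
  have Z: "Z \<ge> 0" using op_trace_nonneg[of 0] by (simp add: Z_def numeral_2_eq_2)
  have W: "W \<ge> 0" unfolding W_def by (intro infsum_nonneg) auto
  have c: "low_const l > 0" by (rule low_const_pos[OF l])
  have B: "B \<ge> 0" using Z W c by (simp add: B_def)
  have "(\<Sum>\<^sub>\<infinity>N. cmod (A i N)) \<le> sqrt B"
  proof (rule infsum_le_finite_sums[OF rapid_abs_summable[OF rapid_A]])
    fix F :: "int set" assume F: "finite F" "F \<subseteq> UNIV"
    have "(\<Sum>N\<in>F. (wt N)\<^sup>2 * (cmod (A i N))\<^sup>2) \<le> (\<Sum>N\<in>F. (wt N)\<^sup>2 * (\<Sum>i\<in>UNIV. (cmod (A i N))\<^sup>2))"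
      by (intro sum_mono mult_left_mono member_le_sum) auto
    also have "\<dots> \<le> (\<Sum>N\<in>insert 0 (F - {0}). (wt N)\<^sup>2 * (\<Sum>i\<in>UNIV. (cmod (A i N))\<^sup>2))"
      using F by (intro sum_mono2) (auto intro!: mult_nonneg_nonneg sum_nonneg)
    also have "\<dots> = (\<Sum>i\<in>UNIV. (cmod (A i 0))\<^sup>2) + (\<Sum>N\<in>F - {0}. (wt N)\<^sup>2 * (\<Sum>i\<in>UNIV. (cmod (A i N))\<^sup>2))"
      using F by (subst sum.insert) (auto simp: wt_def)
    also have "\<dots> \<le> 2 * l\<^sup>2 * Z + 1 / (2 * low_const l) * Z"
      unfolding Z_def using F by (intro add_mono zero_mode[OF pos] nonzero_modes) auto
    finally have 1: "(\<Sum>N\<in>F. (wt N)\<^sup>2 * (cmod (A i N))\<^sup>2) \<le> (2 * l\<^sup>2 + 1 / (2 * low_const l)) * Z"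
      by (simp add: distrib_right)
    have 2: "(\<Sum>N\<in>F. 1 / wt N ^ 2) \<le> W"
      unfolding W_def by (rule finite_sum_le_infsum[OF summable_wt F]) auto
    have "(\<Sum>N\<in>F. cmod (A i N))\<^sup>2 = (\<Sum>N\<in>F. (1 / wt N) * (wt N * cmod (A i N)))\<^sup>2" by simp
    also have "\<dots> \<le> (\<Sum>N\<in>F. (1 / wt N)\<^sup>2) * (\<Sum>N\<in>F. (wt N * cmod (A i N))\<^sup>2)"
      by (rule Cauchy_Schwarz_ineq_sum)
    also have "\<dots> \<le> W * ((2 * l\<^sup>2 + 1 / (2 * low_const l)) * Z)"
      using 1 2 W by (intro mult_mono) (auto simp: power_divide power_mult_distrib intro!: sum_nonneg)
    finally have "(\<Sum>N\<in>F. cmod (A i N))\<^sup>2 \<le> B" by (simp add: B_def)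
    then show "(\<Sum>N\<in>F. cmod (A i N)) \<le> sqrt B" by (rule real_le_rsqrt)
  qed
  then have "(\<Sum>\<^sub>\<infinity>N. cmod (A i N))\<^sup>2 \<le> (sqrt B)\<^sup>2"
    by (intro power_mono infsum_nonneg) auto
  then show ?thesis using B by (simp add: B_def W_def Z_def)
qed

lemma finite_sobolev_bound:
  assumes pos: "\<And>i. Im (A i 0) = 0" "\<And>i. Re (A i 0) \<ge> 0" and F: "finite F"
  shows "(\<Sum>N\<in>F. \<Sum>i\<in>UNIV. (1 + \<bar>real_of_int N\<bar> ^ (2 * d + 3)) * (cmod (word_coeff (A i) d d N))\<^sup>2)
    \<le> 2 * (2 * (real d + 4) + 1) * (1 + (real d + 4) ^ (2 * d + 3))
        * ((\<Sum>\<^sub>\<infinity>k. 1 / wt k ^ 2) * (2 * l\<^sup>2 + 1 / (2 * low_const l))) ^ Suc d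
        * Re (op_trace (power_diff l a 2)) ^ Suc d
      + 4 ^ d * (2 * (real d + 4)) ^ (2 * d + 3) * Re (op_trace (power_diff l a (2 * Suc d)))"
proof -
  define Q where "Q = (\<Sum>\<^sub>\<infinity>k. 1 / wt k ^ 2) * (2 * l\<^sup>2 + 1 / (2 * low_const l)) * Re (op_trace (power_diff l a 2))"
  define f where "f N i = (1 + \<bar>real_of_int N\<bar> ^ (2 * d + 3)) * (cmod (word_coeff (A i) d d N))\<^sup>2" for N i
  define F1 F2 where "F1 = {N \<in> F. \<bar>N\<bar> < int (d + 4)}" and "F2 = {N \<in> F. \<bar>N\<bar> \<ge> int (d + 4)}"
  have w: "(cmod (word_coeff (A i) d d N))\<^sup>2 \<le> Q ^ Suc d" for i N
  proof -
    have "(cmod (word_coeff (A i) d d N))\<^sup>2 \<le> ((\<Sum>\<^sub>\<infinity>k. cmod (A i k)) ^ Suc d)\<^sup>2"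
      by (intro power_mono cmod_word_coeff_le rapid_A) simp
    also have "\<dots> = ((\<Sum>\<^sub>\<infinity>k. cmod (A i k))\<^sup>2) ^ Suc d"
      by (simp only: power_mult[symmetric] mult.commute)
    also have "\<dots> \<le> Q ^ Suc d"
      unfolding Q_def by (intro power_mono sum_coeff_sq_le[OF pos]) auto
    finally show ?thesis .
  qed
  have Q0: "Q ^ Suc d \<ge> 0" by (rule order_trans[OF zero_le_power2 w])
  have "(\<Sum>N\<in>F1. \<Sum>i\<in>UNIV. f N i) \<le> (\<Sum>N\<in>F1. \<Sum>i\<in>(UNIV::bdry set). (1 + (real d + 4) ^ (2 * d + 3)) * Q ^ Suc d)"
    unfolding f_def
  proof (intro sum_mono mult_mono w)
    fix N assume "N \<in> F1"
    then have "real_of_int \<bar>N\<bar> \<le> real_of_int (int (d + 4))"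
      unfolding of_int_le_iff by (simp add: F1_def)
    then have "\<bar>real_of_int N\<bar> \<le> real d + 4" by simp
    then show "1 + \<bar>real_of_int N\<bar> ^ (2 * d + 3) \<le> 1 + (real d + 4) ^ (2 * d + 3)"
      by (intro add_left_mono power_mono) auto
  qed (auto intro!: add_nonneg_nonneg)
  also have "\<dots> = real (card F1) * (2 * ((1 + (real d + 4) ^ (2 * d + 3)) * Q ^ Suc d))"
    by (simp add: UNIV_bdry)
  also have "\<dots> \<le> (2 * (real d + 4) + 1) * (2 * ((1 + (real d + 4) ^ (2 * d + 3)) * Q ^ Suc d))"
  proof (rule mult_right_mono)
    have "F1 \<subseteq> {- int (d + 4)..int (d + 4)}" by (auto simp: F1_def)
    then have "card F1 \<le> card {- int (d + 4)..int (d + 4)}" by (intro card_mono) auto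
    then show "real (card F1) \<le> 2 * (real d + 4) + 1" by simp
  qed (use Q0 in \<open>auto intro!: mult_nonneg_nonneg add_nonneg_nonneg\<close>)
  finally have low: "(\<Sum>N\<in>F1. \<Sum>i\<in>UNIV. f N i) \<le> (2 * (real d + 4) + 1) * (2 * ((1 + (real d + 4) ^ (2 * d + 3)) * Q ^ Suc d))" .
  have "(\<Sum>N\<in>F2. \<Sum>i\<in>UNIV. f N i)
      \<le> (\<Sum>N\<in>F2. \<Sum>i\<in>UNIV. 2 * (\<bar>real_of_int N\<bar> ^ (2 * d + 3) * (cmod (word_coeff (A i) d d N))\<^sup>2))"
  proof (intro sum_mono)
    fix N i assume "N \<in> F2"
    then have "real_of_int 1 \<le> real_of_int \<bar>N\<bar>" unfolding of_int_le_iff by (simp add: F2_def)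
    then have "1 \<le> \<bar>real_of_int N\<bar> ^ (2 * d + 3)" by (intro one_le_power) simp
    then have "1 + \<bar>real_of_int N\<bar> ^ (2 * d + 3) \<le> 2 * \<bar>real_of_int N\<bar> ^ (2 * d + 3)" by simp
    from mult_right_mono[OF this, of "(cmod (word_coeff (A i) d d N))\<^sup>2"]
    show "f N i \<le> 2 * (\<bar>real_of_int N\<bar> ^ (2 * d + 3) * (cmod (word_coeff (A i) d d N))\<^sup>2)"
      by (simp add: f_def mult.assoc)
  qed
  also have "\<dots> = 2 * (\<Sum>N\<in>F2. \<Sum>i\<in>UNIV. \<bar>real_of_int N\<bar> ^ (2 * d + 3) * (cmod (word_coeff (A i) d d N))\<^sup>2)"
    by (simp add: sum_distrib_left)
  also have "\<dots> \<le> 2 * (4 ^ d * (2 * (real d + 4)) ^ (2 * d + 3) / 2 * Re (op_trace (power_diff l a (2 * Suc d))))"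
    using F by (intro mult_left_mono high_modes) (auto simp: F2_def)
  finally have high: "(\<Sum>N\<in>F2. \<Sum>i\<in>UNIV. f N i)
      \<le> 4 ^ d * (2 * (real d + 4)) ^ (2 * d + 3) * Re (op_trace (power_diff l a (2 * Suc d)))" by simp
  have "F1 \<union> F2 = F" "F1 \<inter> F2 = {}" "finite F1" "finite F2" using F by (auto simp: F1_def F2_def)
  then have "(\<Sum>N\<in>F. \<Sum>i\<in>UNIV. f N i) = (\<Sum>N\<in>F1. \<Sum>i\<in>UNIV. f N i) + (\<Sum>N\<in>F2. \<Sum>i\<in>UNIV. f N i)"
    using sum.union_disjoint[of F1 F2 "\<lambda>N. \<Sum>i\<in>UNIV. f N i"] by (simp only:)
  with low high have "(\<Sum>N\<in>F. \<Sum>i\<in>UNIV. f N i)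
      \<le> (2 * (real d + 4) + 1) * (2 * ((1 + (real d + 4) ^ (2 * d + 3)) * Q ^ Suc d))
        + 4 ^ d * (2 * (real d + 4)) ^ (2 * d + 3) * Re (op_trace (power_diff l a (2 * Suc d)))"
    by linarith
  moreover have "(2 * (real d + 4) + 1) * (2 * ((1 + (real d + 4) ^ (2 * d + 3)) * (P * R)))
      = 2 * (2 * (real d + 4) + 1) * (1 + (real d + 4) ^ (2 * d + 3)) * P * R" for P R
    by (simp only: mult_ac)
  ultimately show ?thesis
    unfolding f_def Q_def power_mult_distrib[of "_ * _" "Re _"] by (simp only:)
qed

end

end

theorem proposition5p3:
  fixes m :: nat
  assumes "m \<ge> 1"
  shows "\<exists>d'::real. d' > 0 \<and> (\<forall>l::real. l > 0 \<longrightarrow> (\<exists>d::real. d > 0 \<and>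
    (\<forall>a :: real bdry_fun. smooth_bdry a \<and> (\<forall>i \<theta>. a i \<theta> > 0) \<longrightarrow>
      sobolev_norm_sq (real m + 1/2) (\<lambda>i \<theta>. complex_of_real (a i \<theta> ^ m))
        \<le> d * Re (op_trace (power_diff l a 2)) ^ m
          + d' * Re (op_trace (power_diff l a (2 * m))))))"
proof -
  obtain d where m: "m = Suc d" using assms by (cases m) auto
  define K where "K = (4 ^ d * (2 * (real d + 4)) ^ (2 * d + 3) :: real)"
  have K: "K > 0" by (simp add: K_def)
  show ?thesis
  proof (rule exI[of _ K], intro conjI K allI impI)
    fix l :: real assume l: "l > 0"
    define W where "W = (\<Sum>\<^sub>\<infinity>k. 1 / wt k ^ 2)"
    define C where "C = 2 * (2 * (real d + 4) + 1) * (1 + (real d + 4) ^ (2 * d + 3))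
        * (W * (2 * l\<^sup>2 + 1 / (2 * low_const l))) ^ Suc d"
    have "W \<ge> 1"
      using finite_sum_le_infsum[OF summable_wt, of "{0}"] by (simp add: W_def wt_def)
    then have "W * (2 * l\<^sup>2 + 1 / (2 * low_const l)) > 0"
      using l low_const_pos[OF l] by (intro mult_pos_pos add_pos_pos) auto
    then have pos: "(W * (2 * l\<^sup>2 + 1 / (2 * low_const l))) ^ Suc d > 0" by (rule zero_less_power)
    have C: "C > 0" unfolding C_def by (intro mult_pos_pos pos) (simp_all add: add_pos_nonneg)
    show "\<exists>C>0. \<forall>a. smooth_bdry a \<and> (\<forall>i \<theta>. a i \<theta> > 0) \<longrightarrow>
        sobolev_norm_sq (real m + 1/2) (\<lambda>i \<theta>. complex_of_real (a i \<theta> ^ m))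
          \<le> C * Re (op_trace (power_diff l a 2)) ^ m + K * Re (op_trace (power_diff l a (2 * m)))"
    proof (intro exI[of _ C] conjI C allI impI)
      fix a :: "real bdry_fun" assume "smooth_bdry a \<and> (\<forall>i \<theta>. a i \<theta> > 0)"
      then have sm: "smooth_circle (a i)" and ap: "a i \<theta> > 0" for i \<theta> by (auto simp: smooth_bdry_def)
      define A where "A i = fourier_coeff (\<lambda>\<theta>. of_real (a i \<theta>))" for i
      have rA: "rapid (A i)" and aA: "of_real (a i \<theta>) = fourier_series (A i) \<theta>" and Am: "A i (- k) = cnj (A i k)" for i \<theta> k
        unfolding A_def by (rule smooth_circle_fourier[OF sm])+
      interpret boundary_weight l A by unfold_locales (use l rA Am in auto)
      have Im0: "Im (A i 0) = 0" for i
        using Am[of i 0] by (simp add: complex_eq_iff)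
      have Re0: "Re (A i 0) \<ge> 0" for i
      proof -
        have "((\<lambda>\<theta>. complex_of_real (a i \<theta>)) has_integral of_real (2 * pi) * A i 0) {0..2 * pi}"
          unfolding aA by (rule integral_fourier_series[OF rA, of i])
        from has_integral_Re[OF this] have "((\<lambda>\<theta>. a i \<theta>) has_integral 2 * pi * Re (A i 0)) {0..2 * pi}"
          by simp
        from has_integral_nonneg[OF this] ap[of i] have "0 \<le> 2 * pi * Re (A i 0)" by (simp add: less_imp_le)
        then show ?thesis using pi_gt_zero by (simp add: zero_le_mult_iff)
      qed
      define g where "g i N = (1 + \<bar>real_of_int N\<bar> ^ (2 * d + 3)) * (cmod (word_coeff (A i) d d N))\<^sup>2" for i N
      define B where "B = C * Re (op_trace (power_diff l a 2)) ^ m + K * Re (op_trace (power_diff l a (2 * m)))"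
      have g0: "g i N \<ge> 0" for i N by (simp add: g_def)
      have fin: "(\<Sum>N\<in>F. \<Sum>i\<in>UNIV. g i N) \<le> B" if "finite F" for F
        using finite_sobolev_bound[OF aA Im0 Re0 that, of d] by (simp add: g_def B_def C_def K_def W_def m)
      have sg: "g i summable_on UNIV" for i
      proof (rule nonneg_bounded_partial_sums_imp_summable_on[where C = B])
        show "\<forall>\<^sub>F X in finite_subsets_at_top UNIV. sum (g i) X \<le> B"
        proof (rule eventually_finite_subsets_at_top_weakI)
          fix X :: "int set" assume "finite X"
          have "sum (g i) X \<le> (\<Sum>N\<in>X. \<Sum>i\<in>UNIV. g i N)"
            by (intro sum_mono member_le_sum) (auto simp: g0)
          also have "\<dots> \<le> B" by (rule fin[OF \<open>finite X\<close>])
          finally show "sum (g i) X \<le> B" .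
        qed
      qed (rule g0)
      have coeff: "fourier_coeff (\<lambda>\<theta>. complex_of_real (a i \<theta> ^ m)) = word_coeff (A i) d d" for i
      proof -
        have "(\<lambda>\<theta>. complex_of_real (a i \<theta> ^ m)) = fourier_series (word_coeff (A i) d d)"
          by (rule ext) (simp only: of_real_power aA fourier_series_word_coeff[OF rA] m)
        then show ?thesis using fourier_coeff_fourier_series[OF rapid_word_coeff[OF rA]] by auto
      qed
      have pw: "\<bar>real_of_int N\<bar> powr (2 * (real m + 1 / 2)) = \<bar>real_of_int N\<bar> ^ (2 * d + 3)" for N
      proof (cases "N = 0")
        case False
        have e: "2 * (real m + 1 / 2) = real (2 * d + 3)" by (simp add: m)
        show ?thesis unfolding e using False by (intro powr_realpow) simp
      qed (simp add: power_0_left)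
      have "sobolev_norm_sq (real m + 1/2) (\<lambda>i \<theta>. complex_of_real (a i \<theta> ^ m)) = (\<Sum>i\<in>UNIV. \<Sum>\<^sub>\<infinity>N. g i N)"
        unfolding sobolev_norm_sq_def circle_sobolev_norm_sq_def coeff pw g_def UNIV_bdry[symmetric] ..
      also have "\<dots> = (\<Sum>\<^sub>\<infinity>N. \<Sum>i\<in>UNIV. g i N)"
        unfolding sum_bdry by (rule infsum_add[OF sg sg, symmetric])
      also have "\<dots> \<le> B"
        unfolding sum_bdry
        by (rule infsum_le_finite_sums[OF summable_on_add[OF sg sg]]) (use fin in \<open>simp add: sum_bdry\<close>)
      finally show "sobolev_norm_sq (real m + 1/2) (\<lambda>i \<theta>. complex_of_real (a i \<theta> ^ m))
          \<le> C * Re (op_trace (power_diff l a 2)) ^ m + K * Re (op_trace (power_diff l a (2 * m)))"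
        unfolding B_def .
    qed
  qed
qed

end
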